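(* Let $\mathcal{E}$ be an elementary topos, let $L$ be an intermediate logic specified by an axiom $\top\vdash_{\vec{x}}\top=\phi_{L}$, where $\phi_{L}$ is a term obtained by applying the operation $\vee$ to terms only involving the connectives $\wedge$, $\Rightarrow$ and $\neg$, and let $j^{\mathcal{E}}_{L}$ be the $L$-topology on $\mathcal{E}$. Then: (i) $j^{\mathcal{E}}_{L}\leq\neg\neg$; (ii) $\mathbf{sh}_{j^{\mathcal{E}}_{L}}(\mathcal{E})$ satisfies $L$; (iii) for every implicationally open (resp. weakly open, if the connective $\Rightarrow$ does not appear in the term $\phi_{L}$) local operator $j$ on $\mathcal{E}$, $j\geq j^{\mathcal{E}}_{L}$ if and only if $\mathbf{sh}_{j}(\mathcal{E})$ satisfies $L$.
   Context: An intermediate logic $L$ is a propositional logic between intuitionistic and classical logic; here it is obtained from intuitionistic logic by adding a single axiom scheme, presented by a sequent $\top\vdash_{\vec{x}}\top=\phi_{L}(\vec{x})$, where $\phi_{L}(\vec{x})$ is a term, in $n$ variables $\vec{x}$, in the theory of Heyting algebras (signature: constants $0,1$, unary operation $\neg$, binary operations $\vee,\wedge,\Rightarrow$). For an elementary topos $\mathcal{E}$ with subobject classifier $\Omega$ (an internal Heyting algebra), let $f_{L}:\Omega^{n}\to\Omega$ be the interpretation of the term $\phi_{L}$ in $\Omega$ and $g_{L}:\Omega^{n}\to\Omega$ the composite of the unique arrow $\Omega^{n}\to 1$ with the truth value $\top:1\to\Omega$. The topos $\mathcal{E}$ satisfies $L$ if the internal Heyting algebra $\Omega$ satisfies the sequent,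 i.e. if the equalizer of $f_{L}$ and $g_{L}$ is an isomorphism. The $L$-topology $j^{\mathcal{E}}_{L}$ on $\mathcal{E}$ is the smallest local operator $j$ on $\mathcal{E}$ such that the equalizer of $f_{L}$ and $g_{L}$ (a subobject of $\Omega^{n}$) is $j$-dense (such a smallest operator always exists). For a local operator (Lawvere–Tierney topology) $j$, $\mathbf{sh}_{j}(\mathcal{E})$ is the topos of $j$-sheaves and $a_{j}:\mathcal{E}\to\mathbf{sh}_{j}(\mathcal{E})$ the associated sheaf functor. Local operators are ordered pointwise, so that $j\ge k$ if and only if $\mathbf{sh}_{j}(\mathcal{E})\subseteq\mathbf{sh}_{k}(\mathcal{E})$; $\neg\neg$ is the double negation local operator. A local operator $j$ is weakly open if $a_{j}$ preserves the pseudocomplementation of subobjects, and implicationally open if $a_{j}$ preserves the Heyting implication of subobjects. *)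

theory Defs
  imports Main
begin

section \<open>Categories and finite limits\<close>

record ('o, 'a) cat =
  Ob :: "'o set"
  Ar :: "'a set"
  Dom :: "'a \<Rightarrow> 'o"
  Cod :: "'a \<Rightarrow> 'o"
  Ide :: "'o \<Rightarrow> 'a"
  Cmp :: "'a \<Rightarrow> 'a \<Rightarrow> 'a" (infixl "\<cdot>\<index>" 70)

definition hom :: "('o, 'a, 'm) cat_scheme \<Rightarrow> 'o \<Rightarrow> 'o \<Rightarrow> 'a set" where
  "hom C A B = {f \<in> Ar C. Dom C f = A \<and> Cod C f = B}"

locale category =
  fixes C :: "('o, 'a, 'm) cat_scheme" (structure)
  assumes dom_in: "f \<in> Ar C \<Longrightarrow> Dom C f \<in> Ob C"
    and cod_in: "f \<in> Ar C \<Longrightarrow> Cod C f \<in> Ob C"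
    and ide_in: "A \<in> Ob C \<Longrightarrow> Ide C A \<in> hom C A A"
    and cmp_in: "\<lbrakk>f \<in> hom C A B; g \<in> hom C B D\<rbrakk> \<Longrightarrow> g \<cdot> f \<in> hom C A D"
    and ide_left: "f \<in> hom C A B \<Longrightarrow> Ide C B \<cdot> f = f"
    and ide_right: "f \<in> hom C A B \<Longrightarrow> f \<cdot> Ide C A = f"
    and cmp_assoc: "\<lbrakk>f \<in> hom C A B; g \<in> hom C B D; h \<in> hom C D E\<rbrakk> \<Longrightarrow> h \<cdot> (g \<cdot> f) = (h \<cdot> g) \<cdot> f"

definition monic :: "('o, 'a, 'm) cat_scheme \<Rightarrow> 'a \<Rightarrow> bool" where
  "monic C m \<longleftrightarrow> m \<in> Ar C \<and>
     (\<forall>X\<in>Ob C. \<forall>f\<in>hom C X (Dom C m). \<forall>g\<in>hom C X (Dom C m). m \<cdot>\<^bsub>C\<^esub> f = m \<cdot>\<^bsub>C\<^esub> g \<longrightarrow> f = g)"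

definition iso :: "('o, 'a, 'm) cat_scheme \<Rightarrow> 'a \<Rightarrow> bool" where
  "iso C f \<longleftrightarrow> f \<in> Ar C \<and>
     (\<exists>g\<in>hom C (Cod C f) (Dom C f). g \<cdot>\<^bsub>C\<^esub> f = Ide C (Dom C f) \<and> f \<cdot>\<^bsub>C\<^esub> g = Ide C (Cod C f))"

definition terminal :: "('o, 'a, 'm) cat_scheme \<Rightarrow> 'o \<Rightarrow> bool" where
  "terminal C T \<longleftrightarrow> T \<in> Ob C \<and> (\<forall>X\<in>Ob C. \<exists>!u. u \<in> hom C X T)"

definition is_product ::
    "('o, 'a, 'm) cat_scheme \<Rightarrow> nat \<Rightarrow> (nat \<Rightarrow> 'o) \<Rightarrow> 'o \<Rightarrow> (nat \<Rightarrow> 'a) \<Rightarrow> bool" where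
  "is_product C n A P p \<longleftrightarrow> P \<in> Ob C \<and> (\<forall>i<n. p i \<in> hom C P (A i)) \<and>
     (\<forall>X\<in>Ob C. \<forall>f. (\<forall>i<n. f i \<in> hom C X (A i)) \<longrightarrow>
        (\<exists>!h. h \<in> hom C X P \<and> (\<forall>i<n. p i \<cdot>\<^bsub>C\<^esub> h = f i)))"

definition is_product2 ::
    "('o, 'a, 'm) cat_scheme \<Rightarrow> 'o \<Rightarrow> 'o \<Rightarrow> 'o \<Rightarrow> 'a \<Rightarrow> 'a \<Rightarrow> bool" where
  "is_product2 C A B P p q \<longleftrightarrow> P \<in> Ob C \<and> p \<in> hom C P A \<and> q \<in> hom C P B \<and>
     (\<forall>X\<in>Ob C. \<forall>f\<in>hom C X A. \<forall>g\<in>hom C X B.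
        \<exists>!h. h \<in> hom C X P \<and> p \<cdot>\<^bsub>C\<^esub> h = f \<and> q \<cdot>\<^bsub>C\<^esub> h = g)"

definition is_equalizer :: "('o, 'a, 'm) cat_scheme \<Rightarrow> 'a \<Rightarrow> 'a \<Rightarrow> 'a \<Rightarrow> bool" where
  "is_equalizer C f g e \<longleftrightarrow> f \<in> Ar C \<and> g \<in> hom C (Dom C f) (Cod C f) \<and>
     e \<in> Ar C \<and> Cod C e = Dom C f \<and> f \<cdot>\<^bsub>C\<^esub> e = g \<cdot>\<^bsub>C\<^esub> e \<and>
     (\<forall>X\<in>Ob C. \<forall>h\<in>hom C X (Dom C f). f \<cdot>\<^bsub>C\<^esub> h = g \<cdot>\<^bsub>C\<^esub> h \<longrightarrow>
        (\<exists>!k. k \<in> hom C X (Dom C e) \<and> e \<cdot>\<^bsub>C\<^esub> k = h))"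

definition is_pullback ::
    "('o, 'a, 'm) cat_scheme \<Rightarrow> 'a \<Rightarrow> 'a \<Rightarrow> 'a \<Rightarrow> 'a \<Rightarrow> bool" where
  "is_pullback C f g p q \<longleftrightarrow> f \<in> Ar C \<and> g \<in> Ar C \<and> Cod C f = Cod C g \<and>
     p \<in> Ar C \<and> q \<in> Ar C \<and> Dom C p = Dom C q \<and> Cod C p = Dom C f \<and> Cod C q = Dom C g \<and>
     f \<cdot>\<^bsub>C\<^esub> p = g \<cdot>\<^bsub>C\<^esub> q \<and>
     (\<forall>X\<in>Ob C. \<forall>h\<in>hom C X (Dom C f). \<forall>k\<in>hom C X (Dom C g). f \<cdot>\<^bsub>C\<^esub> h = g \<cdot>\<^bsub>C\<^esub> k \<longrightarrow>
        (\<exists>!u. u \<in> hom C X (Dom C p) \<and> p \<cdot>\<^bsub>C\<^esub> u = h \<and> q \<cdot>\<^bsub>C\<^esub> u = k))"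

text \<open>\<open>ev\<close> exhibits \<open>E\<close> as the exponential of \<open>B\<close> by \<open>A\<close>, where \<open>p, q\<close> exhibit \<open>P\<close> as
  \<open>E \<times> A\<close>; the arrow \<open>k\<close> is \<open>h \<times> A\<close>.\<close>

definition is_exponential ::
    "('o, 'a, 'm) cat_scheme \<Rightarrow> 'o \<Rightarrow> 'o \<Rightarrow> 'o \<Rightarrow> 'o \<Rightarrow> 'a \<Rightarrow> 'a \<Rightarrow> 'a \<Rightarrow> bool" where
  "is_exponential C A B E P p q ev \<longleftrightarrow> E \<in> Ob C \<and> is_product2 C E A P p q \<and> ev \<in> hom C P B \<and>
     (\<forall>X Q p' q' f. is_product2 C X A Q p' q' \<and> X \<in> Ob C \<and> f \<in> hom C Q B \<longrightarrow>
        (\<exists>!h. h \<in> hom C X E \<and>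
           (\<exists>k\<in>hom C Q P. p \<cdot>\<^bsub>C\<^esub> k = h \<cdot>\<^bsub>C\<^esub> p' \<and> q \<cdot>\<^bsub>C\<^esub> k = q' \<and> ev \<cdot>\<^bsub>C\<^esub> k = f)))"


section \<open>Elementary toposes\<close>

text \<open>\<open>t\<close> is a generic subobject \<open>1 \<rightarrow> \<Omega>\<close>, \<open>1 = Dom C t\<close> and \<open>\<Omega> = Cod C t\<close>.\<close>

definition is_truth :: "('o, 'a, 'm) cat_scheme \<Rightarrow> 'a \<Rightarrow> bool" where
  "is_truth C t \<longleftrightarrow> t \<in> Ar C \<and> terminal C (Dom C t) \<and>
     (\<forall>m. monic C m \<longrightarrow>
        (\<exists>!\<chi>. \<chi> \<in> hom C (Cod C m) (Cod C t) \<and>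
           (\<exists>u\<in>hom C (Dom C m) (Dom C t). is_pullback C \<chi> t m u)))"

locale elementary_topos = category C for C :: "('o, 'a, 'm) cat_scheme" (structure) +
  assumes finite_products: "(\<And>i. i < n \<Longrightarrow> A i \<in> Ob C) \<Longrightarrow> \<exists>P p. is_product C n A P p"
    and equalizers: "\<lbrakk>f \<in> hom C X Y; g \<in> hom C X Y\<rbrakk> \<Longrightarrow> \<exists>e. is_equalizer C f g e"
    and exponentials: "\<lbrakk>X \<in> Ob C; Y \<in> Ob C\<rbrakk> \<Longrightarrow> \<exists>E P p q ev. is_exponential C X Y E P p q ev"
    and subobject_classifier: "\<exists>t. is_truth C t"

text \<open>The structure below is determined up to isomorphism; a choice is fixed once for every category.\<close>

definition truth :: "('o, 'a, 'm) cat_scheme \<Rightarrow> 'a" where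
  "truth C = (SOME t. is_truth C t)"

definition one :: "('o, 'a, 'm) cat_scheme \<Rightarrow> 'o" where
  "one C = Dom C (truth C)"

definition Omega :: "('o, 'a, 'm) cat_scheme \<Rightarrow> 'o" where
  "Omega C = Cod C (truth C)"

definition to_one :: "('o, 'a, 'm) cat_scheme \<Rightarrow> 'o \<Rightarrow> 'a" where
  "to_one C X = (THE u. u \<in> hom C X (one C))"

definition Opow :: "('o, 'a, 'm) cat_scheme \<Rightarrow> nat \<Rightarrow> 'o \<times> (nat \<Rightarrow> 'a)" where
  "Opow C n = (SOME (P, p). is_product C n (\<lambda>_. Omega C) P p)"

abbreviation Omega_pow :: "('o, 'a, 'm) cat_scheme \<Rightarrow> nat \<Rightarrow> 'o" where
  "Omega_pow C n \<equiv> fst (Opow C n)"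

abbreviation proj :: "('o, 'a, 'm) cat_scheme \<Rightarrow> nat \<Rightarrow> nat \<Rightarrow> 'a" where
  "proj C n \<equiv> snd (Opow C n)"

definition pair :: "('o, 'a, 'm) cat_scheme \<Rightarrow> 'a \<Rightarrow> 'a \<Rightarrow> 'a" where
  "pair C f g = (THE h. h \<in> hom C (Dom C f) (Omega_pow C 2) \<and>
     proj C 2 0 \<cdot>\<^bsub>C\<^esub> h = f \<and> proj C 2 1 \<cdot>\<^bsub>C\<^esub> h = g)"

definition equalizer :: "('o, 'a, 'm) cat_scheme \<Rightarrow> 'a \<Rightarrow> 'a \<Rightarrow> 'a" where
  "equalizer C f g = (SOME e. is_equalizer C f g e)"

definition classifies :: "('o, 'a, 'm) cat_scheme \<Rightarrow> 'a \<Rightarrow> 'a \<Rightarrow> bool" where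
  "classifies C \<chi> m \<longleftrightarrow> monic C m \<and> \<chi> \<in> hom C (Cod C m) (Omega C) \<and>
     is_pullback C \<chi> (truth C) m (to_one C (Dom C m))"

definition Sub :: "('o, 'a, 'm) cat_scheme \<Rightarrow> 'o \<Rightarrow> 'a set" where
  "Sub C X = {m. monic C m \<and> Cod C m = X}"

definition sub_le :: "('o, 'a, 'm) cat_scheme \<Rightarrow> 'a \<Rightarrow> 'a \<Rightarrow> bool" where
  "sub_le C m k \<longleftrightarrow> (\<exists>h\<in>hom C (Dom C m) (Dom C k). k \<cdot>\<^bsub>C\<^esub> h = m)"

text \<open>The order of \<open>Hom(X, \<Omega>)\<close>, transported from \<open>Sub(X)\<close>.\<close>

definition elem_le :: "('o, 'a, 'm) cat_scheme \<Rightarrow> 'a \<Rightarrow> 'a \<Rightarrow> bool" where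
  "elem_le C f g \<longleftrightarrow> (\<exists>m k. classifies C f m \<and> classifies C g k \<and> sub_le C m k)"


section \<open>Heyting operations in a preordered set\<close>

definition is_bot :: "'x set \<Rightarrow> ('x \<Rightarrow> 'x \<Rightarrow> bool) \<Rightarrow> 'x \<Rightarrow> bool" where
  "is_bot S le z \<longleftrightarrow> z \<in> S \<and> (\<forall>d\<in>S. le z d)"

definition is_meet :: "'x set \<Rightarrow> ('x \<Rightarrow> 'x \<Rightarrow> bool) \<Rightarrow> 'x \<Rightarrow> 'x \<Rightarrow> 'x \<Rightarrow> bool" where
  "is_meet S le a b c \<longleftrightarrow> a \<in> S \<and> b \<in> S \<and> c \<in> S \<and> (\<forall>d\<in>S. le d c \<longleftrightarrow> le d a \<and> le d b)"

definition is_join :: "'x set \<Rightarrow> ('x \<Rightarrow> 'x \<Rightarrow> bool) \<Rightarrow> 'x \<Rightarrow> 'x \<Rightarrow> 'x \<Rightarrow> bool" where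
  "is_join S le a b c \<longleftrightarrow> a \<in> S \<and> b \<in> S \<and> c \<in> S \<and> (\<forall>d\<in>S. le c d \<longleftrightarrow> le a d \<and> le b d)"

definition is_himp :: "'x set \<Rightarrow> ('x \<Rightarrow> 'x \<Rightarrow> bool) \<Rightarrow> 'x \<Rightarrow> 'x \<Rightarrow> 'x \<Rightarrow> bool" where
  "is_himp S le a b c \<longleftrightarrow> a \<in> S \<and> b \<in> S \<and> c \<in> S \<and>
     (\<forall>d\<in>S. le d c \<longleftrightarrow> (\<exists>e. is_meet S le d a e \<and> le e b))"

definition is_pseudocompl :: "'x set \<Rightarrow> ('x \<Rightarrow> 'x \<Rightarrow> bool) \<Rightarrow> 'x \<Rightarrow> 'x \<Rightarrow> bool" where
  "is_pseudocompl S le a c \<longleftrightarrow> (\<exists>z. is_bot S le z \<and> is_himp S le a z c)"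


section \<open>The internal Heyting algebra of truth values\<close>

text \<open>The operations on \<open>\<Omega>\<close> are the arrows that induce, for every \<open>X\<close>, the Heyting operations of
  \<open>Hom(X, \<Omega>) \<cong> Sub(X)\<close>; by the Yoneda lemma there is exactly one such arrow for each operation.\<close>

definition is_binary_op ::
    "('o, 'a, 'm) cat_scheme \<Rightarrow> ('a set \<Rightarrow> ('a \<Rightarrow> 'a \<Rightarrow> bool) \<Rightarrow> 'a \<Rightarrow> 'a \<Rightarrow> 'a \<Rightarrow> bool) \<Rightarrow> 'a \<Rightarrow> bool" where
  "is_binary_op C R v \<longleftrightarrow> v \<in> hom C (Omega_pow C 2) (Omega C) \<and>
     (\<forall>X\<in>Ob C. \<forall>f\<in>hom C X (Omega C). \<forall>g\<in>hom C X (Omega C).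
        R (hom C X (Omega C)) (elem_le C) f g (v \<cdot>\<^bsub>C\<^esub> pair C f g))"

definition and_op :: "('o, 'a, 'm) cat_scheme \<Rightarrow> 'a" where
  "and_op C = (THE v. is_binary_op C is_meet v)"

definition or_op :: "('o, 'a, 'm) cat_scheme \<Rightarrow> 'a" where
  "or_op C = (THE v. is_binary_op C is_join v)"

definition imp_op :: "('o, 'a, 'm) cat_scheme \<Rightarrow> 'a" where
  "imp_op C = (THE v. is_binary_op C is_himp v)"

definition neg_op :: "('o, 'a, 'm) cat_scheme \<Rightarrow> 'a" where
  "neg_op C = (THE v. v \<in> hom C (Omega C) (Omega C) \<and>
     (\<forall>X\<in>Ob C. \<forall>f\<in>hom C X (Omega C). is_pseudocompl (hom C X (Omega C)) (elem_le C) f (v \<cdot>\<^bsub>C\<^esub> f)))"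

definition false_op :: "('o, 'a, 'm) cat_scheme \<Rightarrow> 'a" where
  "false_op C = (THE z. z \<in> hom C (one C) (Omega C) \<and>
     (\<forall>X\<in>Ob C. is_bot (hom C X (Omega C)) (elem_le C) (z \<cdot>\<^bsub>C\<^esub> to_one C X)))"


section \<open>Heyting terms and intermediate logics\<close>

datatype hterm =
    Var nat
  | Zero
  | One
  | Neg hterm
  | Or hterm hterm
  | And hterm hterm
  | Imp hterm hterm

primrec vars :: "hterm \<Rightarrow> nat set" where
  "vars (Var i) = {i}"
| "vars Zero = {}"
| "vars One = {}"
| "vars (Neg s) = vars s"
| "vars (Or s t) = vars s \<union> vars t"
| "vars (And s t) = vars s \<union> vars t"
| "vars (Imp s t) = vars s \<union> vars t"

primrec subst :: "(nat \<Rightarrow> hterm) \<Rightarrow> hterm \<Rightarrow> hterm" where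
  "subst \<sigma> (Var i) = \<sigma> i"
| "subst \<sigma> Zero = Zero"
| "subst \<sigma> One = One"
| "subst \<sigma> (Neg s) = Neg (subst \<sigma> s)"
| "subst \<sigma> (Or s t) = Or (subst \<sigma> s) (subst \<sigma> t)"
| "subst \<sigma> (And s t) = And (subst \<sigma> s) (subst \<sigma> t)"
| "subst \<sigma> (Imp s t) = Imp (subst \<sigma> s) (subst \<sigma> t)"

primrec imp_free :: "hterm \<Rightarrow> bool" where
  "imp_free (Var i) = True"
| "imp_free Zero = True"
| "imp_free One = True"
| "imp_free (Neg s) = imp_free s"
| "imp_free (Or s t) = (imp_free s \<and> imp_free t)"
| "imp_free (And s t) = (imp_free s \<and> imp_free t)"
| "imp_free (Imp s t) = False"

primrec and_imp_neg_term :: "hterm \<Rightarrow> bool" where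
  "and_imp_neg_term (Var i) = True"
| "and_imp_neg_term Zero = False"
| "and_imp_neg_term One = False"
| "and_imp_neg_term (Neg s) = and_imp_neg_term s"
| "and_imp_neg_term (Or s t) = False"
| "and_imp_neg_term (And s t) = (and_imp_neg_term s \<and> and_imp_neg_term t)"
| "and_imp_neg_term (Imp s t) = (and_imp_neg_term s \<and> and_imp_neg_term t)"

text \<open>Finite disjunctions \<open>t\<^sub>1 \<or> \<dots> \<or> t\<^sub>m\<close>, \<open>m \<ge> 1\<close>, arbitrarily bracketed.\<close>

inductive disjunctive :: "hterm \<Rightarrow> bool" where
  "and_imp_neg_term t \<Longrightarrow> disjunctive t"
| "\<lbrakk>disjunctive s; disjunctive t\<rbrakk> \<Longrightarrow> disjunctive (Or s t)"

text \<open>Intuitionistic propositional logic extended by the axiom schemes in \<open>Ax\<close>.\<close>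

inductive provable :: "hterm set \<Rightarrow> hterm \<Rightarrow> bool" for Ax where
  scheme: "A \<in> Ax \<Longrightarrow> provable Ax (subst \<sigma> A)"
| MP: "\<lbrakk>provable Ax (Imp A B); provable Ax A\<rbrakk> \<Longrightarrow> provable Ax B"
| K: "provable Ax (Imp A (Imp B A))"
| S: "provable Ax (Imp (Imp A (Imp B D)) (Imp (Imp A B) (Imp A D)))"
| andI: "provable Ax (Imp A (Imp B (And A B)))"
| andE1: "provable Ax (Imp (And A B) A)"
| andE2: "provable Ax (Imp (And A B) B)"
| orI1: "provable Ax (Imp A (Or A B))"
| orI2: "provable Ax (Imp B (Or A B))"
| orE: "provable Ax (Imp (Imp A D) (Imp (Imp B D) (Imp (Or A B) D)))"
| negI: "provable Ax (Imp (Imp A B) (Imp (Imp A (Neg B)) (Neg A)))"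
| negE: "provable Ax (Imp (Neg A) (Imp A B))"
| zeroE: "provable Ax (Imp Zero A)"
| oneI: "provable Ax One"

definition logic :: "hterm set \<Rightarrow> hterm set" where
  "logic Ax = {\<psi>. provable Ax \<psi>}"

definition intermediate_logic :: "hterm set \<Rightarrow> bool" where
  "intermediate_logic L \<longleftrightarrow> logic {} \<subseteq> L \<and> L \<subseteq> logic {Or (Var 0) (Neg (Var 0))}"


section \<open>Interpretation of terms and satisfaction\<close>

text \<open>The variables \<open>Var 0, \<dots>, Var (n - 1)\<close> are interpreted as the projections \<open>\<Omega>\<^sup>n \<rightarrow> \<Omega>\<close>.\<close>

primrec interp :: "('o, 'a, 'm) cat_scheme \<Rightarrow> nat \<Rightarrow> hterm \<Rightarrow> 'a" where
  "interp C n (Var i) = proj C n i"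
| "interp C n Zero = false_op C \<cdot>\<^bsub>C\<^esub> to_one C (Omega_pow C n)"
| "interp C n One = truth C \<cdot>\<^bsub>C\<^esub> to_one C (Omega_pow C n)"
| "interp C n (Neg s) = neg_op C \<cdot>\<^bsub>C\<^esub> interp C n s"
| "interp C n (Or s t) = or_op C \<cdot>\<^bsub>C\<^esub> pair C (interp C n s) (interp C n t)"
| "interp C n (And s t) = and_op C \<cdot>\<^bsub>C\<^esub> pair C (interp C n s) (interp C n t)"
| "interp C n (Imp s t) = imp_op C \<cdot>\<^bsub>C\<^esub> pair C (interp C n s) (interp C n t)"

definition axiom_equalizer :: "('o, 'a, 'm) cat_scheme \<Rightarrow> nat \<Rightarrow> hterm \<Rightarrow> 'a" where
  "axiom_equalizer C n \<phi> = equalizer C (interp C n \<phi>) (truth C \<cdot>\<^bsub>C\<^esub> to_one C (Omega_pow C n))"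

definition satisfies :: "('o, 'a, 'm) cat_scheme \<Rightarrow> nat \<Rightarrow> hterm \<Rightarrow> bool" where
  "satisfies C n \<phi> \<longleftrightarrow> iso C (axiom_equalizer C n \<phi>)"


section \<open>Local operators and sheaves\<close>

definition local_operator :: "('o, 'a, 'm) cat_scheme \<Rightarrow> 'a \<Rightarrow> bool" where
  "local_operator C j \<longleftrightarrow> j \<in> hom C (Omega C) (Omega C) \<and>
     j \<cdot>\<^bsub>C\<^esub> truth C = truth C \<and>
     j \<cdot>\<^bsub>C\<^esub> j = j \<and>
     j \<cdot>\<^bsub>C\<^esub> and_op C = and_op C \<cdot>\<^bsub>C\<^esub> pair C (j \<cdot>\<^bsub>C\<^esub> proj C 2 0) (j \<cdot>\<^bsub>C\<^esub> proj C 2 1)"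

definition local_le :: "('o, 'a, 'm) cat_scheme \<Rightarrow> 'a \<Rightarrow> 'a \<Rightarrow> bool" where
  "local_le C j k \<longleftrightarrow>
     (\<forall>X\<in>Ob C. \<forall>f\<in>hom C X (Omega C). elem_le C (j \<cdot>\<^bsub>C\<^esub> f) (k \<cdot>\<^bsub>C\<^esub> f))"

definition double_neg :: "('o, 'a, 'm) cat_scheme \<Rightarrow> 'a" where
  "double_neg C = neg_op C \<cdot>\<^bsub>C\<^esub> neg_op C"

definition is_closure :: "('o, 'a, 'm) cat_scheme \<Rightarrow> 'a \<Rightarrow> 'a \<Rightarrow> 'a \<Rightarrow> bool" where
  "is_closure C j m c \<longleftrightarrow> (\<exists>\<chi>. classifies C \<chi> m \<and> classifies C (j \<cdot>\<^bsub>C\<^esub> \<chi>) c)"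

definition dense :: "('o, 'a, 'm) cat_scheme \<Rightarrow> 'a \<Rightarrow> 'a \<Rightarrow> bool" where
  "dense C j m \<longleftrightarrow> (\<exists>c. is_closure C j m c \<and> iso C c)"

definition sheaf :: "('o, 'a, 'm) cat_scheme \<Rightarrow> 'a \<Rightarrow> 'o \<Rightarrow> bool" where
  "sheaf C j F \<longleftrightarrow> F \<in> Ob C \<and>
     (\<forall>m. dense C j m \<longrightarrow> (\<forall>f\<in>hom C (Dom C m) F. \<exists>!g. g \<in> hom C (Cod C m) F \<and> g \<cdot>\<^bsub>C\<^esub> m = f))"

definition Sh :: "('o, 'a, 'm) cat_scheme \<Rightarrow> 'a \<Rightarrow> ('o, 'a, 'm) cat_scheme" where
  "Sh C j = C\<lparr>Ob := {F. sheaf C j F},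
              Ar := {f \<in> Ar C. sheaf C j (Dom C f) \<and> sheaf C j (Cod C f)}\<rparr>"

locale category_functor = C: category C + D: category D
  for C :: "('o, 'a, 'm) cat_scheme" and D :: "('p, 'b, 'k) cat_scheme" +
  fixes Fo :: "'o \<Rightarrow> 'p" and Fa :: "'a \<Rightarrow> 'b"
  assumes obj: "X \<in> Ob C \<Longrightarrow> Fo X \<in> Ob D"
    and arr: "f \<in> hom C X Y \<Longrightarrow> Fa f \<in> hom D (Fo X) (Fo Y)"
    and ide: "X \<in> Ob C \<Longrightarrow> Fa (Ide C X) = Ide D (Fo X)"
    and cmp: "\<lbrakk>f \<in> hom C X Y; g \<in> hom C Y Z\<rbrakk> \<Longrightarrow> Fa (g \<cdot>\<^bsub>C\<^esub> f) = Fa g \<cdot>\<^bsub>D\<^esub> Fa f"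

text \<open>A left adjoint of the inclusion of sheaves, given by its unit \<open>\<eta>\<close>.\<close>

definition associated_sheaf_functor ::
    "('o, 'a, 'm) cat_scheme \<Rightarrow> 'a \<Rightarrow> ('o \<Rightarrow> 'o) \<Rightarrow> ('a \<Rightarrow> 'a) \<Rightarrow> bool" where
  "associated_sheaf_functor C j Fo Fa \<longleftrightarrow> category_functor C (Sh C j) Fo Fa \<and>
     (\<exists>\<eta>. (\<forall>X\<in>Ob C. \<eta> X \<in> hom C X (Fo X)) \<and>
          (\<forall>X Y. \<forall>f\<in>hom C X Y. \<eta> Y \<cdot>\<^bsub>C\<^esub> f = Fa f \<cdot>\<^bsub>C\<^esub> \<eta> X) \<and>
          (\<forall>X\<in>Ob C. \<forall>F. sheaf C j F \<longrightarrow>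
             (\<forall>f\<in>hom C X F. \<exists>!g. g \<in> hom C (Fo X) F \<and> g \<cdot>\<^bsub>C\<^esub> \<eta> X = f)))"

text \<open>The associated sheaf functor exists and is unique up to natural isomorphism, so the
  choice of \<open>Fo, Fa\<close> in the next two definitions is immaterial.\<close>

definition weakly_open :: "('o, 'a, 'm) cat_scheme \<Rightarrow> 'a \<Rightarrow> bool" where
  "weakly_open C j \<longleftrightarrow> local_operator C j \<and>
     (\<exists>Fo Fa. associated_sheaf_functor C j Fo Fa \<and>
        (\<forall>X\<in>Ob C. \<forall>a c. is_pseudocompl (Sub C X) (sub_le C) a c \<longrightarrow>
           is_pseudocompl (Sub (Sh C j) (Fo X)) (sub_le (Sh C j)) (Fa a) (Fa c)))"

definition implicationally_open :: "('o, 'a, 'm) cat_scheme \<Rightarrow> 'a \<Rightarrow> bool" where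
  "implicationally_open C j \<longleftrightarrow> local_operator C j \<and>
     (\<exists>Fo Fa. associated_sheaf_functor C j Fo Fa \<and>
        (\<forall>X\<in>Ob C. \<forall>a b c. is_himp (Sub C X) (sub_le C) a b c \<longrightarrow>
           is_himp (Sub (Sh C j) (Fo X)) (sub_le (Sh C j)) (Fa a) (Fa b) (Fa c)))"

text \<open>\<open>j\<close> is the \<open>L\<close>-topology of the logic presented by the axiom \<open>\<phi>\<close> in \<open>n\<close> variables.\<close>

definition is_L_topology :: "('o, 'a, 'm) cat_scheme \<Rightarrow> nat \<Rightarrow> hterm \<Rightarrow> 'a \<Rightarrow> bool" where
  "is_L_topology C n \<phi> j \<longleftrightarrow> local_operator C j \<and> dense C j (axiom_equalizer C n \<phi>) \<and>
     (\<forall>k. local_operator C k \<and> dense C k (axiom_equalizer C n \<phi>) \<longrightarrow> local_le C j k)"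

end

theory Submission
  imports Defs
begin

text \<open>The whole proof takes place in the sets \<open>Hom(X, \<Omega>)\<close> of predicates on the objects \<open>X\<close>.  They are
  Heyting algebras, naturally in \<open>X\<close>, so by the Yoneda lemma a topos satisfies an axiom iff the term
  takes the value true in \<open>Hom(X, \<Omega>)\<close> under all valuations, for all \<open>X\<close> (\<open>satisfies_iff\<close>).  A local
  operator \<open>j\<close> acts on \<open>Hom(X, \<Omega>)\<close> by composition, and this is a nucleus.  The truth values of
  \<open>sh\<^sub>j(E)\<close> are the closed ones, so the algebra of predicates of \<open>sh\<^sub>j(E)\<close> on a sheaf \<open>F\<close> consists of
  the fixed points of \<open>j\<close> in \<open>Hom(F, \<Omega>)\<close> (\<open>satisfies_Sh_iff\<close>): meets and implications are those of
  \<open>E\<close>, the least element is \<open>j 0\<close>, and joins are closures of joins.  On the other hand, the axiom is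
  \<open>j\<close>-dense iff \<open>j\<close> sends all values of the term in \<open>E\<close> to true (\<open>dense_axiom_iff\<close>).  What has to be
  compared is therefore the term evaluated with closed operations and the closure of the term evaluated
  in \<open>E\<close>.

  (i) The axiom is a classical tautology, so by Glivenko's theorem (\<open>glivenko\<close>) its double negation is
  true in every Heyting algebra; that is, the axiom is \<open>\<not>\<not>\<close>-dense, and the \<open>L\<close>-topology is the least
  local operator for which it is dense.

  (ii) By (i) the \<open>L\<close>-topology satisfies \<open>j 0 = 0\<close>.  Then the closed predicates have the same negation as
  all predicates, so on closed arguments terms in \<open>\<and>\<close>, \<open>\<Rightarrow>\<close>, \<open>\<not>\<close> have the same value in both algebras;
  a disjunction of such terms only acquires an outer \<open>j\<close> (\<open>heval_closed_disjunctive\<close>), and \<open>j\<close> of the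
  axiom is true by density.

  (iii) Pulling back along the unit \<open>X \<rightarrow> a\<^sub>j X\<close> identifies the subobjects of \<open>a\<^sub>j X\<close> in \<open>sh\<^sub>j(E)\<close> with the
  closed predicates on \<open>X\<close>, and \<open>a\<^sub>j(m)\<close> with the closure of \<open>m\<close> (\<open>sheafified_subobject\<close>).  Hence an
  implicationally open \<open>j\<close> satisfies \<open>j(a \<Rightarrow> b) = (j a \<Rightarrow> j b)\<close> for all predicates, and a weakly open one
  \<open>j(\<not> a) = (j a \<Rightarrow> j 0)\<close>.  By induction, \<open>j\<close> commutes with the evaluation of the term
  (\<open>heval_closed_open\<close>), and density of the axiom says the same as its validity in \<open>sh\<^sub>j(E)\<close>
  (\<open>open_dense_iff_satisfies\<close>).

  Two constructions support this.  A predicate \<open>f\<close> on \<open>X\<close> is determined by the arrows \<open>h\<close> into \<open>X\<close> with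
  \<open>f h\<close> true (\<open>pred_eqI\<close>), so each Heyting operation on \<open>\<Omega>\<close> is obtained by describing these arrows:
  equalizers give \<open>\<and>\<close> and \<open>\<Rightarrow>\<close>, exponentials give universal quantification, and \<open>0\<close> and \<open>\<or>\<close> have their
  second-order definitions.  For sheaves, the closed truth values form a sheaf
  (\<open>ex_closed_truth_values\<close>) that classifies the subobjects in \<open>sh\<^sub>j(E)\<close>.\<close>

section \<open>Heyting algebras carried by sets\<close>

text \<open>The operations are recovered from the order by definite descriptions, so that a Heyting algebra is just
  a set with an order: the predicates on an object and the closed predicates among them then share the order
  relation and differ only in the carrier.\<close>
definition is_top :: "'x set \<Rightarrow> ('x \<Rightarrow> 'x \<Rightarrow> bool) \<Rightarrow> 'x \<Rightarrow> bool" where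
  "is_top S le z \<longleftrightarrow> z \<in> S \<and> (\<forall>d\<in>S. le d z)"

definition htop where "htop S le = (THE z. is_top S le z)"
definition hbot where "hbot S le = (THE z. is_bot S le z)"
definition hmeet where "hmeet S le a b = (THE c. is_meet S le a b c)"
definition hjoin where "hjoin S le a b = (THE c. is_join S le a b c)"
definition himp where "himp S le a b = (THE c. is_himp S le a b c)"

primrec heval :: "'x set \<Rightarrow> ('x \<Rightarrow> 'x \<Rightarrow> bool) \<Rightarrow> (nat \<Rightarrow> 'x) \<Rightarrow> hterm \<Rightarrow> 'x" where
  "heval S le v (Var i) = v i"
| "heval S le v Zero = hbot S le"
| "heval S le v One = htop S le"
| "heval S le v (Neg s) = himp S le (heval S le v s) (hbot S le)"
| "heval S le v (Or s t) = hjoin S le (heval S le v s) (heval S le v t)"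
| "heval S le v (And s t) = hmeet S le (heval S le v s) (heval S le v t)"
| "heval S le v (Imp s t) = himp S le (heval S le v s) (heval S le v t)"

lemma heval_cong: "(\<And>i. i \<in> vars t \<Longrightarrow> v i = w i) \<Longrightarrow> heval S le v t = heval S le w t"
  by (induction t) auto

locale poset_on =
  fixes S :: "'x set" and le :: "'x \<Rightarrow> 'x \<Rightarrow> bool" (infix "\<sqsubseteq>" 50)
  assumes refl: "a \<in> S \<Longrightarrow> a \<sqsubseteq> a"
    and trans: "\<lbrakk>a \<in> S; b \<in> S; c \<in> S; a \<sqsubseteq> b; b \<sqsubseteq> c\<rbrakk> \<Longrightarrow> a \<sqsubseteq> c"
    and antisym: "\<lbrakk>a \<in> S; b \<in> S; a \<sqsubseteq> b; b \<sqsubseteq> a\<rbrakk> \<Longrightarrow> a = b"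
begin

lemma is_top_unique: "\<lbrakk>is_top S le a; is_top S le b\<rbrakk> \<Longrightarrow> a = b"
  by (simp add: is_top_def antisym)

lemma is_bot_unique: "\<lbrakk>is_bot S le a; is_bot S le b\<rbrakk> \<Longrightarrow> a = b"
  by (simp add: is_bot_def antisym)

lemma is_meet_unique: "\<lbrakk>is_meet S le a b c; is_meet S le a b d\<rbrakk> \<Longrightarrow> c = d"
  unfolding is_meet_def by (meson antisym refl)

lemma is_join_unique: "\<lbrakk>is_join S le a b c; is_join S le a b d\<rbrakk> \<Longrightarrow> c = d"
  unfolding is_join_def by (meson antisym refl)

lemma is_himp_unique:
  assumes "is_himp S le a b c" "is_himp S le a b d"
  shows "c = d"
proof -
  have "c \<in> S" "d \<in> S" "\<forall>x\<in>S. x \<sqsubseteq> c \<longleftrightarrow> x \<sqsubseteq> d"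
    using assms unfolding is_himp_def by simp_all
  then show ?thesis by (meson antisym refl)
qed

lemma htop_eq: "is_top S le a \<Longrightarrow> htop S le = a"
  unfolding htop_def by (blast intro: the_equality is_top_unique)

lemma hbot_eq: "is_bot S le a \<Longrightarrow> hbot S le = a"
  unfolding hbot_def by (blast intro: the_equality is_bot_unique)

lemma hmeet_eq: "is_meet S le a b c \<Longrightarrow> hmeet S le a b = c"
  unfolding hmeet_def by (blast intro: the_equality is_meet_unique)

lemma hjoin_eq: "is_join S le a b c \<Longrightarrow> hjoin S le a b = c"
  unfolding hjoin_def by (blast intro: the_equality is_join_unique)

lemma himp_eq: "is_himp S le a b c \<Longrightarrow> himp S le a b = c"
  unfolding himp_def by (blast intro: the_equality is_himp_unique)

end

locale heyting_poset = poset_on +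
  assumes ex_top: "\<exists>z. is_top S le z"
    and ex_bot: "\<exists>z. is_bot S le z"
    and ex_meet: "\<lbrakk>a \<in> S; b \<in> S\<rbrakk> \<Longrightarrow> \<exists>c. is_meet S le a b c"
    and ex_join: "\<lbrakk>a \<in> S; b \<in> S\<rbrakk> \<Longrightarrow> \<exists>c. is_join S le a b c"
    and ex_himp: "\<lbrakk>a \<in> S; b \<in> S\<rbrakk> \<Longrightarrow> \<exists>c. is_himp S le a b c"
begin

abbreviation Bot ("\<bottom>") where "\<bottom> \<equiv> hbot S le"
abbreviation Top ("\<top>") where "\<top> \<equiv> htop S le"
abbreviation Meet (infixl "\<sqinter>" 70) where "a \<sqinter> b \<equiv> hmeet S le a b"
abbreviation Join (infixl "\<squnion>" 65) where "a \<squnion> b \<equiv> hjoin S le a b"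
abbreviation Implies (infixr "\<rightarrow>" 60) where "a \<rightarrow> b \<equiv> himp S le a b"
abbreviation Not ("\<sim> _" [80] 80) where "\<sim> a \<equiv> a \<rightarrow> \<bottom>"

lemma is_top_htop: "is_top S le \<top>" using ex_top htop_eq by blast
lemma is_bot_hbot: "is_bot S le \<bottom>" using ex_bot hbot_eq by blast
lemma is_meet_hmeet: "\<lbrakk>a \<in> S; b \<in> S\<rbrakk> \<Longrightarrow> is_meet S le a b (a \<sqinter> b)" using ex_meet hmeet_eq by blast
lemma is_join_hjoin: "\<lbrakk>a \<in> S; b \<in> S\<rbrakk> \<Longrightarrow> is_join S le a b (a \<squnion> b)" using ex_join hjoin_eq by blast
lemma is_himp_himp: "\<lbrakk>a \<in> S; b \<in> S\<rbrakk> \<Longrightarrow> is_himp S le a b (a \<rightarrow> b)" using ex_himp himp_eq by blast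

lemma top_in [simp]: "\<top> \<in> S" and bot_in [simp]: "\<bottom> \<in> S"
  using is_top_htop is_bot_hbot by (auto simp: is_top_def is_bot_def)

lemma meet_in [simp]: "\<lbrakk>a \<in> S; b \<in> S\<rbrakk> \<Longrightarrow> a \<sqinter> b \<in> S"
  using is_meet_hmeet by (auto simp: is_meet_def)

lemma join_in [simp]: "\<lbrakk>a \<in> S; b \<in> S\<rbrakk> \<Longrightarrow> a \<squnion> b \<in> S"
  using is_join_hjoin by (auto simp: is_join_def)

lemma imp_in [simp]: "\<lbrakk>a \<in> S; b \<in> S\<rbrakk> \<Longrightarrow> a \<rightarrow> b \<in> S"
  using is_himp_himp by (auto simp: is_himp_def)

lemma le_top [simp]: "a \<in> S \<Longrightarrow> a \<sqsubseteq> \<top>"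
  using is_top_htop by (auto simp: is_top_def)

lemma bot_le [simp]: "a \<in> S \<Longrightarrow> \<bottom> \<sqsubseteq> a"
  using is_bot_hbot by (auto simp: is_bot_def)

lemma le_meet_iff: "\<lbrakk>a \<in> S; b \<in> S; d \<in> S\<rbrakk> \<Longrightarrow> d \<sqsubseteq> a \<sqinter> b \<longleftrightarrow> d \<sqsubseteq> a \<and> d \<sqsubseteq> b"
  using is_meet_hmeet[of a b] by (auto simp: is_meet_def)

lemma join_le_iff: "\<lbrakk>a \<in> S; b \<in> S; d \<in> S\<rbrakk> \<Longrightarrow> a \<squnion> b \<sqsubseteq> d \<longleftrightarrow> a \<sqsubseteq> d \<and> b \<sqsubseteq> d"
  using is_join_hjoin[of a b] by (auto simp: is_join_def)

lemma is_himp_iff: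
  assumes "a \<in> S" "b \<in> S" "c \<in> S"
  shows "is_himp S le a b c \<longleftrightarrow> (\<forall>d\<in>S. d \<sqsubseteq> c \<longleftrightarrow> d \<sqinter> a \<sqsubseteq> b)"
proof -
  have "(\<exists>e. is_meet S le d a e \<and> e \<sqsubseteq> b) \<longleftrightarrow> d \<sqinter> a \<sqsubseteq> b" if "d \<in> S" for d
    using is_meet_hmeet[OF that assms(1)] is_meet_unique by blast
  then show ?thesis using assms by (simp add: is_himp_def)
qed

lemma le_imp_iff: "\<lbrakk>a \<in> S; b \<in> S; d \<in> S\<rbrakk> \<Longrightarrow> d \<sqsubseteq> a \<rightarrow> b \<longleftrightarrow> d \<sqinter> a \<sqsubseteq> b"
  using is_himp_himp[of a b] is_himp_iff[of a b "a \<rightarrow> b"] by simp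

lemma is_pseudocompl_iff: "a \<in> S \<Longrightarrow> is_pseudocompl S le a c \<longleftrightarrow> c = \<sim> a"
  unfolding is_pseudocompl_def using is_bot_hbot hbot_eq is_himp_himp[of a \<bottom>] himp_eq bot_in by metis

lemma meet_le1 [simp]: "\<lbrakk>a \<in> S; b \<in> S\<rbrakk> \<Longrightarrow> a \<sqinter> b \<sqsubseteq> a"
  and meet_le2 [simp]: "\<lbrakk>a \<in> S; b \<in> S\<rbrakk> \<Longrightarrow> a \<sqinter> b \<sqsubseteq> b"
  using le_meet_iff[of a b "a \<sqinter> b"] refl[of "a \<sqinter> b"] by auto

lemma le_join1 [simp]: "\<lbrakk>a \<in> S; b \<in> S\<rbrakk> \<Longrightarrow> a \<sqsubseteq> a \<squnion> b"
  and le_join2 [simp]: "\<lbrakk>a \<in> S; b \<in> S\<rbrakk> \<Longrightarrow> b \<sqsubseteq> a \<squnion> b"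
  using join_le_iff[of a b "a \<squnion> b"] refl[of "a \<squnion> b"] by auto

lemma meet_commute: "\<lbrakk>a \<in> S; b \<in> S\<rbrakk> \<Longrightarrow> a \<sqinter> b = b \<sqinter> a"
  by (intro antisym) (auto simp: le_meet_iff)

lemma meet_mono: "\<lbrakk>a \<in> S; b \<in> S; c \<in> S; d \<in> S; a \<sqsubseteq> c; b \<sqsubseteq> d\<rbrakk> \<Longrightarrow> a \<sqinter> b \<sqsubseteq> c \<sqinter> d"
  using trans[of "a \<sqinter> b" a c] trans[of "a \<sqinter> b" b d] by (simp add: le_meet_iff)

lemma meet_absorb: "\<lbrakk>a \<in> S; b \<in> S\<rbrakk> \<Longrightarrow> a \<sqinter> b = a \<longleftrightarrow> a \<sqsubseteq> b"
  using antisym[of "a \<sqinter> b" a] meet_le2[of a b] refl[of a] le_meet_iff[of a b a] by auto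

lemma eq_top_iff: "a \<in> S \<Longrightarrow> a = \<top> \<longleftrightarrow> \<top> \<sqsubseteq> a"
  using antisym[of a \<top>] refl[of \<top>] by auto

lemma meet_top [simp]: "a \<in> S \<Longrightarrow> \<top> \<sqinter> a = a" "a \<in> S \<Longrightarrow> a \<sqinter> \<top> = a"
  by (auto simp: meet_absorb meet_commute)

lemma imp_eq_top_iff: "\<lbrakk>a \<in> S; b \<in> S\<rbrakk> \<Longrightarrow> a \<rightarrow> b = \<top> \<longleftrightarrow> a \<sqsubseteq> b"
  by (simp add: eq_top_iff le_imp_iff)

text \<open>This and the next lemma let inequalities be proved in the style of natural deduction, with the elements
  below \<open>d\<close> in the role of contexts.\<close>
lemma imp_elim: "\<lbrakk>a \<in> S; b \<in> S; d \<in> S; d \<sqsubseteq> a \<rightarrow> b; d \<sqsubseteq> a\<rbrakk> \<Longrightarrow> d \<sqsubseteq> b"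
  by (metis le_imp_iff meet_absorb)

lemma imp_intro: "\<lbrakk>a \<in> S; b \<in> S; d \<in> S; \<And>e. \<lbrakk>e \<in> S; e \<sqsubseteq> d; e \<sqsubseteq> a\<rbrakk> \<Longrightarrow> e \<sqsubseteq> b\<rbrakk> \<Longrightarrow> d \<sqsubseteq> a \<rightarrow> b"
  by (simp add: le_imp_iff)

lemma le_bot_elim: "\<lbrakk>a \<in> S; d \<in> S; d \<sqsubseteq> \<bottom>\<rbrakk> \<Longrightarrow> d \<sqsubseteq> a"
  using trans[of d \<bottom> a] by simp

lemma heval_in: "(\<And>i. i \<in> vars t \<Longrightarrow> v i \<in> S) \<Longrightarrow> heval S le v t \<in> S"
  by (induction t) auto

lemma not_not_intro: "a \<in> S \<Longrightarrow> a \<sqsubseteq> \<sim> \<sim> a"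
  by (simp add: le_imp_iff meet_commute[of a]) (simp flip: le_imp_iff add: refl)

lemma not_antimono:
  assumes "a \<in> S" "b \<in> S" "a \<sqsubseteq> b" shows "\<sim> b \<sqsubseteq> \<sim> a"
proof (rule imp_intro)
  fix e assume e: "e \<in> S" "e \<sqsubseteq> \<sim> b" "e \<sqsubseteq> a"
  then have "e \<sqsubseteq> b" using assms trans by blast
  then show "e \<sqsubseteq> \<bottom>" using imp_elim e assms by (metis bot_in)
qed (use assms in auto)

lemma not_not_mono: "\<lbrakk>a \<in> S; b \<in> S; a \<sqsubseteq> b\<rbrakk> \<Longrightarrow> \<sim> \<sim> a \<sqsubseteq> \<sim> \<sim> b"
  by (simp add: not_antimono)

lemma not_not_idem: "a \<in> S \<Longrightarrow> \<sim> \<sim> \<sim> \<sim> a = \<sim> \<sim> a"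
  by (intro antisym) (simp_all add: not_antimono not_not_intro)

lemma not_not_top: "\<sim> \<sim> \<top> = \<top>"
  by (simp add: eq_top_iff not_not_intro)

lemma not_not_meet:
  assumes "a \<in> S" "b \<in> S" shows "\<sim> \<sim> (a \<sqinter> b) = \<sim> \<sim> a \<sqinter> \<sim> \<sim> b"
proof (rule antisym)
  show "\<sim> \<sim> (a \<sqinter> b) \<sqsubseteq> \<sim> \<sim> a \<sqinter> \<sim> \<sim> b"
    using assms by (simp add: le_meet_iff not_not_mono)
  show "\<sim> \<sim> a \<sqinter> \<sim> \<sim> b \<sqsubseteq> \<sim> \<sim> (a \<sqinter> b)"
  proof (rule imp_intro)
    fix e assume e: "e \<in> S" "e \<sqsubseteq> \<sim> \<sim> a \<sqinter> \<sim> \<sim> b" "e \<sqsubseteq> \<sim> (a \<sqinter> b)"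
    have ea: "e \<sqsubseteq> \<sim> \<sim> a" and eb: "e \<sqsubseteq> \<sim> \<sim> b" using e assms by (simp_all add: le_meet_iff)
    have "e \<sqsubseteq> \<sim> a"
    proof (rule imp_intro)
      fix d assume d: "d \<in> S" "d \<sqsubseteq> e" "d \<sqsubseteq> a"
      have "d \<sqsubseteq> \<sim> b"
      proof (rule imp_intro)
        fix c assume c: "c \<in> S" "c \<sqsubseteq> d" "c \<sqsubseteq> b"
        have "c \<sqsubseteq> a \<sqinter> b" using c d assms trans[of c d a] by (simp add: le_meet_iff)
        moreover have "c \<sqsubseteq> \<sim> (a \<sqinter> b)"
          using c d e assms by (meson bot_in imp_in meet_in trans)
        ultimately show "c \<sqsubseteq> \<bottom>" using c assms by (meson bot_in imp_elim meet_in)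
      qed (use assms d in auto)
      moreover have "d \<sqsubseteq> \<sim> \<sim> b" using d e eb assms by (meson bot_in imp_in trans)
      ultimately show "d \<sqsubseteq> \<bottom>" using d assms by (meson bot_in imp_elim imp_in)
    qed (use assms e in auto)
    then show "e \<sqsubseteq> \<bottom>" using ea e assms by (meson bot_in imp_elim imp_in)
  qed (use assms in auto)
qed (use assms in auto)

text \<open>The double negation of modus ponens; with it, the formulas whose double negation is valid are closed under
  detachment.\<close>
lemma not_not_imp_elim:
  assumes "a \<in> S" "b \<in> S" shows "\<sim> \<sim> (a \<rightarrow> b) \<sqinter> \<sim> \<sim> a \<sqsubseteq> \<sim> \<sim> b"
proof -
  have "(a \<rightarrow> b) \<sqinter> a \<sqsubseteq> b" using assms by (simp flip: le_imp_iff add: refl)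
  then show ?thesis using assms by (simp flip: not_not_meet add: not_not_mono)
qed

lemma not_not_excluded_middle:
  assumes "a \<in> S" shows "\<sim> \<sim> (a \<squnion> \<sim> a) = \<top>"
proof -
  have "\<sim> (a \<squnion> \<sim> a) \<sqsubseteq> \<sim> a \<sqinter> \<sim> \<sim> a"
    using assms by (simp add: le_meet_iff not_antimono)
  moreover have "\<sim> a \<sqinter> \<sim> \<sim> a \<sqsubseteq> \<bottom>"
    using assms not_not_intro[of "\<sim> a"] by (simp flip: le_imp_iff)
  ultimately show ?thesis
    using assms trans[of "\<sim> (a \<squnion> \<sim> a)" "\<sim> a \<sqinter> \<sim> \<sim> a" \<bottom>] by (simp add: imp_eq_top_iff)
qed

end

text \<open>Glivenko's theorem.  The formulas whose double negation is valid contain the intuitionistic axioms and all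
  instances of excluded middle, and they are closed under modus ponens.  The valuation is total because a
  derivation may pass through formulas with more variables than its conclusion.\<close>
lemma (in heyting_poset) glivenko:
  assumes "provable {Or (Var 0) (Neg (Var 0))} t" "\<And>i. v i \<in> S"
  shows "\<sim> \<sim> (heval S le v t) = \<top>"
proof -
  have [simp]: "heval S le v t \<in> S" for t using assms(2) by (simp add: heval_in)
  show ?thesis
    using assms(1)
  proof induction
    case (scheme A \<sigma>)
    then show ?case using not_not_excluded_middle by simp
  next
    case (MP A B)
    then have "\<top> \<sqsubseteq> \<sim> \<sim> heval S le v B"
      using not_not_imp_elim[of "heval S le v A" "heval S le v B"] by simp
    then show ?case by (simp add: eq_top_iff)
  next
    case (K A B)
    have "heval S le v (Imp A (Imp B A)) = \<top>" by (simp add: imp_eq_top_iff le_imp_iff)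
    then show ?case by (simp only: not_not_top)
  next
    case (S A B D)
    let ?a = "heval S le v A" and ?b = "heval S le v B" and ?d = "heval S le v D"
    have "?a \<rightarrow> ?b \<rightarrow> ?d \<sqsubseteq> (?a \<rightarrow> ?b) \<rightarrow> ?a \<rightarrow> ?d"
    proof (intro imp_intro)
      fix e d assume "e \<in> S" "e \<sqsubseteq> ?a \<rightarrow> ?b \<rightarrow> ?d" "e \<sqsubseteq> ?a \<rightarrow> ?b" "d \<in> S" "d \<sqsubseteq> e" "d \<sqsubseteq> ?a"
      moreover from this have "d \<sqsubseteq> ?a \<rightarrow> ?b \<rightarrow> ?d" "d \<sqsubseteq> ?a \<rightarrow> ?b"
        using trans[of d e] by simp_all
      ultimately show "d \<sqsubseteq> ?d"
        using imp_elim[of ?a "?b \<rightarrow> ?d" d] imp_elim[of ?b ?d d] imp_elim[of ?a ?b d] by simp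
    qed auto
    then have "heval S le v (Imp (Imp A (Imp B D)) (Imp (Imp A B) (Imp A D))) = \<top>"
      by (simp add: imp_eq_top_iff)
    then show ?case by (simp only: not_not_top)
  next
    case (andI A B)
    have "heval S le v (Imp A (Imp B (And A B))) = \<top>" by (simp add: imp_eq_top_iff le_imp_iff refl)
    then show ?case by (simp only: not_not_top)
  next
    case (andE1 A B)
    have "heval S le v (Imp (And A B) A) = \<top>" by (simp add: imp_eq_top_iff)
    then show ?case by (simp only: not_not_top)
  next
    case (andE2 A B)
    have "heval S le v (Imp (And A B) B) = \<top>" by (simp add: imp_eq_top_iff)
    then show ?case by (simp only: not_not_top)
  next
    case (orI1 A B)
    have "heval S le v (Imp A (Or A B)) = \<top>" by (simp add: imp_eq_top_iff)
    then show ?case by (simp only: not_not_top)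
  next
    case (orI2 B A)
    have "heval S le v (Imp B (Or A B)) = \<top>" by (simp add: imp_eq_top_iff)
    then show ?case by (simp only: not_not_top)
  next
    case (orE A D B)
    let ?a = "heval S le v A" and ?b = "heval S le v B" and ?d = "heval S le v D"
    have "?a \<rightarrow> ?d \<sqsubseteq> (?b \<rightarrow> ?d) \<rightarrow> (?a \<squnion> ?b) \<rightarrow> ?d"
    proof (intro imp_intro)
      fix e d assume e: "e \<in> S" "e \<sqsubseteq> ?a \<rightarrow> ?d" "e \<sqsubseteq> ?b \<rightarrow> ?d" and d: "d \<in> S" "d \<sqsubseteq> e" "d \<sqsubseteq> ?a \<squnion> ?b"
      have "?a \<sqsubseteq> e \<rightarrow> ?d" "?b \<sqsubseteq> e \<rightarrow> ?d"
        using e by (simp_all add: le_imp_iff meet_commute[of _ e])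
      then have "?a \<squnion> ?b \<sqsubseteq> e \<rightarrow> ?d" using e by (simp add: join_le_iff)
      then have "d \<sqsubseteq> e \<rightarrow> ?d" using e d trans[of d "?a \<squnion> ?b" "e \<rightarrow> ?d"] by simp
      then show "d \<sqsubseteq> ?d" using e d imp_elim[of e ?d d] by simp
    qed auto
    then have "heval S le v (Imp (Imp A D) (Imp (Imp B D) (Imp (Or A B) D))) = \<top>"
      by (simp add: imp_eq_top_iff)
    then show ?case by (simp only: not_not_top)
  next
    case (negI A B)
    let ?a = "heval S le v A" and ?b = "heval S le v B"
    have "?a \<rightarrow> ?b \<sqsubseteq> (?a \<rightarrow> \<sim> ?b) \<rightarrow> \<sim> ?a"
    proof (intro imp_intro)
      fix e d assume "e \<in> S" "e \<sqsubseteq> ?a \<rightarrow> ?b" "e \<sqsubseteq> ?a \<rightarrow> \<sim> ?b" "d \<in> S" "d \<sqsubseteq> e" "d \<sqsubseteq> ?a"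
      moreover from this have "d \<sqsubseteq> ?a \<rightarrow> ?b" "d \<sqsubseteq> ?a \<rightarrow> \<sim> ?b"
        using trans[of d e] by simp_all
      ultimately show "d \<sqsubseteq> \<bottom>"
        using imp_elim[of ?a "\<sim> ?b" d] imp_elim[of ?b \<bottom> d] imp_elim[of ?a ?b d] by simp
    qed auto
    then have "heval S le v (Imp (Imp A B) (Imp (Imp A (Neg B)) (Neg A))) = \<top>"
      by (simp add: imp_eq_top_iff)
    then show ?case by (simp only: not_not_top)
  next
    case (negE A B)
    let ?a = "heval S le v A" and ?b = "heval S le v B"
    have "\<sim> ?a \<sqsubseteq> ?a \<rightarrow> ?b"
    proof (intro imp_intro)
      fix e assume "e \<in> S" "e \<sqsubseteq> \<sim> ?a" "e \<sqsubseteq> ?a"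
      then show "e \<sqsubseteq> ?b" using imp_elim[of ?a \<bottom> e] le_bot_elim[of ?b e] by simp
    qed auto
    then have "heval S le v (Imp (Neg A) (Imp A B)) = \<top>" by (simp add: imp_eq_top_iff)
    then show ?case by (simp only: not_not_top)
  next
    case (zeroE A)
    have "heval S le v (Imp Zero A) = \<top>" by (simp add: imp_eq_top_iff)
    then show ?case by (simp only: not_not_top)
  next
    case oneI
    then show ?case by (simp add: not_not_top)
  qed
qed

section \<open>Nuclei\<close>

definition fixed_points :: "'x set \<Rightarrow> ('x \<Rightarrow> 'x) \<Rightarrow> 'x set" where
  "fixed_points S j = {a \<in> S. j a = a}"

locale nucleus = heyting_poset +
  fixes j :: "'a \<Rightarrow> 'a"
  assumes j_in [simp]: "a \<in> S \<Longrightarrow> j a \<in> S"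
    and j_infl: "a \<in> S \<Longrightarrow> a \<sqsubseteq> j a"
    and j_idem: "a \<in> S \<Longrightarrow> j (j a) = j a"
    and j_meet: "\<lbrakk>a \<in> S; b \<in> S\<rbrakk> \<Longrightarrow> j (a \<sqinter> b) = j a \<sqinter> j b"
begin

abbreviation closed :: "'a set" where "closed \<equiv> fixed_points S j"

lemma closed_in: "a \<in> closed \<Longrightarrow> a \<in> S" and closed_fix: "a \<in> closed \<Longrightarrow> j a = a"
  by (simp_all add: fixed_points_def)

lemma j_closed: "a \<in> S \<Longrightarrow> j a \<in> closed" by (simp add: fixed_points_def j_idem)

lemma j_mono: "\<lbrakk>a \<in> S; b \<in> S; a \<sqsubseteq> b\<rbrakk> \<Longrightarrow> j a \<sqsubseteq> j b"
  using j_meet[of a b] meet_absorb[of a b] meet_absorb[of "j a" "j b"] by simp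

lemma j_le_iff: "\<lbrakk>a \<in> S; b \<in> closed\<rbrakk> \<Longrightarrow> j a \<sqsubseteq> b \<longleftrightarrow> a \<sqsubseteq> b"
  by (metis closed_fix closed_in j_in j_infl j_mono trans)

lemma meet_closed: "\<lbrakk>a \<in> closed; b \<in> closed\<rbrakk> \<Longrightarrow> a \<sqinter> b \<in> closed"
  by (simp add: fixed_points_def j_meet)

text \<open>From \<open>j (a \<rightarrow> b) \<sqinter> a \<sqsubseteq> j ((a \<rightarrow> b) \<sqinter> a) \<sqsubseteq> j b = b\<close>.\<close>
lemma imp_closed: assumes a: "a \<in> S" and b: "b \<in> closed" shows "a \<rightarrow> b \<in> closed"
proof -
  have bS: "b \<in> S" using b by (rule closed_in)
  have "j (a \<rightarrow> b) \<sqinter> a \<sqsubseteq> j (a \<rightarrow> b) \<sqinter> j a"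
    using a bS by (intro meet_mono) (auto simp: refl j_infl)
  moreover have "j (a \<rightarrow> b) \<sqinter> j a = j ((a \<rightarrow> b) \<sqinter> a)"
    using a bS by (simp add: j_meet)
  moreover have "\<dots> \<sqsubseteq> b"
    using a b bS by (subst j_le_iff) (simp_all flip: le_imp_iff add: refl)
  ultimately have "j (a \<rightarrow> b) \<sqinter> a \<sqsubseteq> b"
    using a bS trans[of "j (a \<rightarrow> b) \<sqinter> a" "j (a \<rightarrow> b) \<sqinter> j a" b] by simp
  then have "j (a \<rightarrow> b) \<sqsubseteq> a \<rightarrow> b" using a bS by (simp add: le_imp_iff)
  then show ?thesis using a bS antisym[of "j (a \<rightarrow> b)" "a \<rightarrow> b"] by (simp add: fixed_points_def j_infl)
qed

lemma is_meet_closed: "\<lbrakk>a \<in> closed; b \<in> closed\<rbrakk> \<Longrightarrow> is_meet closed le a b (a \<sqinter> b)"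
  by (simp add: is_meet_def meet_closed le_meet_iff closed_in)

lemma is_join_closed: "\<lbrakk>a \<in> closed; b \<in> closed\<rbrakk> \<Longrightarrow> is_join closed le a b (j (a \<squnion> b))"
  by (simp add: is_join_def j_closed j_le_iff join_le_iff closed_in)

lemma poset_closed: "poset_on closed le"
proof
  show "a = b" if "a \<in> closed" "b \<in> closed" "a \<sqsubseteq> b" "b \<sqsubseteq> a" for a b
    using that closed_in antisym by blast
  show "a \<sqsubseteq> c" if "a \<in> closed" "b \<in> closed" "c \<in> closed" "a \<sqsubseteq> b" "b \<sqsubseteq> c" for a b c
    using that closed_in trans by blast
qed (simp add: closed_in refl)

lemma is_himp_closed:
  assumes "a \<in> closed" "b \<in> closed" shows "is_himp closed le a b (a \<rightarrow> b)"
proof -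
  have "(\<exists>e. is_meet closed le d a e \<and> e \<sqsubseteq> b) \<longleftrightarrow> d \<sqinter> a \<sqsubseteq> b" if "d \<in> closed" for d
    using is_meet_closed[of d a] poset_on.is_meet_unique[OF poset_closed] that assms(1) by blast
  then show ?thesis using assms
    by (simp add: is_himp_def imp_closed closed_in le_imp_iff)
qed

lemma is_bot_closed: "is_bot closed le (j \<bottom>)"
  by (simp add: is_bot_def j_closed j_le_iff closed_in)

lemma is_top_closed: "is_top closed le \<top>"
  using j_infl[of \<top>] antisym[of "j \<top>" \<top>] by (simp add: is_top_def fixed_points_def)

lemma heyting_closed: "heyting_poset closed le"
proof -
  interpret P: poset_on closed le by (rule poset_closed)
  show ?thesis
    by unfold_locales (use is_meet_closed is_join_closed is_himp_closed is_bot_closed is_top_closed in blast)+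
qed

lemma
  shows hbot_closed: "hbot closed le = j \<bottom>"
    and htop_closed: "htop closed le = \<top>"
    and hmeet_closed: "\<lbrakk>a \<in> closed; b \<in> closed\<rbrakk> \<Longrightarrow> hmeet closed le a b = a \<sqinter> b"
    and hjoin_closed: "\<lbrakk>a \<in> closed; b \<in> closed\<rbrakk> \<Longrightarrow> hjoin closed le a b = j (a \<squnion> b)"
    and himp_closed: "\<lbrakk>a \<in> closed; b \<in> closed\<rbrakk> \<Longrightarrow> himp closed le a b = a \<rightarrow> b"
  using poset_on.hbot_eq[OF poset_closed is_bot_closed] poset_on.htop_eq[OF poset_closed is_top_closed]
    poset_on.hmeet_eq[OF poset_closed is_meet_closed] poset_on.hjoin_eq[OF poset_closed is_join_closed]
    poset_on.himp_eq[OF poset_closed is_himp_closed] by blast+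

lemma heval_closed_in: "(\<And>i. i \<in> vars t \<Longrightarrow> v i \<in> closed) \<Longrightarrow> heval closed le v t \<in> closed"
  using heyting_poset.heval_in[OF heyting_closed] by blast

lemma j_join: assumes "a \<in> S" "b \<in> S" shows "j (j a \<squnion> j b) = j (a \<squnion> b)"
proof (rule antisym)
  have "j a \<squnion> j b \<sqsubseteq> j (a \<squnion> b)" using assms by (simp add: join_le_iff j_mono)
  then show "j (j a \<squnion> j b) \<sqsubseteq> j (a \<squnion> b)" using assms by (simp add: j_le_iff j_closed)
  have "a \<squnion> b \<sqsubseteq> j a \<squnion> j b"
    using assms trans[of a "j a" "j a \<squnion> j b"] trans[of b "j b" "j a \<squnion> j b"] by (simp add: join_le_iff j_infl)
  then show "j (a \<squnion> b) \<sqsubseteq> j (j a \<squnion> j b)" using assms by (simp add: j_mono)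
qed (use assms in auto)

text \<open>Closed elements have the same meets and implications among themselves as in the whole algebra; if \<open>\<bottom>\<close> is
  closed, they also have the same negations.  Joins are the only operations that differ.\<close>
lemma heval_closed_and_imp_neg:
  assumes "j \<bottom> = \<bottom>" "and_imp_neg_term t" "\<And>i. i \<in> vars t \<Longrightarrow> v i \<in> closed"
  shows "heval closed le v t = heval S le v t"
  using assms(2,3)
proof (induction t)
  case (Neg s)
  have "heval closed le v s \<in> closed" using Neg.prems by (intro heval_closed_in) simp
  moreover have "\<bottom> \<in> closed" using assms(1) by (simp add: fixed_points_def)
  ultimately show ?case using Neg assms(1) by (simp add: hbot_closed himp_closed)
next
  case (And s t)
  have "heval closed le v s \<in> closed" "heval closed le v t \<in> closed"
    using And.prems by (auto intro: heval_closed_in)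
  then show ?case using And by (simp add: hmeet_closed)
next
  case (Imp s t)
  have "heval closed le v s \<in> closed" "heval closed le v t \<in> closed"
    using Imp.prems by (auto intro: heval_closed_in)
  then show ?case using Imp by (simp add: himp_closed)
qed auto

text \<open>Nested closures of joins collapse to a single one (\<open>j_join\<close>), so for a disjunction only an outermost
  \<open>j\<close> remains.  This fails when a join occurs below an implication, whence the restriction on the term.\<close>
lemma heval_closed_disjunctive:
  assumes "j \<bottom> = \<bottom>" "disjunctive t" "\<And>i. i \<in> vars t \<Longrightarrow> v i \<in> closed"
  shows "heval closed le v t = j (heval S le v t)"
  using assms(2,3)
proof (induction t)
  case (1 t)
  have "heval closed le v t \<in> closed" using 1 by (intro heval_closed_in) simp
  then show ?case using heval_closed_and_imp_neg[OF assms(1) 1(1)] 1(2) closed_fix by simp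
next
  case (2 s t)
  have "heval closed le v s \<in> closed" "heval closed le v t \<in> closed"
    using "2.prems" by (auto intro!: heval_closed_in)
  moreover have "heval S le v s \<in> S" "heval S le v t \<in> S"
    using "2.prems" closed_in by (auto intro: heval_in)
  ultimately show ?case using 2 by (simp add: hjoin_closed j_join)
qed

text \<open>A nucleus always commutes with meets and, up to closure, with joins.  Once it commutes with negation and
  with the implications that occur, it is a homomorphism onto the algebra of closed elements.\<close>
lemma heval_closed_open:
  assumes neg: "\<And>a. a \<in> S \<Longrightarrow> j (\<sim> a) = j a \<rightarrow> j \<bottom>"
    and imp: "imp_free t \<or> (\<forall>a\<in>S. \<forall>b\<in>S. j (a \<rightarrow> b) = j a \<rightarrow> j b)"
    and v: "\<And>i. i \<in> vars t \<Longrightarrow> v i \<in> S"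
  shows "heval closed le (\<lambda>i. j (v i)) t = j (heval S le v t)"
  using imp v
proof (induction t)
  case (Neg s)
  have "heval S le v s \<in> S" using Neg.prems by (auto intro: heval_in)
  then show ?case using Neg neg by (simp add: hbot_closed himp_closed j_closed)
next
  case (Or s t)
  have "heval S le v s \<in> S" "heval S le v t \<in> S" using Or.prems by (auto intro: heval_in)
  then show ?case using Or by (auto simp add: hjoin_closed j_closed j_join)
next
  case (And s t)
  have "heval S le v s \<in> S" "heval S le v t \<in> S" using And.prems by (auto intro: heval_in)
  then show ?case using And by (auto simp add: hmeet_closed j_closed j_meet)
next
  case (Imp s t)
  have "heval S le v s \<in> S" "heval S le v t \<in> S" using Imp.prems by (auto intro: heval_in)
  then show ?case using Imp by (auto simp add: himp_closed j_closed)
next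
  case One
  then show ?case using is_top_closed by (simp add: htop_closed is_top_def closed_fix)
qed (auto simp: hbot_closed)

end

section \<open>Equivalences of preorders\<close>

text \<open>Sets of subobjects are only preordered, so they are compared with sets of predicates by maps that preserve
  and reflect the order and are onto, rather than by bijections.\<close>
locale order_equivalence =
  fixes S :: "'x set" and le :: "'x \<Rightarrow> 'x \<Rightarrow> bool" and T :: "'y set" and le' :: "'y \<Rightarrow> 'y \<Rightarrow> bool"
    and h :: "'x \<Rightarrow> 'y"
  assumes image: "h ` S = T"
    and le_iff: "\<lbrakk>a \<in> S; b \<in> S\<rbrakk> \<Longrightarrow> le' (h a) (h b) \<longleftrightarrow> le a b"
begin

lemma image_in: "a \<in> S \<Longrightarrow> h a \<in> T" using image by blast

lemma is_bot_iff: "a \<in> S \<Longrightarrow> is_bot T le' (h a) \<longleftrightarrow> is_bot S le a"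
  unfolding is_bot_def image[symmetric] by (auto simp: le_iff)

lemma is_top_iff: "a \<in> S \<Longrightarrow> is_top T le' (h a) \<longleftrightarrow> is_top S le a"
  unfolding is_top_def image[symmetric] by (auto simp: le_iff)

lemma is_meet_iff:
  "\<lbrakk>a \<in> S; b \<in> S; c \<in> S\<rbrakk> \<Longrightarrow> is_meet T le' (h a) (h b) (h c) \<longleftrightarrow> is_meet S le a b c"
  unfolding is_meet_def image[symmetric] by (auto simp: le_iff)

lemma is_join_iff:
  "\<lbrakk>a \<in> S; b \<in> S; c \<in> S\<rbrakk> \<Longrightarrow> is_join T le' (h a) (h b) (h c) \<longleftrightarrow> is_join S le a b c"
  unfolding is_join_def image[symmetric] by (auto simp: le_iff)

lemma is_himp_iff:
  assumes "a \<in> S" "b \<in> S" "c \<in> S"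
  shows "is_himp T le' (h a) (h b) (h c) \<longleftrightarrow> is_himp S le a b c"
proof -
  have "(\<exists>e. is_meet T le' (h d) (h a) e \<and> le' e (h b)) \<longleftrightarrow> (\<exists>e. is_meet S le d a e \<and> le e b)"
    (is "?L = ?R") if "d \<in> S" for d
  proof
    assume ?L
    then obtain e where e: "is_meet T le' (h d) (h a) e" "le' e (h b)" by blast
    then obtain e' where "e' \<in> S" "e = h e'" using image by (auto simp: is_meet_def)
    then show ?R using e that assms is_meet_iff le_iff by blast
  next
    assume ?R
    then obtain e where e: "is_meet S le d a e" "le e b" by blast
    then have "e \<in> S" by (simp add: is_meet_def)
    then show ?L using e that assms is_meet_iff le_iff by blast
  qed
  then show ?thesis unfolding is_himp_def image[symmetric] using assms by (auto simp: le_iff)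
qed

lemma is_pseudocompl_iff:
  assumes "a \<in> S" "c \<in> S"
  shows "is_pseudocompl T le' (h a) (h c) \<longleftrightarrow> is_pseudocompl S le a c"
proof
  assume "is_pseudocompl T le' (h a) (h c)"
  then obtain z where z: "is_bot T le' z" "is_himp T le' (h a) z (h c)" unfolding is_pseudocompl_def by blast
  then obtain z' where "z' \<in> S" "z = h z'" using image by (auto simp: is_bot_def)
  then show "is_pseudocompl S le a c"
    using z is_bot_iff is_himp_iff assms unfolding is_pseudocompl_def by blast
next
  assume "is_pseudocompl S le a c"
  then obtain z where z: "is_bot S le z" "is_himp S le a z c" unfolding is_pseudocompl_def by blast
  then have "z \<in> S" by (simp add: is_bot_def)
  then show "is_pseudocompl T le' (h a) (h c)"
    using z is_bot_iff is_himp_iff assms unfolding is_pseudocompl_def by blast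
qed

end

lemma order_equivalence_comp:
  assumes "order_equivalence S le T le' h" "order_equivalence T le' U le'' k"
  shows "order_equivalence S le U le'' (\<lambda>x. k (h x))"
proof -
  interpret A: order_equivalence S le T le' h by (rule assms(1))
  interpret B: order_equivalence T le' U le'' k by (rule assms(2))
  show ?thesis
  proof
    show "(\<lambda>x. k (h x)) ` S = U" unfolding B.image[symmetric] A.image[symmetric] by (simp add: image_image)
    show "le'' (k (h a)) (k (h b)) = le a b" if "a \<in> S" "b \<in> S" for a b
      using that A.le_iff B.le_iff A.image_in by simp
  qed
qed

locale order_isomorphism = order_equivalence + H: heyting_poset S le + H': heyting_poset T le'
begin

lemma heval_image:
  assumes "\<And>i. i \<in> vars t \<Longrightarrow> v i \<in> S"
  shows "heval T le' (\<lambda>i. h (v i)) t = h (heval S le v t)"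
proof -
  have bot: "hbot T le' = h (hbot S le)"
    using H'.hbot_eq H.is_bot_hbot is_bot_iff H.bot_in by blast
  show ?thesis using assms
  proof (induction t)
    case One
    then show ?case using H'.htop_eq H.is_top_htop is_top_iff H.top_in by fastforce
  next
    case (Neg s)
    then have "heval S le v s \<in> S" by (simp add: H.heval_in)
    then have "himp T le' (h (heval S le v s)) (h (hbot S le)) = h (himp S le (heval S le v s) (hbot S le))"
      by (intro H'.himp_eq) (simp add: is_himp_iff H.is_himp_himp)
    then show ?case using Neg by (simp add: bot)
  next
    case (Or s t)
    then have "heval S le v s \<in> S" "heval S le v t \<in> S" by (simp_all add: H.heval_in)
    then have "hjoin T le' (h (heval S le v s)) (h (heval S le v t)) = h (hjoin S le (heval S le v s) (heval S le v t))"
      by (intro H'.hjoin_eq) (simp add: is_join_iff H.is_join_hjoin)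
    then show ?case using Or by simp
  next
    case (And s t)
    then have "heval S le v s \<in> S" "heval S le v t \<in> S" by (simp_all add: H.heval_in)
    then have "hmeet T le' (h (heval S le v s)) (h (heval S le v t)) = h (hmeet S le (heval S le v s) (heval S le v t))"
      by (intro H'.hmeet_eq) (simp add: is_meet_iff H.is_meet_hmeet)
    then show ?case using And by simp
  next
    case (Imp s t)
    then have "heval S le v s \<in> S" "heval S le v t \<in> S" by (simp_all add: H.heval_in)
    then have "himp T le' (h (heval S le v s)) (h (heval S le v t)) = h (himp S le (heval S le v s) (heval S le v t))"
      by (intro H'.himp_eq) (simp add: is_himp_iff H.is_himp_himp)
    then show ?case using Imp by simp
  qed (auto simp: bot)
qed

end

section \<open>Predicates and generalized elements\<close>

text \<open>The predicate true on \<open>X\<close>.\<close>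
definition tt :: "('o, 'a, 'm) cat_scheme \<Rightarrow> 'o \<Rightarrow> 'a" where
  "tt C X = truth C \<cdot>\<^bsub>C\<^esub> to_one C X"

definition stable_op ::
    "('o, 'a, 'm) cat_scheme \<Rightarrow> ('a set \<Rightarrow> ('a \<Rightarrow> 'a \<Rightarrow> bool) \<Rightarrow> 'a \<Rightarrow> 'a \<Rightarrow> 'a \<Rightarrow> bool) \<Rightarrow> bool" where
  "stable_op C R \<longleftrightarrow> (\<forall>X. \<forall>f\<in>hom C X (Omega C). \<forall>g\<in>hom C X (Omega C). \<exists>c\<in>hom C X (Omega C).
     \<forall>Y. \<forall>h\<in>hom C Y X. R (hom C Y (Omega C)) (elem_le C) (f \<cdot>\<^bsub>C\<^esub> h) (g \<cdot>\<^bsub>C\<^esub> h) (c \<cdot>\<^bsub>C\<^esub> h))"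

lemma ex1_unique: "\<lbrakk>\<exists>!x. P x; P a; P b\<rbrakk> \<Longrightarrow> a = b"
  by blast

context category
begin

lemma homD:
  assumes "f \<in> hom C A B"
  shows hom_Ar: "f \<in> Ar C" and hom_Dom: "Dom C f = A" and "Cod C f = B"
    and hom_dom_Ob: "A \<in> Ob C" and hom_cod_Ob: "B \<in> Ob C"
  using assms dom_in cod_in by (auto simp: hom_def)

lemma Ar_hom: "f \<in> Ar C \<Longrightarrow> f \<in> hom C (Dom C f) (Cod C f)"
  by (simp add: hom_def)

lemma monic_hom: "monic C m \<Longrightarrow> m \<in> hom C (Dom C m) (Cod C m)"
  by (simp add: monic_def hom_def)

lemma monic_cancel:
  "\<lbrakk>monic C m; f \<in> hom C X (Dom C m); g \<in> hom C X (Dom C m); m \<cdot> f = m \<cdot> g\<rbrakk> \<Longrightarrow> f = g"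
  unfolding monic_def using hom_dom_Ob by blast

lemma cmp_assoc':
  "\<lbrakk>f \<in> hom C A B; g \<in> hom C B D; h \<in> hom C D E\<rbrakk> \<Longrightarrow> (h \<cdot> g) \<cdot> f = h \<cdot> (g \<cdot> f)"
  by (simp add: cmp_assoc)

lemma equalizer_monic:
  assumes "is_equalizer C f g e" shows "monic C e"
proof -
  have e: "f \<in> hom C (Dom C f) (Cod C f)" "g \<in> hom C (Dom C f) (Cod C f)"
      "e \<in> hom C (Dom C e) (Dom C f)" "f \<cdot> e = g \<cdot> e"
    using assms by (auto simp: is_equalizer_def hom_def)
  have "x = y" if x: "x \<in> hom C X (Dom C e)" and y: "y \<in> hom C X (Dom C e)" and xy: "e \<cdot> x = e \<cdot> y" for X x y
  proof -
    have "f \<cdot> (e \<cdot> x) = g \<cdot> (e \<cdot> x)"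
      using cmp_assoc[OF x e(3,1)] cmp_assoc[OF x e(3,2)] e(4) by simp
    then have "\<exists>!k. k \<in> hom C X (Dom C e) \<and> e \<cdot> k = e \<cdot> x"
      using assms cmp_in[OF x e(3)] hom_dom_Ob[OF x] unfolding is_equalizer_def by blast
    then show ?thesis using x y xy by metis
  qed
  then show ?thesis using e by (auto simp: monic_def hom_def)
qed

lemma equalizer_factors_iff:
  assumes "is_equalizer C f g e" "f \<in> hom C A B" "h \<in> hom C X A"
  shows "f \<cdot> h = g \<cdot> h \<longleftrightarrow> (\<exists>k\<in>hom C X (Dom C e). e \<cdot> k = h)"
proof -
  have e: "g \<in> hom C A B" "e \<in> hom C (Dom C e) A" "f \<cdot> e = g \<cdot> e" and A: "Dom C f = A"
    using assms by (auto simp: is_equalizer_def hom_def)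
  show ?thesis
  proof
    assume "f \<cdot> h = g \<cdot> h"
    then show "\<exists>k\<in>hom C X (Dom C e). e \<cdot> k = h"
      using assms(1,3) A hom_dom_Ob[OF assms(3)] unfolding is_equalizer_def by blast
  next
    assume "\<exists>k\<in>hom C X (Dom C e). e \<cdot> k = h"
    then show "f \<cdot> h = g \<cdot> h"
      using e cmp_assoc[OF _ e(2) assms(2)] cmp_assoc[OF _ e(2) e(1)] by auto
  qed
qed

lemma product_eqI:
  assumes P: "is_product C n A P p" and h: "h \<in> hom C X P" and k: "k \<in> hom C X P"
    and eq: "\<And>i. i < n \<Longrightarrow> p i \<cdot> h = p i \<cdot> k"
  shows "h = k"
proof -
  have "\<forall>i<n. p i \<cdot> k \<in> hom C X (A i)" using P cmp_in[OF k] unfolding is_product_def by blast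
  then have ex1: "\<exists>!l. l \<in> hom C X P \<and> (\<forall>i<n. p i \<cdot> l = p i \<cdot> k)"
    using P[unfolded is_product_def, THEN conjunct2, THEN conjunct2,
        rule_format, OF hom_dom_Ob[OF h], of "\<lambda>i. p i \<cdot> k"] by simp
  show ?thesis by (rule ex1_unique[OF ex1]) (simp_all add: h k eq)
qed

text \<open>A subobject is classified by \<open>f\<close> iff an arrow factors through it exactly when \<open>f\<close> maps the arrow to the
  generic point.  Since pullbacks along a point reduce to this factorization property, the pullback squares
  disappear from the rest of the argument.\<close>
lemma point_pullback_iff:
  assumes T: "terminal C (Dom C t)" and t: "t \<in> Ar C" and m: "monic C m" and f: "f \<in> hom C (Cod C m) (Cod C t)"
  shows "(\<exists>u\<in>hom C (Dom C m) (Dom C t). is_pullback C f t m u) \<longleftrightarrow>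
    (\<forall>Y\<in>Ob C. \<forall>h\<in>hom C Y (Cod C m).
       (\<exists>k\<in>hom C Y (Dom C t). f \<cdot> h = t \<cdot> k) \<longleftrightarrow> (\<exists>k\<in>hom C Y (Dom C m). m \<cdot> k = h))"
    (is "?L \<longleftrightarrow> ?R")
proof -
  have mh: "m \<in> hom C (Dom C m) (Cod C m)" using m by (rule monic_hom)
  have th: "t \<in> hom C (Dom C t) (Cod C t)" using t by (rule Ar_hom)
  show ?thesis
  proof
    assume ?L
    then obtain u where u: "u \<in> hom C (Dom C m) (Dom C t)" and pb: "is_pullback C f t m u" by blast
    have fm: "f \<cdot> m = t \<cdot> u" using pb by (simp add: is_pullback_def)
    show ?R
    proof (intro ballI iffI)
      fix Y h assume Y: "Y \<in> Ob C" and h: "h \<in> hom C Y (Cod C m)"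
      { assume "\<exists>k\<in>hom C Y (Dom C t). f \<cdot> h = t \<cdot> k"
        then show "\<exists>k\<in>hom C Y (Dom C m). m \<cdot> k = h"
          using pb Y h hom_Dom[OF f] unfolding is_pullback_def by metis }
      { assume "\<exists>k\<in>hom C Y (Dom C m). m \<cdot> k = h"
        then obtain k where k: "k \<in> hom C Y (Dom C m)" "m \<cdot> k = h" by blast
        have "f \<cdot> h = t \<cdot> (u \<cdot> k)" using cmp_assoc[OF k(1) mh f] cmp_assoc[OF k(1) u th] fm k(2) by simp
        then show "\<exists>k\<in>hom C Y (Dom C t). f \<cdot> h = t \<cdot> k" using cmp_in[OF k(1) u] by blast }
    qed
  next
    assume R: ?R
    have M: "Dom C m \<in> Ob C" using hom_dom_Ob[OF mh] .
    obtain u where u: "u \<in> hom C (Dom C m) (Dom C t)" "f \<cdot> m = t \<cdot> u"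
      using R M mh ide_in[OF M] ide_right[OF mh] by blast
    have "\<exists>!w. w \<in> hom C X (Dom C m) \<and> m \<cdot> w = h \<and> u \<cdot> w = k"
      if X: "X \<in> Ob C" and h: "h \<in> hom C X (Dom C f)" and k: "k \<in> hom C X (Dom C t)"
        and eq: "f \<cdot> h = t \<cdot> k" for X h k
    proof -
      obtain w where w: "w \<in> hom C X (Dom C m)" "m \<cdot> w = h" using R X h k eq hom_Dom[OF f] by auto
      moreover have "u \<cdot> w = k" using T X k cmp_in[OF w(1) u(1)] unfolding terminal_def by blast
      ultimately show ?thesis using monic_cancel[OF m] by blast
    qed
    then have "is_pullback C f t m u"
      using u homD[OF f] t homD[OF u(1)] homD[OF mh] unfolding is_pullback_def by auto
    then show ?L using u(1) by blast
  qed
qed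

lemma iso_monic_iff:
  assumes m: "monic C m"
  shows "iso C m \<longleftrightarrow> (\<exists>k\<in>hom C (Cod C m) (Dom C m). m \<cdot> k = Ide C (Cod C m))" (is "_ = ?R")
proof
  show "iso C m \<Longrightarrow> ?R" by (auto simp: iso_def)
  assume ?R
  then obtain k where k: "k \<in> hom C (Cod C m) (Dom C m)" "m \<cdot> k = Ide C (Cod C m)" by blast
  have mh: "m \<in> hom C (Dom C m) (Cod C m)" using m by (rule monic_hom)
  have "m \<cdot> (k \<cdot> m) = m \<cdot> Ide C (Dom C m)"
    using cmp_assoc[OF mh k(1) mh] k(2) ide_left[OF mh] ide_right[OF mh] by simp
  then have "k \<cdot> m = Ide C (Dom C m)"
    using monic_cancel[OF m] cmp_in[OF mh k(1)] ide_in[OF hom_dom_Ob[OF mh]] by blast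
  then show "iso C m" using k mh by (auto simp: iso_def hom_def)
qed

end

text \<open>The part of the structure of a topos that the definition of satisfaction depends on.  Both a topos and its
  categories of sheaves are instances.\<close>
locale classifying_category = category C for C :: "('o, 'a, 'm) cat_scheme" (structure) +
  assumes ex_truth: "\<exists>t. is_truth C t"
    and ex_equalizer: "\<lbrakk>f \<in> hom C X (Omega C); g \<in> hom C X (Omega C)\<rbrakk> \<Longrightarrow> \<exists>e. is_equalizer C f g e"
    and ex_power: "\<exists>P p. is_product C n (\<lambda>_. Omega C) P p"
begin

abbreviation preds :: "'o \<Rightarrow> 'a set" where "preds X \<equiv> hom C X (Omega C)"
abbreviation bot_at where "bot_at X \<equiv> hbot (preds X) (elem_le C)"
abbreviation meet_at where "meet_at X \<equiv> hmeet (preds X) (elem_le C)"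
abbreviation join_at where "join_at X \<equiv> hjoin (preds X) (elem_le C)"
abbreviation imp_at where "imp_at X \<equiv> himp (preds X) (elem_le C)"
abbreviation neg_at where "neg_at X f \<equiv> imp_at X f (bot_at X)"
abbreviation eval_at where "eval_at X \<equiv> heval (preds X) (elem_le C)"

lemma truth_is_truth: "is_truth C (truth C)"
  unfolding truth_def using ex_truth by (rule someI_ex)

lemma one_terminal: "terminal C (one C)"
  using truth_is_truth by (simp add: is_truth_def one_def)

lemma truth_in: "truth C \<in> hom C (one C) (Omega C)"
  using truth_is_truth by (simp add: is_truth_def one_def Omega_def hom_def)

lemma one_Ob: "one C \<in> Ob C" and Omega_Ob: "Omega C \<in> Ob C"
  using homD[OF truth_in] by auto

lemma to_one_in: "X \<in> Ob C \<Longrightarrow> to_one C X \<in> hom C X (one C)"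
  using one_terminal theI'[of "\<lambda>u. u \<in> hom C X (one C)"] unfolding terminal_def to_one_def by blast

lemma to_one_unique: "u \<in> hom C X (one C) \<Longrightarrow> u = to_one C X"
  using one_terminal to_one_in hom_dom_Ob unfolding terminal_def by blast

lemma tt_in: "X \<in> Ob C \<Longrightarrow> tt C X \<in> preds X"
  unfolding tt_def using to_one_in truth_in cmp_in by blast

lemma tt_cmp: assumes "h \<in> hom C Y X" shows "tt C X \<cdot> h = tt C Y"
proof -
  have X: "to_one C X \<in> hom C X (one C)" using to_one_in assms hom_cod_Ob by blast
  show ?thesis
    unfolding tt_def using to_one_unique[OF cmp_in[OF assms X]] cmp_assoc[OF assms X truth_in] by simp
qed

lemma truth_eq_tt: "truth C = tt C (one C)"
  unfolding tt_def using to_one_unique[OF ide_in[OF one_Ob]] ide_right[OF truth_in] by simp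

lemma classifies_iff:
  "classifies C f m \<longleftrightarrow> monic C m \<and> f \<in> preds (Cod C m) \<and>
     (\<forall>Y\<in>Ob C. \<forall>h\<in>hom C Y (Cod C m). f \<cdot> h = tt C Y \<longleftrightarrow> (\<exists>k\<in>hom C Y (Dom C m). m \<cdot> k = h))"
proof (cases "monic C m \<and> f \<in> preds (Cod C m)")
  case True
  then have m: "monic C m" and f: "f \<in> hom C (Cod C m) (Cod C (truth C))" by (auto simp: Omega_def)
  have "Dom C m \<in> Ob C" using monic_hom[OF m] by (rule hom_dom_Ob)
  then have "is_pullback C f (truth C) m (to_one C (Dom C m)) \<longleftrightarrow>
      (\<exists>u\<in>hom C (Dom C m) (Dom C (truth C)). is_pullback C f (truth C) m u)"
    using to_one_in to_one_unique unfolding one_def by metis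
  also have "\<dots> \<longleftrightarrow> (\<forall>Y\<in>Ob C. \<forall>h\<in>hom C Y (Cod C m).
      (\<exists>k\<in>hom C Y (Dom C (truth C)). f \<cdot> h = truth C \<cdot> k) \<longleftrightarrow> (\<exists>k\<in>hom C Y (Dom C m). m \<cdot> k = h))"
    by (rule point_pullback_iff[OF one_terminal[unfolded one_def] hom_Ar[OF truth_in] m f])
  finally have pb: "is_pullback C f (truth C) m (to_one C (Dom C m)) \<longleftrightarrow> (\<forall>Y\<in>Ob C. \<forall>h\<in>hom C Y (Cod C m).
      (\<exists>k\<in>hom C Y (Dom C (truth C)). f \<cdot> h = truth C \<cdot> k) \<longleftrightarrow> (\<exists>k\<in>hom C Y (Dom C m). m \<cdot> k = h))" .
  have "(\<exists>k\<in>hom C Y (Dom C (truth C)). f \<cdot> h = truth C \<cdot> k) \<longleftrightarrow> f \<cdot> h = tt C Y" if "Y \<in> Ob C" for Y h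
    using to_one_in[OF that] to_one_unique unfolding one_def tt_def by metis
  then show ?thesis using True pb by (simp add: classifies_def)
qed (auto simp: classifies_def)

lemma ex_classifier: assumes m: "monic C m" shows "\<exists>f. classifies C f m"
proof -
  obtain f u where "f \<in> preds (Cod C m)" "u \<in> hom C (Dom C m) (one C)" "is_pullback C f (truth C) m u"
    using truth_is_truth m unfolding is_truth_def one_def Omega_def by blast
  then show ?thesis using m to_one_unique by (auto simp: classifies_def)
qed

lemma classifier_unique:
  assumes "classifies C f m" "classifies C g m" shows "f = g"
proof -
  have m: "monic C m" using assms by (simp add: classifies_def)
  have u: "to_one C (Dom C m) \<in> hom C (Dom C m) (one C)"
    using m monic_hom hom_dom_Ob to_one_in by blast
  have "\<exists>!\<chi>. \<chi> \<in> preds (Cod C m) \<and> (\<exists>u\<in>hom C (Dom C m) (one C). is_pullback C \<chi> (truth C) m u)"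
    using truth_is_truth m unfolding is_truth_def one_def Omega_def by blast
  then show ?thesis using assms u unfolding classifies_def by blast
qed

lemma equalizer_tt_classifies:
  assumes f: "f \<in> preds X" and e: "is_equalizer C f (tt C X) e"
  shows "classifies C f e"
proof -
  have "Cod C e = X" using e homD[OF f] by (simp add: is_equalizer_def)
  then show ?thesis
    using f equalizer_monic[OF e] equalizer_factors_iff[OF e f] tt_cmp by (auto simp: classifies_iff)
qed

lemma ex_classified:
  assumes f: "f \<in> preds X" obtains m where "classifies C f m" "m \<in> hom C (Dom C m) X"
proof -
  obtain m where m: "classifies C f m"
    using ex_equalizer[OF f tt_in] f equalizer_tt_classifies hom_dom_Ob by blast
  have "monic C m" "Cod C m = X" using m homD[OF f] by (auto simp: classifies_def hom_def)
  then show ?thesis using that m monic_hom by metis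
qed

lemma classified_hom:
  "\<lbrakk>classifies C f m; f \<in> preds X\<rbrakk> \<Longrightarrow> m \<in> hom C (Dom C m) X"
  using monic_hom[of m] by (auto simp: classifies_def hom_def)

lemma factors_iff:
  assumes "classifies C f m" "f \<in> preds X" "h \<in> hom C Y X"
  shows "f \<cdot> h = tt C Y \<longleftrightarrow> (\<exists>k\<in>hom C Y (Dom C m). m \<cdot> k = h)"
proof -
  have "Cod C m = X" using assms(1,2) by (auto simp: classifies_def hom_def)
  then show ?thesis using assms hom_dom_Ob[OF assms(3)] by (simp add: classifies_iff)
qed

lemma classified_tt:
  assumes "classifies C f m" "f \<in> preds X" shows "f \<cdot> m = tt C (Dom C m)"
proof -
  have m: "m \<in> hom C (Dom C m) X" using classified_hom[OF assms] .
  show ?thesis using factors_iff[OF assms m] ide_in[OF hom_dom_Ob[OF m]] ide_right[OF m] by blast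
qed

text \<open>Predicates on \<open>X\<close> are extensional: the arrows along which a predicate becomes true are those that factor
  through the subobject it classifies, and they determine this subobject.\<close>
lemma pred_eqI:
  assumes f: "f \<in> preds X" and g: "g \<in> preds X"
    and eq: "\<And>Y h. h \<in> hom C Y X \<Longrightarrow> f \<cdot> h = tt C Y \<longleftrightarrow> g \<cdot> h = tt C Y"
  shows "f = g"
proof -
  obtain m where m: "classifies C f m" using ex_classified[OF f] by blast
  moreover have "classifies C g m"
    using m g eq homD[OF f] homD[OF g] unfolding classifies_iff by (auto simp: hom_def)
  ultimately show ?thesis by (rule classifier_unique)
qed

text \<open>Kripke-Joyal semantics of the order.\<close>
lemma elem_le_iff:
  assumes f: "f \<in> preds X" and g: "g \<in> preds X"
  shows "elem_le C f g \<longleftrightarrow> (\<forall>Y h. h \<in> hom C Y X \<longrightarrow> f \<cdot> h = tt C Y \<longrightarrow> g \<cdot> h = tt C Y)"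
proof
  assume "elem_le C f g"
  then obtain m k where mk: "classifies C f m" "classifies C g k" "sub_le C m k"
    unfolding elem_le_def by blast
  then obtain l where l: "l \<in> hom C (Dom C m) (Dom C k)" "k \<cdot> l = m" unfolding sub_le_def by blast
  have k: "k \<in> hom C (Dom C k) X" using classified_hom mk(2) g by blast
  show "\<forall>Y h. h \<in> hom C Y X \<longrightarrow> f \<cdot> h = tt C Y \<longrightarrow> g \<cdot> h = tt C Y"
  proof (intro allI impI)
    fix Y h assume h: "h \<in> hom C Y X" "f \<cdot> h = tt C Y"
    then obtain r where r: "r \<in> hom C Y (Dom C m)" "m \<cdot> r = h" using factors_iff[OF mk(1) f] by blast
    have "k \<cdot> (l \<cdot> r) = h" using cmp_assoc[OF r(1) l(1) k] l r by simp
    then show "g \<cdot> h = tt C Y" using factors_iff[OF mk(2) g h(1)] cmp_in[OF r(1) l(1)] by blast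
  qed
next
  assume R: "\<forall>Y h. h \<in> hom C Y X \<longrightarrow> f \<cdot> h = tt C Y \<longrightarrow> g \<cdot> h = tt C Y"
  obtain m where m: "classifies C f m" "m \<in> hom C (Dom C m) X" using ex_classified[OF f] by blast
  obtain k where k: "classifies C g k" using ex_classified[OF g] by blast
  have "g \<cdot> m = tt C (Dom C m)" using R m classified_tt[OF m(1) f] by blast
  then have "sub_le C m k" using factors_iff[OF k g m(2)] by (simp add: sub_le_def)
  then show "elem_le C f g" using m k unfolding elem_le_def by blast
qed

lemma elem_le_cmp:
  assumes "f \<in> preds X" "g \<in> preds X" "h \<in> hom C Y X" "elem_le C f g"
  shows "elem_le C (f \<cdot> h) (g \<cdot> h)"
proof -
  have "f \<cdot> h \<in> preds Y" "g \<cdot> h \<in> preds Y" using assms cmp_in by blast+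
  moreover have "(g \<cdot> h) \<cdot> k = tt C Z" if k: "k \<in> hom C Z Y" and e: "(f \<cdot> h) \<cdot> k = tt C Z" for Z k
    using assms(4) cmp_in[OF k assms(3)] e cmp_assoc'[OF k assms(3,1)] cmp_assoc'[OF k assms(3,2)]
    by (simp add: elem_le_iff[OF assms(1,2)])
  ultimately show ?thesis by (simp add: elem_le_iff)
qed

lemma preds_poset: "poset_on (preds X) (elem_le C)"
proof
  show "elem_le C a a" if "a \<in> preds X" for a using that by (simp add: elem_le_iff)
  show "elem_le C a c"
    if "a \<in> preds X" "b \<in> preds X" "c \<in> preds X" "elem_le C a b" "elem_le C b c" for a b c
    using that by (simp add: elem_le_iff)
  show "a = b" if "a \<in> preds X" "b \<in> preds X" "elem_le C a b" "elem_le C b a" for a b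
    using that by (intro pred_eqI) (auto simp: elem_le_iff)
qed

lemma is_top_tt: "X \<in> Ob C \<Longrightarrow> is_top (preds X) (elem_le C) (tt C X)"
  by (simp add: is_top_def elem_le_iff tt_in tt_cmp)

lemma htop_preds: "X \<in> Ob C \<Longrightarrow> htop (preds X) (elem_le C) = tt C X"
  using poset_on.htop_eq[OF preds_poset is_top_tt] .

lemma power_product: "is_product C n (\<lambda>_. Omega C) (Omega_pow C n) (proj C n)"
proof -
  have "\<exists>x. case x of (P, p) \<Rightarrow> is_product C n (\<lambda>_. Omega C) P p" using ex_power by auto
  from someI_ex[OF this] show ?thesis by (simp add: Opow_def case_prod_unfold)
qed

lemma power_Ob: "Omega_pow C n \<in> Ob C"
  using power_product[of n] by (simp add: is_product_def)

lemma proj_in: "i < n \<Longrightarrow> proj C n i \<in> preds (Omega_pow C n)"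
  using power_product[of n] by (simp add: is_product_def)

lemma tuple_ex:
  assumes "X \<in> Ob C" "\<And>i. i < n \<Longrightarrow> f i \<in> preds X"
  shows "\<exists>h\<in>hom C X (Omega_pow C n). \<forall>i<n. proj C n i \<cdot> h = f i"
  using power_product[of n] assms unfolding is_product_def by blast

lemma tuple_eqI:
  assumes "h \<in> hom C X (Omega_pow C n)" "k \<in> hom C X (Omega_pow C n)"
    and "\<And>i. i < n \<Longrightarrow> proj C n i \<cdot> h = proj C n i \<cdot> k"
  shows "h = k"
  by (rule product_eqI[OF power_product assms])

lemma
  assumes f: "f \<in> preds X" and g: "g \<in> preds X"
  shows pair_in: "pair C f g \<in> hom C X (Omega_pow C 2)"
    and pair_proj0: "proj C 2 0 \<cdot> pair C f g = f"
    and pair_proj1: "proj C 2 1 \<cdot> pair C f g = g"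
proof -
  have "\<exists>h\<in>hom C X (Omega_pow C 2). \<forall>i<2. proj C 2 i \<cdot> h = (if i = 0 then f else g)"
    by (rule tuple_ex[OF hom_dom_Ob[OF f]]) (simp add: f g)
  then obtain h where h: "h \<in> hom C X (Omega_pow C 2)"
    and hi: "\<forall>i<2. proj C 2 i \<cdot> h = (if i = 0 then f else g)" by (elim bexE)
  have h01: "proj C 2 0 \<cdot> h = f" "proj C 2 1 \<cdot> h = g"
    using hi[rule_format, of 0] hi[rule_format, of 1] by simp_all
  have un: "k = h" if k: "k \<in> hom C X (Omega_pow C 2)" "proj C 2 0 \<cdot> k = f" "proj C 2 1 \<cdot> k = g" for k
  proof (rule tuple_eqI[OF k(1) h])
    fix i :: nat assume "i < 2" then have "i = 0 \<or> i = 1" by auto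
    then show "proj C 2 i \<cdot> k = proj C 2 i \<cdot> h" using k h01 by metis
  qed
  have "pair C f g = h" unfolding pair_def hom_Dom[OF f]
  proof (rule the_equality)
    show "h \<in> hom C X (Omega_pow C 2) \<and> proj C 2 0 \<cdot> h = f \<and> proj C 2 1 \<cdot> h = g"
      using h h01 by (intro conjI)
    show "k = h" if "k \<in> hom C X (Omega_pow C 2) \<and> proj C 2 0 \<cdot> k = f \<and> proj C 2 1 \<cdot> k = g" for k
      using un that by (elim conjE)
  qed
  then show "pair C f g \<in> hom C X (Omega_pow C 2)" "proj C 2 0 \<cdot> pair C f g = f" "proj C 2 1 \<cdot> pair C f g = g"
    using h h01 by (simp_all only:)
qed

lemma pair_eqI:
  assumes h: "h \<in> hom C X (Omega_pow C 2)" and "proj C 2 0 \<cdot> h = f" "proj C 2 1 \<cdot> h = g"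
  shows "h = pair C f g"
proof -
  have f: "f \<in> preds X" and g: "g \<in> preds X" using assms proj_in cmp_in[OF h] by auto
  show ?thesis
  proof (rule tuple_eqI[OF h pair_in[OF f g]])
    fix i :: nat assume "i < 2" then have "i = 0 \<or> i = 1" by auto
    then show "proj C 2 i \<cdot> h = proj C 2 i \<cdot> pair C f g"
      using assms pair_proj0[OF f g] pair_proj1[OF f g] by auto
  qed
qed

lemma pair_cmp:
  assumes f: "f \<in> preds X" and g: "g \<in> preds X" and h: "h \<in> hom C Y X"
  shows "pair C f g \<cdot> h = pair C (f \<cdot> h) (g \<cdot> h)"
proof (rule pair_eqI)
  show "pair C f g \<cdot> h \<in> hom C Y (Omega_pow C 2)" using cmp_in[OF h pair_in[OF f g]] .
  have p: "proj C 2 0 \<in> preds (Omega_pow C 2)" "proj C 2 1 \<in> preds (Omega_pow C 2)" by (simp_all add: proj_in)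
  show "proj C 2 0 \<cdot> (pair C f g \<cdot> h) = f \<cdot> h" "proj C 2 1 \<cdot> (pair C f g \<cdot> h) = g \<cdot> h"
    using cmp_assoc[OF h pair_in[OF f g] p(1)] cmp_assoc[OF h pair_in[OF f g] p(2)]
      pair_proj0[OF f g] pair_proj1[OF f g] by simp_all
qed

text \<open>Yoneda: if the operation \<open>R\<close> is stable under substitution, its value at the two projections \<open>\<Omega>\<^sup>2 \<rightarrow> \<Omega>\<close> is an
  arrow that induces the operation everywhere, and an arrow that induces it is determined by this value.\<close>
lemma binary_op:
  assumes stable: "stable_op C R"
    and R_unique: "\<And>X f g c d. \<lbrakk>R (preds X) (elem_le C) f g c; R (preds X) (elem_le C) f g d\<rbrakk> \<Longrightarrow> c = d"
  shows "is_binary_op C R (THE v. is_binary_op C R v)"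
proof -
  let ?P = "Omega_pow C 2"
  have p: "proj C 2 0 \<in> preds ?P" "proj C 2 1 \<in> preds ?P" by (simp_all add: proj_in)
  from stable p obtain v where v: "v \<in> preds ?P"
    and R: "\<And>Y h. h \<in> hom C Y ?P \<Longrightarrow> R (preds Y) (elem_le C) (proj C 2 0 \<cdot> h) (proj C 2 1 \<cdot> h) (v \<cdot> h)"
    unfolding stable_op_def by blast
  have idP: "Ide C ?P \<in> hom C ?P ?P" by (rule ide_in[OF power_Ob])
  have Rv: "R (preds ?P) (elem_le C) (proj C 2 0) (proj C 2 1) v"
    using R[OF idP] ide_right[OF p(1)] ide_right[OF p(2)] ide_right[OF v] by simp
  have vop: "is_binary_op C R v"
    unfolding is_binary_op_def
  proof (intro conjI ballI)
    fix X f g assume fg: "f \<in> preds X" "g \<in> preds X"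
    show "R (preds X) (elem_le C) f g (v \<cdot> pair C f g)"
      using R[OF pair_in[OF fg]] by (simp only: pair_proj0[OF fg] pair_proj1[OF fg])
  qed (rule v)
  have "w = v" if w: "is_binary_op C R w" for w
  proof -
    have pp: "pair C (proj C 2 0) (proj C 2 1) = Ide C ?P"
      using pair_eqI[OF idP] ide_right[OF p(1)] ide_right[OF p(2)] by simp
    have wh: "w \<in> preds ?P" using w by (simp add: is_binary_op_def)
    have "R (preds ?P) (elem_le C) (proj C 2 0) (proj C 2 1) (w \<cdot> pair C (proj C 2 0) (proj C 2 1))"
      using w power_Ob p unfolding is_binary_op_def by blast
    then have "R (preds ?P) (elem_le C) (proj C 2 0) (proj C 2 1) w"
      by (simp only: pp ide_right[OF wh])
    then show ?thesis using R_unique Rv by blast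
  qed
  then show ?thesis using vop theI[of "is_binary_op C R" v] by blast
qed

end

section \<open>Categories with a Heyting algebra of truth values\<close>

text \<open>Falsity is required as one arrow \<open>1 \<rightarrow> \<Omega>\<close>, which makes its stability under substitution automatic.\<close>
locale heyting_category = classifying_category C for C :: "('o, 'a, 'm) cat_scheme" (structure) +
  assumes stable_bot: "\<exists>z\<in>hom C (one C) (Omega C).
      \<forall>X\<in>Ob C. is_bot (hom C X (Omega C)) (elem_le C) (z \<cdot> to_one C X)"
    and stable_meet: "stable_op C is_meet"
    and stable_join: "stable_op C is_join"
    and stable_himp: "stable_op C is_himp"
begin

lemma and_binary: "is_binary_op C is_meet (and_op C)"
  unfolding and_op_def
  by (rule binary_op[OF stable_meet]) (rule poset_on.is_meet_unique[OF preds_poset])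

lemma or_binary: "is_binary_op C is_join (or_op C)"
  unfolding or_op_def
  by (rule binary_op[OF stable_join]) (rule poset_on.is_join_unique[OF preds_poset])

lemma imp_binary: "is_binary_op C is_himp (imp_op C)"
  unfolding imp_op_def
  by (rule binary_op[OF stable_himp]) (rule poset_on.is_himp_unique[OF preds_poset])

lemma
  assumes "is_binary_op C R v"
  shows is_binary_op_in: "v \<in> preds (Omega_pow C 2)"
    and is_binary_op_rel: "\<lbrakk>f \<in> preds X; g \<in> preds X\<rbrakk> \<Longrightarrow> R (preds X) (elem_le C) f g (v \<cdot> pair C f g)"
  using assms hom_dom_Ob unfolding is_binary_op_def by blast+

lemmas op_in = is_binary_op_in[OF and_binary] is_binary_op_in[OF or_binary] is_binary_op_in[OF imp_binary]

lemma heyting_preds: assumes X: "X \<in> Ob C" shows "heyting_poset (preds X) (elem_le C)"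
proof (intro heyting_poset.intro preds_poset heyting_poset_axioms.intro)
  show "\<exists>z. is_top (preds X) (elem_le C) z" using is_top_tt[OF X] by blast
  show "\<exists>z. is_bot (preds X) (elem_le C) z" using stable_bot X by blast
  show "\<exists>c. is_meet (preds X) (elem_le C) a b c" if "a \<in> preds X" "b \<in> preds X" for a b
    using is_binary_op_rel[OF and_binary that] by blast
  show "\<exists>c. is_join (preds X) (elem_le C) a b c" if "a \<in> preds X" "b \<in> preds X" for a b
    using is_binary_op_rel[OF or_binary that] by blast
  show "\<exists>c. is_himp (preds X) (elem_le C) a b c" if "a \<in> preds X" "b \<in> preds X" for a b
    using is_binary_op_rel[OF imp_binary that] by blast
qed

lemma hmeet_preds: "\<lbrakk>f \<in> preds X; g \<in> preds X\<rbrakk> \<Longrightarrow> meet_at X f g = and_op C \<cdot> pair C f g"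
  by (rule poset_on.hmeet_eq[OF preds_poset is_binary_op_rel[OF and_binary]])

lemma hjoin_preds: "\<lbrakk>f \<in> preds X; g \<in> preds X\<rbrakk> \<Longrightarrow> join_at X f g = or_op C \<cdot> pair C f g"
  by (rule poset_on.hjoin_eq[OF preds_poset is_binary_op_rel[OF or_binary]])

lemma himp_preds: "\<lbrakk>f \<in> preds X; g \<in> preds X\<rbrakk> \<Longrightarrow> imp_at X f g = imp_op C \<cdot> pair C f g"
  by (rule poset_on.himp_eq[OF preds_poset is_binary_op_rel[OF imp_binary]])

lemma binary_cmp:
  assumes "v \<in> preds (Omega_pow C 2)" "f \<in> preds X" "g \<in> preds X" "h \<in> hom C Y X"
  shows "(v \<cdot> pair C f g) \<cdot> h = v \<cdot> pair C (f \<cdot> h) (g \<cdot> h)"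
  using cmp_assoc[OF assms(4) pair_in[OF assms(2,3)] assms(1)] pair_cmp[OF assms(2-4)] by simp

lemma hmeet_cmp: "\<lbrakk>f \<in> preds X; g \<in> preds X; h \<in> hom C Y X\<rbrakk> \<Longrightarrow>
    meet_at X f g \<cdot> h = meet_at Y (f \<cdot> h) (g \<cdot> h)"
  using binary_cmp[OF op_in(1)] cmp_in[of h Y X] by (simp add: hmeet_preds)

lemma hjoin_cmp: "\<lbrakk>f \<in> preds X; g \<in> preds X; h \<in> hom C Y X\<rbrakk> \<Longrightarrow>
    join_at X f g \<cdot> h = join_at Y (f \<cdot> h) (g \<cdot> h)"
  using binary_cmp[OF op_in(2)] cmp_in[of h Y X] by (simp add: hjoin_preds)

lemma himp_cmp: "\<lbrakk>f \<in> preds X; g \<in> preds X; h \<in> hom C Y X\<rbrakk> \<Longrightarrow>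
    imp_at X f g \<cdot> h = imp_at Y (f \<cdot> h) (g \<cdot> h)"
  using binary_cmp[OF op_in(3)] cmp_in[of h Y X] by (simp add: himp_preds)

lemma
  shows false_op_in: "false_op C \<in> preds (one C)"
    and hbot_preds: "X \<in> Ob C \<Longrightarrow> bot_at X = false_op C \<cdot> to_one C X"
proof -
  let ?Z = "\<lambda>z. z \<in> preds (one C) \<and> (\<forall>X\<in>Ob C. is_bot (preds X) (elem_le C) (z \<cdot> to_one C X))"
  have id: "to_one C (one C) = Ide C (one C)" using to_one_unique[OF ide_in[OF one_Ob]] by simp
  have bot: "is_bot (preds (one C)) (elem_le C) z" if "?Z z" for z
  proof -
    have "z \<in> preds (one C)" "is_bot (preds (one C)) (elem_le C) (z \<cdot> to_one C (one C))"
      using that one_Ob by blast+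
    then show ?thesis by (simp add: id ide_right)
  qed
  have "z = z'" if "?Z z" "?Z z'" for z z'
    using poset_on.is_bot_unique[OF preds_poset bot[OF that(1)] bot[OF that(2)]] .
  then have "\<exists>!z. ?Z z" using stable_bot by blast
  from theI'[OF this] have Z: "?Z (false_op C)" unfolding false_op_def .
  then show "false_op C \<in> preds (one C)" by blast
  show "X \<in> Ob C \<Longrightarrow> bot_at X = false_op C \<cdot> to_one C X"
    using Z poset_on.hbot_eq[OF preds_poset] by blast
qed

lemma hbot_cmp:
  assumes h: "h \<in> hom C Y X"
  shows "bot_at X \<cdot> h = bot_at Y"
proof -
  have X: "X \<in> Ob C" and Y: "Y \<in> Ob C" using h hom_dom_Ob hom_cod_Ob by auto
  show ?thesis
    using cmp_assoc[OF h to_one_in[OF X] false_op_in] to_one_unique[OF cmp_in[OF h to_one_in[OF X]]]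
    by (simp add: hbot_preds X Y)
qed

lemma hbot_in: "X \<in> Ob C \<Longrightarrow> bot_at X \<in> preds X"
  using heyting_poset.bot_in[OF heyting_preds] .

lemma hneg_cmp: "\<lbrakk>f \<in> preds X; h \<in> hom C Y X\<rbrakk> \<Longrightarrow> neg_at X f \<cdot> h = neg_at Y (f \<cdot> h)"
  using himp_cmp[of f X "bot_at X" h Y] hbot_in hom_dom_Ob by (simp add: hbot_cmp)

lemma
  shows neg_op_in: "neg_op C \<in> preds (Omega C)"
    and hneg_preds: "f \<in> preds X \<Longrightarrow> neg_op C \<cdot> f = neg_at X f"
proof -
  let ?O = "Omega C"
  let ?N = "\<lambda>v. v \<in> preds ?O \<and>
     (\<forall>X\<in>Ob C. \<forall>f\<in>preds X. is_pseudocompl (preds X) (elem_le C) f (v \<cdot> f))"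
  have id: "Ide C ?O \<in> preds ?O" by (rule ide_in[OF Omega_Ob])
  have iff: "?N v \<longleftrightarrow> v \<in> preds ?O \<and> (\<forall>X\<in>Ob C. \<forall>f\<in>preds X. v \<cdot> f = neg_at X f)" for v
    by (simp add: heyting_poset.is_pseudocompl_iff[OF heyting_preds] cong: ball_cong)
  let ?v = "neg_at ?O (Ide C ?O)"
  have v: "?v \<in> preds ?O"
    by (rule heyting_poset.imp_in[OF heyting_preds[OF Omega_Ob] id hbot_in[OF Omega_Ob]])
  have "?v \<cdot> f = neg_at X f" if "f \<in> preds X" for X f
    using hneg_cmp[OF id that] by (simp only: ide_left[OF that])
  then have "?N ?v" using v unfolding iff by blast
  moreover have "w = ?v" if "?N w" for w
  proof -
    have w: "w \<in> preds ?O" "w \<cdot> Ide C ?O = neg_at ?O (Ide C ?O)"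
      using that id Omega_Ob unfolding iff by blast+
    show ?thesis using w(2) by (simp only: ide_right[OF w(1)])
  qed
  ultimately have "\<exists>!v. ?N v" by blast
  from theI'[OF this] have N: "?N (neg_op C)" unfolding neg_op_def .
  then show "neg_op C \<in> preds ?O" by blast
  show "f \<in> preds X \<Longrightarrow> neg_op C \<cdot> f = neg_at X f" using N hom_dom_Ob unfolding iff by blast
qed

lemma interp_in: "vars t \<subseteq> {..<n} \<Longrightarrow> interp C n t \<in> preds (Omega_pow C n)"
proof (induction t)
  case Zero show ?case using cmp_in[OF to_one_in[OF power_Ob] false_op_in] by simp
next
  case One show ?case using cmp_in[OF to_one_in[OF power_Ob] truth_in] by simp
next
  case (Neg t) then show ?case using cmp_in neg_op_in by simp
next
  case (Or s t) then show ?case using cmp_in[OF pair_in op_in(2)] by simp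
next
  case (And s t) then show ?case using cmp_in[OF pair_in op_in(1)] by simp
next
  case (Imp s t) then show ?case using cmp_in[OF pair_in op_in(3)] by simp
qed (auto intro: proj_in)

lemma interp_cmp:
  assumes h: "h \<in> hom C X (Omega_pow C n)"
  shows "vars t \<subseteq> {..<n} \<Longrightarrow> interp C n t \<cdot> h = eval_at X (\<lambda>i. proj C n i \<cdot> h) t"
proof (induction t)
  case Zero
  then show ?case
    using hbot_cmp[OF h] by (simp add: hbot_preds power_Ob)
next
  case One
  then show ?case
    using tt_cmp[OF h] hom_dom_Ob[OF h] by (simp add: htop_preds tt_def)
next
  case (Neg t)
  then have t: "interp C n t \<in> preds (Omega_pow C n)" using interp_in by simp
  from Neg show ?case
    using cmp_assoc[OF h t neg_op_in] hneg_preds[OF cmp_in[OF h t]] by simp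
next
  case (Or s t)
  then have st: "interp C n s \<in> preds (Omega_pow C n)" "interp C n t \<in> preds (Omega_pow C n)"
    using interp_in by simp_all
  with Or show ?case
    using binary_cmp[OF op_in(2) st h] hjoin_preds[OF cmp_in[OF h st(1)] cmp_in[OF h st(2)]] by simp
next
  case (And s t)
  then have st: "interp C n s \<in> preds (Omega_pow C n)" "interp C n t \<in> preds (Omega_pow C n)"
    using interp_in by simp_all
  with And show ?case
    using binary_cmp[OF op_in(1) st h] hmeet_preds[OF cmp_in[OF h st(1)] cmp_in[OF h st(2)]] by simp
next
  case (Imp s t)
  then have st: "interp C n s \<in> preds (Omega_pow C n)" "interp C n t \<in> preds (Omega_pow C n)"
    using interp_in by simp_all
  with Imp show ?case
    using binary_cmp[OF op_in(3) st h] himp_preds[OF cmp_in[OF h st(1)] cmp_in[OF h st(2)]] by simp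
qed simp

lemma axiom_equalizer_classifies:
  assumes "vars t \<subseteq> {..<n}" shows "classifies C (interp C n t) (axiom_equalizer C n t)"
proof -
  have t: "interp C n t \<in> preds (Omega_pow C n)" using interp_in[OF assms] .
  have "\<exists>e. is_equalizer C (interp C n t) (tt C (Omega_pow C n)) e"
    using ex_equalizer[OF t tt_in[OF power_Ob]] .
  then have "is_equalizer C (interp C n t) (tt C (Omega_pow C n)) (axiom_equalizer C n t)"
    unfolding axiom_equalizer_def equalizer_def tt_def by (rule someI_ex)
  then show ?thesis by (rule equalizer_tt_classifies[OF t])
qed

lemma iso_classified_iff:
  assumes "classifies C f m" "f \<in> preds X" shows "iso C m \<longleftrightarrow> f = tt C X"
proof -
  have X: "X \<in> Ob C" "Ide C X \<in> hom C X X" using assms(2) hom_dom_Ob ide_in by auto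
  have "monic C m" "Cod C m = X" using assms by (auto simp: classifies_def hom_def)
  then show ?thesis
    using factors_iff[OF assms X(2)] iso_monic_iff[of m] ide_right[OF assms(2)] by simp
qed

text \<open>The projections \<open>\<Omega>\<^sup>n \<rightarrow> \<Omega>\<close> are the generic valuation: the interpretation of the term is its value there, and
  every other valuation with values in some \<open>Hom(X, \<Omega>)\<close> is a substitution instance of it.\<close>
theorem satisfies_iff:
  assumes "vars t \<subseteq> {..<n}"
  shows "satisfies C n t \<longleftrightarrow>
    (\<forall>X\<in>Ob C. \<forall>f. (\<forall>i<n. f i \<in> preds X) \<longrightarrow> eval_at X f t = tt C X)" (is "_ \<longleftrightarrow> ?R")
proof -
  let ?P = "Omega_pow C n"
  have t: "interp C n t \<in> preds ?P" using interp_in[OF assms] .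
  have id: "Ide C ?P \<in> hom C ?P ?P" using ide_in[OF power_Ob] .
  have "satisfies C n t \<longleftrightarrow> interp C n t = tt C ?P"
    unfolding satisfies_def using iso_classified_iff[OF axiom_equalizer_classifies[OF assms] t] .
  also have "\<dots> \<longleftrightarrow> ?R"
  proof
    assume eq: "interp C n t = tt C ?P"
    show ?R
    proof (intro ballI allI impI)
      fix X f assume X: "X \<in> Ob C" and f: "\<forall>i<n. f i \<in> preds X"
      then obtain h where h: "h \<in> hom C X ?P" "\<forall>i<n. proj C n i \<cdot> h = f i"
        using tuple_ex[of X n f] by blast
      have "eval_at X f t = eval_at X (\<lambda>i. proj C n i \<cdot> h) t"
        using h assms by (intro heval_cong) auto
      then show "eval_at X f t = tt C X"
        using interp_cmp[OF h(1) assms] tt_cmp[OF h(1)] eq by simp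
    qed
  next
    assume R: ?R
    have p: "\<forall>i<n. proj C n i \<cdot> Ide C ?P \<in> preds ?P" using cmp_in[OF id] proj_in by blast
    have "interp C n t \<cdot> Ide C ?P = tt C ?P"
      unfolding interp_cmp[OF id assms] using R[rule_format, OF power_Ob, of "\<lambda>i. proj C n i \<cdot> Ide C ?P"] p by blast
    then show "interp C n t = tt C ?P" using ide_right[OF t] by simp
  qed
  finally show ?thesis .
qed

end

section \<open>The Heyting algebra of truth values of a topos\<close>

context category
begin

lemma product2_pairing:
  assumes "is_product2 C A B P p q" "f \<in> hom C X A" "g \<in> hom C X B"
  shows "\<exists>h\<in>hom C X P. p \<cdot> h = f \<and> q \<cdot> h = g"
  using assms hom_dom_Ob[OF assms(2)] unfolding is_product2_def by blast

lemma product2_eqI: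
  assumes P: "is_product2 C A B P p q" and h: "h \<in> hom C X P" "k \<in> hom C X P"
    and eq: "p \<cdot> h = p \<cdot> k" "q \<cdot> h = q \<cdot> k"
  shows "h = k"
proof -
  have pk: "p \<cdot> k \<in> hom C X A" "q \<cdot> k \<in> hom C X B"
    using P h cmp_in unfolding is_product2_def by blast+
  have ex1: "\<exists>!l. l \<in> hom C X P \<and> p \<cdot> l = p \<cdot> k \<and> q \<cdot> l = q \<cdot> k"
    using P pk hom_dom_Ob[OF h(1)] unfolding is_product2_def by blast
  show ?thesis by (rule ex1_unique[OF ex1]) (simp_all add: h eq)
qed

lemma product_is_product2:
  assumes P: "is_product C 2 A P p"
  shows "is_product2 C (A 0) (A 1) P (p 0) (p 1)"
proof -
  have "\<exists>!h. h \<in> hom C X P \<and> p 0 \<cdot> h = f \<and> p 1 \<cdot> h = g"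
    if "f \<in> hom C X (A 0)" "g \<in> hom C X (A 1)" for X f g
  proof -
    let ?f = "\<lambda>i::nat. if i = 0 then f else g"
    have lt2: "(\<forall>i<2. Q i) \<longleftrightarrow> Q 0 \<and> Q 1" for Q :: "nat \<Rightarrow> bool"
      by (metis One_nat_def less_2_cases_iff)
    have "\<forall>i<2. ?f i \<in> hom C X (A i)" unfolding lt2 using that by simp
    then have "\<exists>!h. h \<in> hom C X P \<and> (\<forall>i<2. p i \<cdot> h = ?f i)"
      using P[unfolded is_product_def, THEN conjunct2, THEN conjunct2, rule_format,
          OF hom_dom_Ob[OF that(1)], of ?f] by simp
    then show ?thesis unfolding lt2 by simp
  qed
  then show ?thesis using P unfolding is_product_def is_product2_def by simp
qed

end

context elementary_topos
begin

lemma truth_Cod_Ob: "Omega C \<in> Ob C"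
proof -
  have "is_truth C (truth C)" unfolding truth_def using subobject_classifier by (rule someI_ex)
  then show ?thesis using cod_in by (simp add: is_truth_def Omega_def)
qed

sublocale classifying_category C
  by unfold_locales
    ((rule subobject_classifier equalizers finite_products truth_Cod_Ob | assumption)+)

lemma ex_product2:
  assumes "A \<in> Ob C" "B \<in> Ob C" shows "\<exists>P p q. is_product2 C A B P p q"
proof -
  have "\<exists>P p. is_product C 2 (\<lambda>i. if i = 0 then A else B) P p"
    by (rule finite_products) (simp add: assms)
  then show ?thesis using product_is_product2 by fastforce
qed

text \<open>The equalizer of two arrows is a subobject, and its classifier is the predicate that they are equal.\<close>
lemma eq_pred:
  assumes f: "f \<in> hom C X A" and g: "g \<in> hom C X A"
  shows "\<exists>c\<in>preds X. \<forall>Y. \<forall>h\<in>hom C Y X. c \<cdot> h = tt C Y \<longleftrightarrow> f \<cdot> h = g \<cdot> h"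
proof -
  obtain e where e: "is_equalizer C f g e" using equalizers[OF f g] by blast
  have X: "Cod C e = X" using e homD[OF f] by (simp add: is_equalizer_def)
  obtain c where c: "classifies C c e" using ex_classifier equalizer_monic[OF e] by blast
  then have cX: "c \<in> preds X" by (simp add: classifies_def X)
  then show ?thesis using factors_iff[OF c cX] equalizer_factors_iff[OF e f] by blast
qed

text \<open>The conjunction states the equation \<open>(f, g) = (true, true)\<close>.\<close>
lemma and_pred:
  assumes f: "f \<in> preds X" and g: "g \<in> preds X"
  shows "\<exists>c\<in>preds X. \<forall>Y. \<forall>h\<in>hom C Y X. c \<cdot> h = tt C Y \<longleftrightarrow> f \<cdot> h = tt C Y \<and> g \<cdot> h = tt C Y"
proof -
  have t: "tt C X \<in> preds X" using f hom_dom_Ob tt_in by blast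
  obtain c where c: "c \<in> preds X"
    "\<And>Y h. h \<in> hom C Y X \<Longrightarrow> c \<cdot> h = tt C Y \<longleftrightarrow> pair C f g \<cdot> h = pair C (tt C X) (tt C X) \<cdot> h"
    using eq_pred[OF pair_in[OF f g] pair_in[OF t t]] by blast
  have "c \<cdot> h = tt C Y \<longleftrightarrow> f \<cdot> h = tt C Y \<and> g \<cdot> h = tt C Y" if h: "h \<in> hom C Y X" for Y h
  proof -
    have tY: "tt C Y \<in> preds Y" using h hom_dom_Ob tt_in by blast
    have "c \<cdot> h = tt C Y \<longleftrightarrow> pair C (f \<cdot> h) (g \<cdot> h) = pair C (tt C Y) (tt C Y)"
      by (simp add: c(2)[OF h] pair_cmp[OF f g h] pair_cmp[OF t t h] tt_cmp[OF h])
    also have "\<dots> \<longleftrightarrow> f \<cdot> h = tt C Y \<and> g \<cdot> h = tt C Y"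
      using pair_proj0[OF cmp_in[OF h f] cmp_in[OF h g]] pair_proj1[OF cmp_in[OF h f] cmp_in[OF h g]]
        pair_proj0[OF tY tY] pair_proj1[OF tY tY] by metis
    finally show ?thesis .
  qed
  then show ?thesis using c(1) by blast
qed

lemma elem_le_cmp_iff:
  assumes f: "f \<in> preds X" and g: "g \<in> preds X" and h: "h \<in> hom C Y X"
  shows "elem_le C (f \<cdot> h) (g \<cdot> h) \<longleftrightarrow>
    (\<forall>Z k. k \<in> hom C Z Y \<longrightarrow> f \<cdot> (h \<cdot> k) = tt C Z \<longrightarrow> g \<cdot> (h \<cdot> k) = tt C Z)"
  using elem_le_iff[OF cmp_in[OF h f] cmp_in[OF h g]] cmp_assoc'[OF _ h f] cmp_assoc'[OF _ h g] by auto

text \<open>The implication states the equation \<open>f \<and> g = f\<close>.\<close>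
lemma imp_pred:
  assumes f: "f \<in> preds X" and g: "g \<in> preds X"
  shows "\<exists>c\<in>preds X. \<forall>Y. \<forall>h\<in>hom C Y X. c \<cdot> h = tt C Y \<longleftrightarrow> elem_le C (f \<cdot> h) (g \<cdot> h)"
proof -
  obtain m where m: "m \<in> preds X"
    "\<And>Y h. h \<in> hom C Y X \<Longrightarrow> m \<cdot> h = tt C Y \<longleftrightarrow> f \<cdot> h = tt C Y \<and> g \<cdot> h = tt C Y"
    using and_pred[OF f g] by blast
  have "m \<cdot> h = f \<cdot> h \<longleftrightarrow> elem_le C (f \<cdot> h) (g \<cdot> h)" if h: "h \<in> hom C Y X" for Y h
  proof
    assume eq: "m \<cdot> h = f \<cdot> h"
    show "elem_le C (f \<cdot> h) (g \<cdot> h)"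
      unfolding elem_le_cmp_iff[OF f g h]
    proof (intro allI impI)
      fix Z k assume k: "k \<in> hom C Z Y" "f \<cdot> (h \<cdot> k) = tt C Z"
      have "m \<cdot> (h \<cdot> k) = f \<cdot> (h \<cdot> k)"
        using cmp_assoc[OF k(1) h m(1)] cmp_assoc[OF k(1) h f] eq by simp
      then show "g \<cdot> (h \<cdot> k) = tt C Z" using m(2)[OF cmp_in[OF k(1) h]] k(2) by simp
    qed
  next
    assume le: "elem_le C (f \<cdot> h) (g \<cdot> h)"
    show "m \<cdot> h = f \<cdot> h"
    proof (rule pred_eqI[OF cmp_in[OF h m(1)] cmp_in[OF h f]])
      fix Z k assume k: "k \<in> hom C Z Y"
      show "(m \<cdot> h) \<cdot> k = tt C Z \<longleftrightarrow> (f \<cdot> h) \<cdot> k = tt C Z"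
        using le k m(2)[OF cmp_in[OF k h]]
        unfolding elem_le_cmp_iff[OF f g h] cmp_assoc'[OF k h m(1)] cmp_assoc'[OF k h f] by blast
    qed
  qed
  then show ?thesis using eq_pred[OF m(1) f] by simp
qed

text \<open>Let \<open>a, b : X \<rightarrow> \<Omega>\<^sup>A\<close> be the transposes of \<open>F\<close> and of true.  The predicate \<open>a = b\<close> on \<open>X\<close> is the
  universal quantification of \<open>F\<close> along \<open>X \<times> A \<rightarrow> X\<close>: for \<open>h : Y \<rightarrow> X\<close>, uniqueness of transposes turns
  \<open>a h = b h\<close> into the truth of \<open>F\<close> on \<open>Y \<times> A\<close>.  The conclusion speaks of generalized elements \<open>w\<close> of
  \<open>X \<times> A\<close> over \<open>h\<close>, so that later no choice of \<open>Y \<times> A\<close> appears.\<close>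
lemma all_pred:
  assumes P: "is_product2 C X A P p q" and X: "X \<in> Ob C" and A: "A \<in> Ob C" and F: "F \<in> preds P"
  shows "\<exists>c\<in>preds X. \<forall>Y. \<forall>h\<in>hom C Y X. c \<cdot> h = tt C Y \<longleftrightarrow>
    (\<forall>Z. \<forall>w\<in>hom C Z P. (\<exists>u\<in>hom C Z Y. p \<cdot> w = h \<cdot> u) \<longrightarrow> F \<cdot> w = tt C Z)"
proof -
  obtain E P0 p0 q0 ev where E: "is_exponential C A (Omega C) E P0 p0 q0 ev"
    using exponentials[OF A Omega_Ob] by blast
  have P0: "is_product2 C E A P0 p0 q0" and ev: "ev \<in> preds P0"
    and transpose: "\<And>X Q p' q' f. \<lbrakk>is_product2 C X A Q p' q'; X \<in> Ob C; f \<in> preds Q\<rbrakk> \<Longrightarrow>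
      \<exists>!h. h \<in> hom C X E \<and> (\<exists>k\<in>hom C Q P0. p0 \<cdot> k = h \<cdot> p' \<and> q0 \<cdot> k = q' \<and> ev \<cdot> k = f)"
    using E unfolding is_exponential_def by blast+
  have p: "p \<in> hom C P X" and q: "q \<in> hom C P A" and PO: "P \<in> Ob C"
    using P by (auto simp: is_product2_def)
  have p0: "p0 \<in> hom C P0 E" and q0: "q0 \<in> hom C P0 A" using P0 by (auto simp: is_product2_def)
  have tP: "tt C P \<in> preds P" using tt_in[OF PO] .
  obtain a k where a: "a \<in> hom C X E" and k: "k \<in> hom C P P0" "p0 \<cdot> k = a \<cdot> p" "q0 \<cdot> k = q" "ev \<cdot> k = F"
    using transpose[OF P X F] by blast
  obtain b l where b: "b \<in> hom C X E" and l: "l \<in> hom C P P0" "p0 \<cdot> l = b \<cdot> p" "q0 \<cdot> l = q" "ev \<cdot> l = tt C P"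
    using transpose[OF P X tP] by blast
  have "a \<cdot> h = b \<cdot> h \<longleftrightarrow>
      (\<forall>Z. \<forall>w\<in>hom C Z P. (\<exists>u\<in>hom C Z Y. p \<cdot> w = h \<cdot> u) \<longrightarrow> F \<cdot> w = tt C Z)" (is "_ \<longleftrightarrow> ?R")
    if h: "h \<in> hom C Y X" for Y h
  proof -
    have Y: "Y \<in> Ob C" using h by (rule hom_dom_Ob)
    obtain Q p' q' where Q: "is_product2 C Y A Q p' q'" using ex_product2[OF Y A] by blast
    then have p': "p' \<in> hom C Q Y" and q': "q' \<in> hom C Q A" by (auto simp: is_product2_def)
    obtain hA where hA: "hA \<in> hom C Q P" "p \<cdot> hA = h \<cdot> p'" "q \<cdot> hA = q'"
      using product2_pairing[OF P cmp_in[OF p' h] q'] by blast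
    have FhA: "F \<cdot> hA \<in> preds Q" using cmp_in[OF hA(1) F] .
    have tr: "p0 \<cdot> (m \<cdot> hA) = (n \<cdot> h) \<cdot> p'" "q0 \<cdot> (m \<cdot> hA) = q'" "ev \<cdot> (m \<cdot> hA) = G \<cdot> hA"
      if "m \<in> hom C P P0" "n \<in> hom C X E" "p0 \<cdot> m = n \<cdot> p" "q0 \<cdot> m = q" "ev \<cdot> m = G" for m n G
    proof -
      show "p0 \<cdot> (m \<cdot> hA) = (n \<cdot> h) \<cdot> p'"
        using cmp_assoc[OF hA(1) that(1) p0] cmp_assoc'[OF hA(1) p that(2)]
          cmp_assoc[OF p' h that(2)] that(3) hA(2) by simp
      show "q0 \<cdot> (m \<cdot> hA) = q'" using cmp_assoc[OF hA(1) that(1) q0] that(4) hA(3) by simp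
      show "ev \<cdot> (m \<cdot> hA) = G \<cdot> hA" using cmp_assoc[OF hA(1) that(1) ev] that(5) by simp
    qed
    note trk = tr[OF k(1) a k(2-4)] and trl = tr[OF l(1) b l(2-4)]
    have kA: "k \<cdot> hA \<in> hom C Q P0" and lA: "l \<cdot> hA \<in> hom C Q P0" using cmp_in[OF hA(1)] k(1) l(1) by auto
    have ah: "a \<cdot> h \<in> hom C Y E" and bh: "b \<cdot> h \<in> hom C Y E" using cmp_in[OF h] a b by auto
    have "a \<cdot> h = b \<cdot> h \<longleftrightarrow> F \<cdot> hA = tt C Q"
    proof
      assume "a \<cdot> h = b \<cdot> h"
      then have "k \<cdot> hA = l \<cdot> hA" using product2_eqI[OF P0 kA lA] trk trl by simp
      then show "F \<cdot> hA = tt C Q" using trk(3) trl(3) tt_cmp[OF hA(1)] by simp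
    next
      assume eq: "F \<cdot> hA = tt C Q"
      show "a \<cdot> h = b \<cdot> h"
      proof (rule ex1_unique[OF transpose[OF Q Y FhA]])
        show "a \<cdot> h \<in> hom C Y E \<and> (\<exists>k\<in>hom C Q P0. p0 \<cdot> k = (a \<cdot> h) \<cdot> p' \<and> q0 \<cdot> k = q' \<and> ev \<cdot> k = F \<cdot> hA)"
          using ah kA trk by blast
        show "b \<cdot> h \<in> hom C Y E \<and> (\<exists>k\<in>hom C Q P0. p0 \<cdot> k = (b \<cdot> h) \<cdot> p' \<and> q0 \<cdot> k = q' \<and> ev \<cdot> k = F \<cdot> hA)"
          unfolding eq tt_cmp[OF hA(1), symmetric] using bh lA trl by blast
      qed
    qed
    also have "\<dots> \<longleftrightarrow> ?R"
    proof
      assume eq: "F \<cdot> hA = tt C Q"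
      show ?R
      proof (intro allI ballI impI)
        fix Z w assume w: "w \<in> hom C Z P" and "\<exists>u\<in>hom C Z Y. p \<cdot> w = h \<cdot> u"
        then obtain u where u: "u \<in> hom C Z Y" "p \<cdot> w = h \<cdot> u" by blast
        obtain v where v: "v \<in> hom C Z Q" "p' \<cdot> v = u" "q' \<cdot> v = q \<cdot> w"
          using product2_pairing[OF Q u(1) cmp_in[OF w q]] by blast
        have "hA \<cdot> v = w"
          using cmp_assoc[OF v(1) hA(1) p] cmp_assoc[OF v(1) hA(1) q] cmp_assoc'[OF v(1) p' h] hA u v
          by (intro product2_eqI[OF P cmp_in[OF v(1) hA(1)] w]) simp_all
        then show "F \<cdot> w = tt C Z" using cmp_assoc[OF v(1) hA(1) F] eq tt_cmp[OF v(1)] by simp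
      qed
    next
      assume ?R then show "F \<cdot> hA = tt C Q" using hA p' by blast
    qed
    finally show ?thesis .
  qed
  then show ?thesis using eq_pred[OF a b] by simp
qed

lemma topos_stable_meet: "stable_op C is_meet"
  unfolding stable_op_def
proof (intro allI ballI)
  fix X f g assume f: "f \<in> preds X" and g: "g \<in> preds X"
  obtain c where c: "c \<in> preds X"
    "\<And>Y h. h \<in> hom C Y X \<Longrightarrow> c \<cdot> h = tt C Y \<longleftrightarrow> f \<cdot> h = tt C Y \<and> g \<cdot> h = tt C Y"
    using and_pred[OF f g] by blast
  have "is_meet (preds Y) (elem_le C) (f \<cdot> h) (g \<cdot> h) (c \<cdot> h)" if h: "h \<in> hom C Y X" for Y h
  proof -
    have in': "f \<cdot> h \<in> preds Y" "g \<cdot> h \<in> preds Y" "c \<cdot> h \<in> preds Y" using cmp_in[OF h] f g c by auto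
    have "(c \<cdot> h) \<cdot> k = tt C Z \<longleftrightarrow> (f \<cdot> h) \<cdot> k = tt C Z \<and> (g \<cdot> h) \<cdot> k = tt C Z" if k: "k \<in> hom C Z Y" for Z k
      using c(2)[OF cmp_in[OF k h]] cmp_assoc[OF k h] f g c(1) by simp
    then show ?thesis using in' unfolding is_meet_def by (auto simp: elem_le_iff)
  qed
  then show "\<exists>c\<in>preds X. \<forall>Y. \<forall>h\<in>hom C Y X. is_meet (preds Y) (elem_le C) (f \<cdot> h) (g \<cdot> h) (c \<cdot> h)"
    using c(1) by blast
qed

lemma topos_stable_himp: "stable_op C is_himp"
  unfolding stable_op_def
proof (intro allI ballI)
  fix X f g assume f: "f \<in> preds X" and g: "g \<in> preds X"
  obtain c where c: "c \<in> preds X"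
    "\<And>Y h. h \<in> hom C Y X \<Longrightarrow> c \<cdot> h = tt C Y \<longleftrightarrow> elem_le C (f \<cdot> h) (g \<cdot> h)"
    using imp_pred[OF f g] by blast
  have "is_himp (preds Y) (elem_le C) (f \<cdot> h) (g \<cdot> h) (c \<cdot> h)" if h: "h \<in> hom C Y X" for Y h
  proof -
    have in': "f \<cdot> h \<in> preds Y" "g \<cdot> h \<in> preds Y" "c \<cdot> h \<in> preds Y" using cmp_in[OF h] f g c by auto
    have ck: "(c \<cdot> h) \<cdot> k = tt C Z \<longleftrightarrow> elem_le C ((f \<cdot> h) \<cdot> k) ((g \<cdot> h) \<cdot> k)" if k: "k \<in> hom C Z Y" for Z k
      using c(2)[OF cmp_in[OF k h]] cmp_assoc[OF k h] f g c(1) by simp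
    have "elem_le C d (c \<cdot> h) \<longleftrightarrow> (\<exists>e. is_meet (preds Y) (elem_le C) d (f \<cdot> h) e \<and> elem_le C e (g \<cdot> h))"
      if d: "d \<in> preds Y" for d
    proof -
      obtain e where e: "e \<in> preds Y"
        "\<And>Z k. k \<in> hom C Z Y \<Longrightarrow> e \<cdot> k = tt C Z \<longleftrightarrow> d \<cdot> k = tt C Z \<and> (f \<cdot> h) \<cdot> k = tt C Z"
        using and_pred[OF d in'(1)] by blast
      have meet: "is_meet (preds Y) (elem_le C) d (f \<cdot> h) e"
        using d in' e unfolding is_meet_def by (auto simp: elem_le_iff)
      have "elem_le C d (c \<cdot> h) \<longleftrightarrow> elem_le C e (g \<cdot> h)"
      proof
        assume le: "elem_le C d (c \<cdot> h)"
        show "elem_le C e (g \<cdot> h)"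
          unfolding elem_le_iff[OF e(1) in'(2)]
        proof (intro allI impI)
          fix Z k assume k: "k \<in> hom C Z Y" "e \<cdot> k = tt C Z"
          then have "d \<cdot> k = tt C Z" and fk: "(f \<cdot> h) \<cdot> k = tt C Z" using e(2) by auto
          then have "(c \<cdot> h) \<cdot> k = tt C Z" using le k(1) elem_le_iff[OF d in'(3)] by blast
          then have le2: "elem_le C ((f \<cdot> h) \<cdot> k) ((g \<cdot> h) \<cdot> k)" using ck[OF k(1)] by blast
          have fgk: "(f \<cdot> h) \<cdot> k \<in> preds Z" "(g \<cdot> h) \<cdot> k \<in> preds Z" using cmp_in[OF k(1)] in' by auto
          have Z: "Ide C Z \<in> hom C Z Z" using ide_in[OF hom_dom_Ob[OF k(1)]] .
          show "(g \<cdot> h) \<cdot> k = tt C Z"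
            using le2 Z fk ide_right[OF fgk(1)] ide_right[OF fgk(2)] unfolding elem_le_iff[OF fgk] by metis
        qed
      next
        assume le: "elem_le C e (g \<cdot> h)"
        have "elem_le C ((f \<cdot> h) \<cdot> k) ((g \<cdot> h) \<cdot> k)" if k: "k \<in> hom C Z Y" "d \<cdot> k = tt C Z" for Z k
          unfolding elem_le_cmp_iff[OF in'(1,2) k(1)]
        proof (intro allI impI)
          fix T l assume l: "l \<in> hom C T Z" "(f \<cdot> h) \<cdot> (k \<cdot> l) = tt C T"
          have "d \<cdot> (k \<cdot> l) = tt C T" using cmp_assoc[OF l(1) k(1) d] k(2) tt_cmp[OF l(1)] by simp
          then have "e \<cdot> (k \<cdot> l) = tt C T" using e(2)[OF cmp_in[OF l(1) k(1)]] l(2) by blast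
          then show "(g \<cdot> h) \<cdot> (k \<cdot> l) = tt C T"
            using le cmp_in[OF l(1) k(1)] unfolding elem_le_iff[OF e(1) in'(2)] by blast
        qed
        then show "elem_le C d (c \<cdot> h)" using ck unfolding elem_le_iff[OF d in'(3)] by blast
      qed
      then show ?thesis using meet poset_on.is_meet_unique[OF preds_poset] by blast
    qed
    then show ?thesis using in' unfolding is_himp_def by blast
  qed
  then show "\<exists>c\<in>preds X. \<forall>Y. \<forall>h\<in>hom C Y X. is_himp (preds Y) (elem_le C) (f \<cdot> h) (g \<cdot> h) (c \<cdot> h)"
    using c(1) by blast
qed

text \<open>Falsity is \<open>\<forall>p. p\<close>, with \<open>p\<close> ranging over \<open>\<Omega>\<close>.\<close>
lemma topos_stable_bot:
  "\<exists>z\<in>preds (one C). \<forall>X\<in>Ob C. is_bot (preds X) (elem_le C) (z \<cdot> to_one C X)"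
proof -
  obtain P p q where P: "is_product2 C (one C) (Omega C) P p q"
    using ex_product2[OF one_Ob Omega_Ob] by blast
  then have q: "q \<in> preds P" by (simp add: is_product2_def)
  obtain z where z: "z \<in> preds (one C)" "\<And>Y h. h \<in> hom C Y (one C) \<Longrightarrow> z \<cdot> h = tt C Y \<longleftrightarrow>
    (\<forall>Z. \<forall>w\<in>hom C Z P. (\<exists>u\<in>hom C Z Y. p \<cdot> w = h \<cdot> u) \<longrightarrow> q \<cdot> w = tt C Z)"
    using all_pred[OF P one_Ob Omega_Ob q] by blast
  have all: "g = tt C Y" if h: "h \<in> hom C Y (one C)" "z \<cdot> h = tt C Y" and g: "g \<in> preds Y" for Y h g
  proof -
    obtain w where w: "w \<in> hom C Y P" "p \<cdot> w = h" "q \<cdot> w = g"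
      using product2_pairing[OF P h(1) g] by blast
    have "p \<cdot> w = h \<cdot> Ide C Y" using w(2) ide_right[OF h(1)] by simp
    then show ?thesis using z(2)[OF h(1)] h(2) w ide_in[OF hom_dom_Ob[OF g]] by blast
  qed
  have "is_bot (preds X) (elem_le C) (z \<cdot> to_one C X)" if X: "X \<in> Ob C" for X
  proof -
    note X1 = to_one_in[OF X]
    have zX: "z \<cdot> to_one C X \<in> preds X" using cmp_in[OF X1 z(1)] .
    have "elem_le C (z \<cdot> to_one C X) d" if d: "d \<in> preds X" for d
      unfolding elem_le_iff[OF zX d]
    proof (intro allI impI)
      fix Y k assume k: "k \<in> hom C Y X" "(z \<cdot> to_one C X) \<cdot> k = tt C Y"
      then show "d \<cdot> k = tt C Y"
        using all[OF cmp_in[OF k(1) X1]] cmp_assoc[OF k(1) X1 z(1)] cmp_in[OF k(1) d] by simp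
    qed
    then show ?thesis using zX by (simp add: is_bot_def)
  qed
  then show ?thesis using z(1) by blast
qed

lemma elem_le_tt: "\<lbrakk>elem_le C (tt C X) g; g \<in> preds X\<rbrakk> \<Longrightarrow> g = tt C X"
  using is_top_tt[of X] hom_dom_Ob[of g X] poset_on.antisym[OF preds_poset, of g X "tt C X"]
  by (simp add: is_top_def)

text \<open>The disjunction is \<open>\<forall>p. ((f \<Rightarrow> p) \<and> (g \<Rightarrow> p)) \<Rightarrow> p\<close>, with \<open>p\<close> ranging over \<open>\<Omega>\<close>.\<close>
lemma or_pred:
  assumes f: "f \<in> preds X" and g: "g \<in> preds X"
  shows "\<exists>c\<in>preds X. \<forall>Y. \<forall>h\<in>hom C Y X. c \<cdot> h = tt C Y \<longleftrightarrow>
    (\<forall>Z. \<forall>u\<in>hom C Z Y. \<forall>a\<in>preds Z.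
       elem_le C (f \<cdot> (h \<cdot> u)) a \<longrightarrow> elem_le C (g \<cdot> (h \<cdot> u)) a \<longrightarrow> a = tt C Z)"
proof -
  have X: "X \<in> Ob C" using f by (rule hom_dom_Ob)
  obtain P p q where P: "is_product2 C X (Omega C) P p q" using ex_product2[OF X Omega_Ob] by blast
  then have p: "p \<in> hom C P X" and q: "q \<in> preds P" by (simp_all add: is_product2_def)
  note fp = cmp_in[OF p f] and gp = cmp_in[OF p g]
  obtain a where a: "a \<in> preds P" "\<And>Y h. h \<in> hom C Y P \<Longrightarrow> a \<cdot> h = tt C Y \<longleftrightarrow> elem_le C ((f \<cdot> p) \<cdot> h) (q \<cdot> h)"
    using imp_pred[OF fp q] by blast
  obtain b where b: "b \<in> preds P" "\<And>Y h. h \<in> hom C Y P \<Longrightarrow> b \<cdot> h = tt C Y \<longleftrightarrow> elem_le C ((g \<cdot> p) \<cdot> h) (q \<cdot> h)"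
    using imp_pred[OF gp q] by blast
  obtain m where m: "m \<in> preds P" "\<And>Y h. h \<in> hom C Y P \<Longrightarrow> m \<cdot> h = tt C Y \<longleftrightarrow> a \<cdot> h = tt C Y \<and> b \<cdot> h = tt C Y"
    using and_pred[OF a(1) b(1)] by blast
  obtain F where F: "F \<in> preds P" "\<And>Y h. h \<in> hom C Y P \<Longrightarrow> F \<cdot> h = tt C Y \<longleftrightarrow> elem_le C (m \<cdot> h) (q \<cdot> h)"
    using imp_pred[OF m(1) q] by blast
  have m': "m \<cdot> w = tt C Z \<longleftrightarrow> elem_le C (f \<cdot> (p \<cdot> w)) (q \<cdot> w) \<and> elem_le C (g \<cdot> (p \<cdot> w)) (q \<cdot> w)"
    if w: "w \<in> hom C Z P" for Z w
    using m(2)[OF w] a(2)[OF w] b(2)[OF w] cmp_assoc[OF w p f] cmp_assoc[OF w p g] by simp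
  obtain c where c: "c \<in> preds X" "\<And>Y h. h \<in> hom C Y X \<Longrightarrow> c \<cdot> h = tt C Y \<longleftrightarrow>
    (\<forall>Z. \<forall>w\<in>hom C Z P. (\<exists>u\<in>hom C Z Y. p \<cdot> w = h \<cdot> u) \<longrightarrow> F \<cdot> w = tt C Z)"
    using all_pred[OF P X Omega_Ob F(1)] by blast
  have "c \<cdot> h = tt C Y \<longleftrightarrow> (\<forall>Z. \<forall>u\<in>hom C Z Y. \<forall>a\<in>preds Z.
       elem_le C (f \<cdot> (h \<cdot> u)) a \<longrightarrow> elem_le C (g \<cdot> (h \<cdot> u)) a \<longrightarrow> a = tt C Z)" (is "_ \<longleftrightarrow> ?R")
    if h: "h \<in> hom C Y X" for Y h
  proof
    assume ch: "c \<cdot> h = tt C Y"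
    show ?R
    proof (intro allI ballI impI)
      fix Z u d assume u: "u \<in> hom C Z Y" and d: "d \<in> preds Z"
        and le: "elem_le C (f \<cdot> (h \<cdot> u)) d" "elem_le C (g \<cdot> (h \<cdot> u)) d"
      obtain w where w: "w \<in> hom C Z P" "p \<cdot> w = h \<cdot> u" "q \<cdot> w = d"
        using product2_pairing[OF P cmp_in[OF u h] d] by blast
      have "F \<cdot> w = tt C Z" using ch c(2)[OF h] w u by blast
      then have "elem_le C (m \<cdot> w) d" using F(2)[OF w(1)] w(3) by simp
      moreover have "m \<cdot> w = tt C Z" using m'[OF w(1)] le w by simp
      ultimately show "d = tt C Z" using elem_le_tt d by simp
    qed
  next
    assume R: ?R
    have "F \<cdot> w = tt C Z" if w: "w \<in> hom C Z P" and u: "u \<in> hom C Z Y" "p \<cdot> w = h \<cdot> u" for Z w u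
      unfolding F(2)[OF w] elem_le_cmp_iff[OF m(1) q w]
    proof (intro allI impI)
      fix T k assume k: "k \<in> hom C T Z" "m \<cdot> (w \<cdot> k) = tt C T"
      have "p \<cdot> (w \<cdot> k) = h \<cdot> (u \<cdot> k)"
        using cmp_assoc[OF k(1) w p] cmp_assoc[OF k(1) u(1) h] u(2) by simp
      then show "q \<cdot> (w \<cdot> k) = tt C T"
        using R[rule_format, OF cmp_in[OF k(1) u(1)] cmp_in[OF cmp_in[OF k(1) w] q]]
          m'[OF cmp_in[OF k(1) w]] k(2) by simp
    qed
    then show "c \<cdot> h = tt C Y" unfolding c(2)[OF h] by blast
  qed
  then show ?thesis using c(1) by blast
qed

lemma topos_stable_join: "stable_op C is_join"
  unfolding stable_op_def
proof (intro allI ballI)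
  fix X f g assume f: "f \<in> preds X" and g: "g \<in> preds X"
  obtain c where c: "c \<in> preds X" "\<And>Y h. h \<in> hom C Y X \<Longrightarrow> c \<cdot> h = tt C Y \<longleftrightarrow>
    (\<forall>Z. \<forall>u\<in>hom C Z Y. \<forall>a\<in>preds Z.
       elem_le C (f \<cdot> (h \<cdot> u)) a \<longrightarrow> elem_le C (g \<cdot> (h \<cdot> u)) a \<longrightarrow> a = tt C Z)"
    using or_pred[OF f g] by blast
  have "is_join (preds Y) (elem_le C) (f \<cdot> h) (g \<cdot> h) (c \<cdot> h)" if h: "h \<in> hom C Y X" for Y h
  proof -
    have in': "f \<cdot> h \<in> preds Y" "g \<cdot> h \<in> preds Y" "c \<cdot> h \<in> preds Y" using cmp_in[OF h] f g c by auto
    have upper: "elem_le C (f' \<cdot> h) (c \<cdot> h)" if f': "f' = f \<or> f' = g" for f'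
    proof -
      have f'X: "f' \<in> preds X" using f' f g by blast
      show ?thesis
        unfolding elem_le_cmp_iff[OF f'X c(1) h]
      proof (intro allI impI)
        fix T k assume k: "k \<in> hom C T Y" "f' \<cdot> (h \<cdot> k) = tt C T"
        have hk: "h \<cdot> k \<in> hom C T X" using cmp_in[OF k(1) h] .
        have "a = tt C Z" if u: "u \<in> hom C Z T" and a: "a \<in> preds Z"
          and "elem_le C (f \<cdot> ((h \<cdot> k) \<cdot> u)) a" "elem_le C (g \<cdot> ((h \<cdot> k) \<cdot> u)) a" for Z u a
        proof -
          have "f' \<cdot> ((h \<cdot> k) \<cdot> u) = tt C Z" using cmp_assoc[OF u hk f'X] k(2) tt_cmp[OF u] by simp
          then have "elem_le C (tt C Z) a" using that f' by auto
          then show ?thesis using elem_le_tt a by blast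
        qed
        then show "c \<cdot> (h \<cdot> k) = tt C T" unfolding c(2)[OF hk] by blast
      qed
    qed
    have least: "elem_le C (c \<cdot> h) d" if d: "d \<in> preds Y" "elem_le C (f \<cdot> h) d" "elem_le C (g \<cdot> h) d" for d
      unfolding elem_le_iff[OF in'(3) d(1)]
    proof (intro allI impI)
      fix T k assume k: "k \<in> hom C T Y" "(c \<cdot> h) \<cdot> k = tt C T"
      have hk: "h \<cdot> k \<in> hom C T X" using cmp_in[OF k(1) h] .
      have id: "Ide C T \<in> hom C T T" using ide_in[OF hom_dom_Ob[OF k(1)]] .
      have "c \<cdot> (h \<cdot> k) = tt C T" using k(2) cmp_assoc[OF k(1) h c(1)] by simp
      moreover have "elem_le C (f \<cdot> ((h \<cdot> k) \<cdot> Ide C T)) (d \<cdot> k)" "elem_le C (g \<cdot> ((h \<cdot> k) \<cdot> Ide C T)) (d \<cdot> k)"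
        using elem_le_cmp[OF in'(1) d(1) k(1) d(2)] elem_le_cmp[OF in'(2) d(1) k(1) d(3)]
          cmp_assoc[OF k(1) h f] cmp_assoc[OF k(1) h g] ide_right[OF hk] by simp_all
      ultimately show "d \<cdot> k = tt C T" using c(2)[OF hk] id cmp_in[OF k(1) d(1)] by blast
    qed
    interpret P: poset_on "preds Y" "elem_le C" by (rule preds_poset)
    have le: "elem_le C (f \<cdot> h) (c \<cdot> h)" "elem_le C (g \<cdot> h) (c \<cdot> h)" by (rule upper; simp)+
    have "elem_le C (c \<cdot> h) d \<longleftrightarrow> elem_le C (f \<cdot> h) d \<and> elem_le C (g \<cdot> h) d" if d: "d \<in> preds Y" for d
      using least[OF d] P.trans[OF in'(1) in'(3) d le(1)] P.trans[OF in'(2) in'(3) d le(2)] by blast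
    then show ?thesis unfolding is_join_def using in' by blast
  qed
  then show "\<exists>c\<in>preds X. \<forall>Y. \<forall>h\<in>hom C Y X. is_join (preds Y) (elem_le C) (f \<cdot> h) (g \<cdot> h) (c \<cdot> h)"
    using c(1) by blast
qed

sublocale heyting_category C
  by unfold_locales (rule topos_stable_bot topos_stable_meet topos_stable_join topos_stable_himp)+

end

section \<open>Local operators\<close>

text \<open>Composition with a local operator is a nucleus on the predicates on every object; the predicates it fixes
  classify the closed subobjects.\<close>
locale topos_operator = elementary_topos C for C :: "('o, 'a, 'm) cat_scheme" (structure) +
  fixes j :: 'a
  assumes local_operator: "local_operator C j"
begin

abbreviation closed_preds :: "'o \<Rightarrow> 'a set" where
  "closed_preds X \<equiv> fixed_points (preds X) (\<lambda>f. j \<cdot> f)"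

abbreviation closed_bot_at where "closed_bot_at X \<equiv> hbot (closed_preds X) (elem_le C)"
abbreviation closed_meet_at where "closed_meet_at X \<equiv> hmeet (closed_preds X) (elem_le C)"
abbreviation closed_join_at where "closed_join_at X \<equiv> hjoin (closed_preds X) (elem_le C)"
abbreviation closed_imp_at where "closed_imp_at X \<equiv> himp (closed_preds X) (elem_le C)"
abbreviation closed_eval_at where "closed_eval_at X \<equiv> heval (closed_preds X) (elem_le C)"

lemma j_in: "j \<in> preds (Omega C)"
  using local_operator by (simp add: local_operator_def)

lemma j_cmp_in: "f \<in> preds X \<Longrightarrow> j \<cdot> f \<in> preds X"
  using cmp_in j_in by blast

lemma j_assoc: "\<lbrakk>f \<in> preds X; h \<in> hom C Y X\<rbrakk> \<Longrightarrow> (j \<cdot> f) \<cdot> h = j \<cdot> (f \<cdot> h)"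
  using cmp_assoc'[OF _ _ j_in] by blast

lemma j_tt: assumes "X \<in> Ob C" shows "j \<cdot> tt C X = tt C X"
  using cmp_assoc[OF to_one_in[OF assms] truth_in j_in] local_operator
  by (simp add: tt_def local_operator_def)

lemma j_hmeet:
  assumes f: "f \<in> preds X" and g: "g \<in> preds X"
  shows "j \<cdot> meet_at X f g = meet_at X (j \<cdot> f) (j \<cdot> g)"
proof -
  have p: "proj C 2 0 \<in> preds (Omega_pow C 2)" "proj C 2 1 \<in> preds (Omega_pow C 2)" by (simp_all add: proj_in)
  note jp = j_cmp_in[OF p(1)] j_cmp_in[OF p(2)]
  note fg = pair_in[OF f g]
  have "j \<cdot> (and_op C \<cdot> pair C f g) = (and_op C \<cdot> pair C (j \<cdot> proj C 2 0) (j \<cdot> proj C 2 1)) \<cdot> pair C f g"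
    using cmp_assoc[OF fg op_in(1) j_in] local_operator by (simp add: local_operator_def)
  also have "\<dots> = and_op C \<cdot> pair C (j \<cdot> f) (j \<cdot> g)"
    using binary_cmp[OF op_in(1) jp fg] j_assoc[OF p(1) fg] j_assoc[OF p(2) fg]
    by (simp add: pair_proj0[OF f g] pair_proj1[OF f g] del: One_nat_def)
  finally show ?thesis by (simp only: hmeet_preds f g j_cmp_in)
qed

lemma nucleus_preds:
  assumes X: "X \<in> Ob C" shows "nucleus (preds X) (elem_le C) (\<lambda>f. j \<cdot> f)"
proof (intro nucleus.intro nucleus_axioms.intro heyting_preds[OF X])
  fix f assume f: "f \<in> preds X"
  show "j \<cdot> f \<in> preds X" using j_cmp_in[OF f] .
  show "elem_le C f (j \<cdot> f)"
    unfolding elem_le_iff[OF f j_cmp_in[OF f]] using j_assoc[OF f] j_tt hom_dom_Ob by simp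
  show "j \<cdot> (j \<cdot> f) = j \<cdot> f"
    using cmp_assoc[OF f j_in j_in] local_operator by (simp add: local_operator_def)
qed (rule j_hmeet)

lemma closed_preds_iff: "f \<in> closed_preds X \<longleftrightarrow> f \<in> preds X \<and> j \<cdot> f = f"
  by (simp add: fixed_points_def)

lemma closed_cmp: "\<lbrakk>f \<in> closed_preds X; h \<in> hom C Y X\<rbrakk> \<Longrightarrow> f \<cdot> h \<in> closed_preds Y"
  using cmp_in[of h Y X] j_assoc[of f X h Y] by (simp add: closed_preds_iff)

lemma j_closed_preds: "f \<in> preds X \<Longrightarrow> j \<cdot> f \<in> closed_preds X"
  using nucleus.j_closed[OF nucleus_preds[OF hom_dom_Ob]] .

lemma tt_closed: "X \<in> Ob C \<Longrightarrow> tt C X \<in> closed_preds X"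
  by (simp add: closed_preds_iff tt_in j_tt)

lemma heyting_closed_preds: "X \<in> Ob C \<Longrightarrow> heyting_poset (closed_preds X) (elem_le C)"
  using nucleus.heyting_closed[OF nucleus_preds] .

context
  fixes X Y h assumes h: "h \<in> hom C Y X"
begin

interpretation NX: nucleus "preds X" "elem_le C" "\<lambda>f. j \<cdot> f" by (rule nucleus_preds[OF hom_cod_Ob[OF h]])
interpretation NY: nucleus "preds Y" "elem_le C" "\<lambda>f. j \<cdot> f" by (rule nucleus_preds[OF hom_dom_Ob[OF h]])

lemma hbot_closed_cmp: "closed_bot_at X \<cdot> h = closed_bot_at Y"
  using j_assoc[OF NX.bot_in h] hbot_cmp[OF h] by (simp add: NX.hbot_closed NY.hbot_closed)

lemma hmeet_closed_cmp: "\<lbrakk>f \<in> closed_preds X; g \<in> closed_preds X\<rbrakk> \<Longrightarrow>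
    closed_meet_at X f g \<cdot> h = closed_meet_at Y (f \<cdot> h) (g \<cdot> h)"
  using hmeet_cmp[OF _ _ h] NX.closed_in closed_cmp[OF _ h] by (simp add: NX.hmeet_closed NY.hmeet_closed)

lemma himp_closed_cmp: "\<lbrakk>f \<in> closed_preds X; g \<in> closed_preds X\<rbrakk> \<Longrightarrow>
    closed_imp_at X f g \<cdot> h = closed_imp_at Y (f \<cdot> h) (g \<cdot> h)"
  using himp_cmp[OF _ _ h] NX.closed_in closed_cmp[OF _ h] by (simp add: NX.himp_closed NY.himp_closed)

lemma hjoin_closed_cmp: "\<lbrakk>f \<in> closed_preds X; g \<in> closed_preds X\<rbrakk> \<Longrightarrow>
    closed_join_at X f g \<cdot> h = closed_join_at Y (f \<cdot> h) (g \<cdot> h)"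
  using hjoin_cmp[OF _ _ h] NX.closed_in closed_cmp[OF _ h] j_assoc[OF NX.join_in h]
  by (simp add: NX.hjoin_closed NY.hjoin_closed)

lemma heval_closed_cmp:
  "(\<And>i. i \<in> vars t \<Longrightarrow> v i \<in> closed_preds X) \<Longrightarrow>
    closed_eval_at X v t \<cdot> h = closed_eval_at Y (\<lambda>i. v i \<cdot> h) t"
proof (induction t)
  case One
  then show ?case using tt_cmp[OF h]
    by (simp add: NX.htop_closed NY.htop_closed htop_preds hom_dom_Ob[OF h] hom_cod_Ob[OF h])
next
  case (Neg t)
  have "closed_eval_at X v t \<in> closed_preds X" using Neg.prems by (simp add: NX.heval_closed_in)
  moreover have "closed_bot_at X \<in> closed_preds X"
    by (simp add: NX.hbot_closed NX.j_closed)
  ultimately show ?case using Neg by (simp add: himp_closed_cmp hbot_closed_cmp)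
next
  case (Or s t)
  then show ?case by (simp add: hjoin_closed_cmp NX.heval_closed_in)
next
  case (And s t)
  then show ?case by (simp add: hmeet_closed_cmp NX.heval_closed_in)
next
  case (Imp s t)
  then show ?case by (simp add: himp_closed_cmp NX.heval_closed_in)
qed (auto simp: hbot_closed_cmp)

end

section \<open>Sheaves\<close>

lemma dense_iff: "dense C j m \<longleftrightarrow> (\<exists>f. classifies C f m \<and> j \<cdot> f = tt C (Cod C m))"
proof
  assume "dense C j m"
  then obtain f c where f: "classifies C f m" and c: "classifies C (j \<cdot> f) c" "iso C c"
    unfolding dense_def is_closure_def by blast
  have "f \<in> preds (Cod C m)" using f by (simp add: classifies_def)
  then have "j \<cdot> f = tt C (Cod C m)" using iso_classified_iff[OF c(1) j_cmp_in] c(2) by blast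
  then show "\<exists>f. classifies C f m \<and> j \<cdot> f = tt C (Cod C m)" using f by blast
next
  assume "\<exists>f. classifies C f m \<and> j \<cdot> f = tt C (Cod C m)"
  then obtain f where f: "classifies C f m" and eq: "j \<cdot> f = tt C (Cod C m)" by blast
  have "f \<in> preds (Cod C m)" using f by (simp add: classifies_def)
  then have jf: "j \<cdot> f \<in> preds (Cod C m)" by (rule j_cmp_in)
  then obtain c where "classifies C (j \<cdot> f) c" using ex_classified by blast
  then show "dense C j m" using f iso_classified_iff[OF _ jf] eq unfolding dense_def is_closure_def by blast
qed

lemma dense_monic: "dense C j m \<Longrightarrow> monic C m"
  by (auto simp: dense_iff classifies_def)

lemma dense_hom: "dense C j m \<Longrightarrow> m \<in> hom C (Dom C m) (Cod C m)"
  using dense_monic monic_hom by blast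

lemma sheaf_Ob: "sheaf C j F \<Longrightarrow> F \<in> Ob C" by (simp add: sheaf_def)

lemma sheaf_extend:
  "\<lbrakk>sheaf C j F; dense C j m; f \<in> hom C (Dom C m) F\<rbrakk> \<Longrightarrow> \<exists>g\<in>hom C (Cod C m) F. g \<cdot> m = f"
  unfolding sheaf_def by blast

lemma sheaf_eqI:
  assumes F: "sheaf C j F" and m: "dense C j m"
    and g: "g \<in> hom C (Cod C m) F" "h \<in> hom C (Cod C m) F" and eq: "g \<cdot> m = h \<cdot> m"
  shows "g = h"
proof -
  have "h \<cdot> m \<in> hom C (Dom C m) F" using cmp_in[OF dense_hom[OF m] g(2)] .
  then have ex1: "\<exists>!k. k \<in> hom C (Cod C m) F \<and> k \<cdot> m = h \<cdot> m" using F m unfolding sheaf_def by blast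
  show ?thesis by (rule ex1_unique[OF ex1]) (simp_all add: g eq)
qed

lemma sheafI:
  assumes "F \<in> Ob C"
    and "\<And>m f. \<lbrakk>dense C j m; f \<in> hom C (Dom C m) F\<rbrakk> \<Longrightarrow> \<exists>g\<in>hom C (Cod C m) F. g \<cdot> m = f"
    and "\<And>m g h. \<lbrakk>dense C j m; g \<in> hom C (Cod C m) F; h \<in> hom C (Cod C m) F; g \<cdot> m = h \<cdot> m\<rbrakk> \<Longrightarrow> g = h"
  shows "sheaf C j F"
  unfolding sheaf_def
proof (intro conjI allI impI ballI)
  fix m f assume m: "dense C j m" and f: "f \<in> hom C (Dom C m) F"
  obtain g where g: "g \<in> hom C (Cod C m) F" "g \<cdot> m = f" using assms(2)[OF m f] by blast
  show "\<exists>!g. g \<in> hom C (Cod C m) F \<and> g \<cdot> m = f"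
    by (rule ex1I[of _ g]) (use g assms(3)[OF m] in auto)
qed (rule assms(1))

lemma product_sheaf:
  assumes P: "is_product C n A P p" and A: "\<And>i. i < n \<Longrightarrow> sheaf C j (A i)"
  shows "sheaf C j P"
proof (rule sheafI)
  show "P \<in> Ob C" using P by (simp add: is_product_def)
  have p: "p i \<in> hom C P (A i)" if "i < n" for i using P that by (simp add: is_product_def)
  { fix m f assume m: "dense C j m" and f: "f \<in> hom C (Dom C m) P"
    note mh = dense_hom[OF m]
    have "\<forall>i. \<exists>g. i < n \<longrightarrow> g \<in> hom C (Cod C m) (A i) \<and> g \<cdot> m = p i \<cdot> f"
      using sheaf_extend[OF A m cmp_in[OF f p]] by blast
    then obtain g where g: "\<And>i. i < n \<Longrightarrow> g i \<in> hom C (Cod C m) (A i)" "\<And>i. i < n \<Longrightarrow> g i \<cdot> m = p i \<cdot> f"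
      by metis
    have "\<exists>!h. h \<in> hom C (Cod C m) P \<and> (\<forall>i<n. p i \<cdot> h = g i)"
      using P[unfolded is_product_def, THEN conjunct2, THEN conjunct2, rule_format,
          OF hom_cod_Ob[OF mh], of g] g(1) by simp
    then obtain h where h: "h \<in> hom C (Cod C m) P" "\<forall>i<n. p i \<cdot> h = g i" by (elim ex1E conjE)
    have "h \<cdot> m = f"
      using g(2) h(2) cmp_assoc[OF mh h(1) p] by (intro product_eqI[OF P cmp_in[OF mh h(1)] f]) simp
    then show "\<exists>g\<in>hom C (Cod C m) P. g \<cdot> m = f" using h(1) by blast }
  { fix m g h assume m: "dense C j m" and g: "g \<in> hom C (Cod C m) P" and h: "h \<in> hom C (Cod C m) P"
      and eq: "g \<cdot> m = h \<cdot> m"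
    note mh = dense_hom[OF m]
    show "g = h"
    proof (rule product_eqI[OF P g h])
      fix i assume i: "i < n"
      show "p i \<cdot> g = p i \<cdot> h"
        using cmp_assoc[OF mh g p[OF i]] cmp_assoc[OF mh h p[OF i]] eq
        by (intro sheaf_eqI[OF A[OF i] m cmp_in[OF g p[OF i]] cmp_in[OF h p[OF i]]]) simp
    qed }
qed

lemma equalizer_sheaf:
  assumes e: "is_equalizer C f g e" and f: "f \<in> hom C F G" and F: "sheaf C j F" and G: "sheaf C j G"
  shows "sheaf C j (Dom C e)"
proof (rule sheafI)
  have eh: "e \<in> hom C (Dom C e) F" and g: "g \<in> hom C F G" and fe: "f \<cdot> e = g \<cdot> e"
    using e homD[OF f] by (auto simp: is_equalizer_def hom_def)
  have em: "monic C e" using equalizer_monic[OF e] .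
  show "Dom C e \<in> Ob C" using hom_dom_Ob[OF eh] .
  { fix m k assume m: "dense C j m" and k: "k \<in> hom C (Dom C m) (Dom C e)"
    note mh = dense_hom[OF m]
    obtain x where x: "x \<in> hom C (Cod C m) F" "x \<cdot> m = e \<cdot> k"
      using sheaf_extend[OF F m cmp_in[OF k eh]] by blast
    have "f \<cdot> x = g \<cdot> x"
    proof (rule sheaf_eqI[OF G m cmp_in[OF x(1) f] cmp_in[OF x(1) g]])
      show "(f \<cdot> x) \<cdot> m = (g \<cdot> x) \<cdot> m"
        using cmp_assoc'[OF mh x(1) f] cmp_assoc'[OF mh x(1) g] x(2)
          cmp_assoc[OF k eh f] cmp_assoc[OF k eh g] fe by simp
    qed
    then obtain y where y: "y \<in> hom C (Cod C m) (Dom C e)" "e \<cdot> y = x"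
      using equalizer_factors_iff[OF e f x(1)] by blast
    have "y \<cdot> m = k"
      using cmp_assoc[OF mh y(1) eh] x(2) y(2) by (intro monic_cancel[OF em cmp_in[OF mh y(1)] k]) simp
    then show "\<exists>g\<in>hom C (Cod C m) (Dom C e). g \<cdot> m = k" using y(1) by blast }
  { fix m x y assume m: "dense C j m" and x: "x \<in> hom C (Cod C m) (Dom C e)" and y: "y \<in> hom C (Cod C m) (Dom C e)"
      and eq: "x \<cdot> m = y \<cdot> m"
    note mh = dense_hom[OF m]
    have "e \<cdot> x = e \<cdot> y"
      using cmp_assoc[OF mh x eh] cmp_assoc[OF mh y eh] eq
      by (intro sheaf_eqI[OF F m cmp_in[OF x eh] cmp_in[OF y eh]]) simp
    then show "x = y" using monic_cancel[OF em x y] by blast }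
qed

lemma one_sheaf: "sheaf C j (one C)"
proof (rule sheafI)
  fix m f assume m: "dense C j m" and f: "f \<in> hom C (Dom C m) (one C)"
  note mh = dense_hom[OF m]
  note u = to_one_in[OF hom_cod_Ob[OF mh]]
  have "to_one C (Cod C m) \<cdot> m = f" using to_one_unique[OF cmp_in[OF mh u]] to_one_unique[OF f] by simp
  then show "\<exists>g\<in>hom C (Cod C m) (one C). g \<cdot> m = f" using u by blast
next
  fix m g h assume "g \<in> hom C (Cod C m) (one C)" "h \<in> hom C (Cod C m) (one C)"
  then show "g = h" using to_one_unique by metis
qed (rule one_Ob)

text \<open>If closed predicates agree along a dense \<open>m\<close>, classified by \<open>d\<close>, then \<open>a \<and> d \<le> b\<close>, and applying \<open>j\<close>,
  which sends \<open>d\<close> to true, gives \<open>a \<le> b\<close>.\<close>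
lemma closed_eqI:
  assumes m: "dense C j m" and f: "f \<in> closed_preds (Cod C m)" and g: "g \<in> closed_preds (Cod C m)"
    and eq: "f \<cdot> m = g \<cdot> m"
  shows "f = g"
proof -
  let ?X = "Cod C m"
  have X: "?X \<in> Ob C" using dense_hom[OF m] hom_cod_Ob by blast
  interpret N: nucleus "preds ?X" "elem_le C" "\<lambda>f. j \<cdot> f" by (rule nucleus_preds[OF X])
  obtain d where d: "classifies C d m" "j \<cdot> d = tt C ?X" using m dense_iff by blast
  then have dX: "d \<in> preds ?X" by (simp add: classifies_def)
  have "elem_le C a b" if a: "a \<in> closed_preds ?X" and b: "b \<in> closed_preds ?X" and ab: "a \<cdot> m = b \<cdot> m" for a b
  proof -
    note aX = N.closed_in[OF a] and bX = N.closed_in[OF b]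
    note adX = N.meet_in[OF aX dX]
    have "elem_le C (meet_at ?X a d) b"
      unfolding elem_le_iff[OF adX bX]
    proof (intro allI impI)
      fix Y h assume h: "h \<in> hom C Y ?X" "meet_at ?X a d \<cdot> h = tt C Y"
      have ah: "a \<cdot> h = tt C Y" and dh: "d \<cdot> h = tt C Y"
        using h N.meet_le1[OF aX dX] N.meet_le2[OF aX dX] elem_le_iff[OF adX aX] elem_le_iff[OF adX dX] by blast+
      obtain k where k: "k \<in> hom C Y (Dom C m)" "m \<cdot> k = h" using factors_iff[OF d(1) dX h(1)] dh by blast
      show "b \<cdot> h = tt C Y"
        using cmp_assoc[OF k(1) dense_hom[OF m] aX] cmp_assoc[OF k(1) dense_hom[OF m] bX] ab ah k(2) by simp
    qed
    then have "elem_le C (j \<cdot> meet_at ?X a d) b" using N.j_le_iff[OF adX b] by blast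
    then have "elem_le C (meet_at ?X a (tt C ?X)) b"
      using N.j_meet[OF aX dX] N.closed_fix[OF a] d(2) by simp
    then show ?thesis using N.meet_top(2)[OF aX] htop_preds[OF X] by simp
  qed
  then show ?thesis using f g eq N.closed_in by (intro N.antisym) auto
qed

text \<open>The extension is the closure, in the larger object, of the subobject classified by \<open>f\<close>.\<close>
lemma closed_extend:
  assumes m: "dense C j m" and f: "f \<in> closed_preds (Dom C m)"
  shows "\<exists>g\<in>closed_preds (Cod C m). g \<cdot> m = f"
proof -
  note mh = dense_hom[OF m]
  have fA: "f \<in> preds (Dom C m)" "j \<cdot> f = f" using f by (simp_all add: closed_preds_iff)
  obtain k where k: "classifies C f k" "k \<in> hom C (Dom C k) (Dom C m)" using ex_classified[OF fA(1)] by blast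
  have mk: "m \<cdot> k \<in> hom C (Dom C k) (Cod C m)" using cmp_in[OF k(2) mh] .
  have Dmk: "Dom C (m \<cdot> k) = Dom C k" "Cod C (m \<cdot> k) = Cod C m" using homD[OF mk] by simp_all
  have km: "monic C k" using k(1) by (simp add: classifies_def)
  have mm: "monic C m" using dense_monic[OF m] .
  have "x = y" if "x \<in> hom C Y (Dom C k)" "y \<in> hom C Y (Dom C k)" "(m \<cdot> k) \<cdot> x = (m \<cdot> k) \<cdot> y" for Y x y
    using that monic_cancel[OF mm cmp_in[OF that(1) k(2)] cmp_in[OF that(2) k(2)]]
      cmp_assoc'[OF that(1) k(2) mh] cmp_assoc'[OF that(2) k(2) mh] monic_cancel[OF km] by simp
  then have "monic C (m \<cdot> k)" using mk unfolding monic_def Dmk by (simp add: hom_def)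
  then obtain s where s: "classifies C s (m \<cdot> k)" using ex_classifier by blast
  then have sX: "s \<in> preds (Cod C m)" using Dmk by (simp add: classifies_def)
  have "s \<cdot> m = f"
  proof (rule pred_eqI[OF cmp_in[OF mh sX] fA(1)])
    fix Y h assume h: "h \<in> hom C Y (Dom C m)"
    have "(s \<cdot> m) \<cdot> h = tt C Y \<longleftrightarrow> (\<exists>l\<in>hom C Y (Dom C k). (m \<cdot> k) \<cdot> l = m \<cdot> h)"
      using factors_iff[OF s sX cmp_in[OF h mh]] cmp_assoc'[OF h mh sX] Dmk by simp
    also have "\<dots> \<longleftrightarrow> (\<exists>l\<in>hom C Y (Dom C k). k \<cdot> l = h)"
      using cmp_assoc'[OF _ k(2) mh] monic_cancel[OF mm cmp_in[OF _ k(2)] h] by (metis (no_types, lifting))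
    finally show "(s \<cdot> m) \<cdot> h = tt C Y \<longleftrightarrow> f \<cdot> h = tt C Y" using factors_iff[OF k(1) fA(1) h] by simp
  qed
  then have "(j \<cdot> s) \<cdot> m = f" using j_assoc[OF sX mh] fA(2) by simp
  then show ?thesis using j_closed_preds[OF sX] by blast
qed

text \<open>An arrow defined on a dense subobject extends to \<open>F\<close>; the extension stays in the subobject because the
  predicate \<open>f\<close> is true of it on a dense part, hence everywhere by closedness.\<close>
lemma closed_sub_sheaf:
  assumes F: "sheaf C j F" and f: "f \<in> closed_preds F" and k: "classifies C f k"
  shows "sheaf C j (Dom C k)"
proof (rule sheafI)
  have fF: "f \<in> preds F" using f by (simp add: closed_preds_iff)
  have kh: "k \<in> hom C (Dom C k) F" using classified_hom[OF k fF] .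
  have km: "monic C k" using k by (simp add: classifies_def)
  show "Dom C k \<in> Ob C" using hom_dom_Ob[OF kh] .
  { fix m g assume m: "dense C j m" and g: "g \<in> hom C (Dom C m) (Dom C k)"
    note mh = dense_hom[OF m]
    obtain x where x: "x \<in> hom C (Cod C m) F" "x \<cdot> m = k \<cdot> g"
      using sheaf_extend[OF F m cmp_in[OF g kh]] by blast
    have "f \<cdot> x = tt C (Cod C m)"
    proof (rule closed_eqI[OF m closed_cmp[OF f x(1)] tt_closed[OF hom_dom_Ob[OF x(1)]]])
      show "(f \<cdot> x) \<cdot> m = tt C (Cod C m) \<cdot> m"
        using cmp_assoc'[OF mh x(1) fF] x(2) cmp_assoc[OF g kh fF] classified_tt[OF k fF]
          tt_cmp[OF g] tt_cmp[OF mh] by simp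
    qed
    then obtain y where y: "y \<in> hom C (Cod C m) (Dom C k)" "k \<cdot> y = x" using factors_iff[OF k fF x(1)] by blast
    have "y \<cdot> m = g"
      using cmp_assoc[OF mh y(1) kh] x(2) y(2) by (intro monic_cancel[OF km cmp_in[OF mh y(1)] g]) simp
    then show "\<exists>h\<in>hom C (Cod C m) (Dom C k). h \<cdot> m = g" using y(1) by blast }
  { fix m x y assume m: "dense C j m" and x: "x \<in> hom C (Cod C m) (Dom C k)" and y: "y \<in> hom C (Cod C m) (Dom C k)"
      and eq: "x \<cdot> m = y \<cdot> m"
    note mh = dense_hom[OF m]
    have "k \<cdot> x = k \<cdot> y"
      using cmp_assoc[OF mh x kh] cmp_assoc[OF mh y kh] eq
      by (intro sheaf_eqI[OF F m cmp_in[OF x kh] cmp_in[OF y kh]]) simp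
    then show "x = y" using monic_cancel[OF km x y] by blast }
qed

text \<open>A sheaf \<open>A\<close> is dense in its closure \<open>K\<close> in \<open>F\<close>, so the identity of \<open>A\<close> extends to a retraction \<open>K \<rightarrow> A\<close>;
  two arrows \<open>K \<rightarrow> F\<close> that agree on \<open>A\<close> are equal, so the retraction shows that \<open>K\<close> is contained in \<open>A\<close>.\<close>
lemma sheaf_sub_closed:
  assumes "sheaf C j (Dom C m)" and F: "sheaf C j F" and f: "f \<in> preds F" and m: "classifies C f m"
  shows "f \<in> closed_preds F"
proof -
  have FO: "F \<in> Ob C" using F sheaf_Ob by blast
  interpret N: nucleus "preds F" "elem_le C" "\<lambda>f. j \<cdot> f" by (rule nucleus_preds[OF FO])
  have jf: "j \<cdot> f \<in> preds F" using j_cmp_in[OF f] .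
  have mh: "m \<in> hom C (Dom C m) F" using classified_hom[OF m f] .
  have mm: "monic C m" using m by (simp add: classifies_def)
  obtain k where k: "classifies C (j \<cdot> f) k" "k \<in> hom C (Dom C k) F" using ex_classified[OF jf] by blast
  have "(j \<cdot> f) \<cdot> m = tt C (Dom C m)"
    using j_assoc[OF f mh] classified_tt[OF m f] j_tt[OF hom_dom_Ob[OF mh]] by simp
  then obtain d where d: "d \<in> hom C (Dom C m) (Dom C k)" "k \<cdot> d = m" using factors_iff[OF k(1) jf mh] by blast
  have km: "monic C k" using k(1) by (simp add: classifies_def)
  have dD: "Dom C d = Dom C m" "Cod C d = Dom C k" using homD[OF d(1)] by simp_all
  have fk: "f \<cdot> k \<in> preds (Dom C k)" using cmp_in[OF k(2) f] .
  have dm: "monic C d"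
    unfolding monic_def dD
  proof (intro conjI ballI impI)
    show "d \<in> Ar C" using hom_Ar[OF d(1)] .
    fix X x y assume x: "x \<in> hom C X (Dom C m)" and y: "y \<in> hom C X (Dom C m)" and "d \<cdot> x = d \<cdot> y"
    then have "m \<cdot> x = m \<cdot> y" using cmp_assoc[OF x d(1) k(2)] cmp_assoc[OF y d(1) k(2)] d(2) by simp
    then show "x = y" using monic_cancel[OF mm x y] by blast
  qed
  have "classifies C (f \<cdot> k) d"
    unfolding classifies_iff dD
  proof (intro conjI dm fk ballI)
    fix Y h assume h: "h \<in> hom C Y (Dom C k)"
    have "(f \<cdot> k) \<cdot> h = tt C Y \<longleftrightarrow> (\<exists>l\<in>hom C Y (Dom C m). m \<cdot> l = k \<cdot> h)"
      using factors_iff[OF m f cmp_in[OF h k(2)]] cmp_assoc'[OF h k(2) f] by simp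
    also have "\<dots> \<longleftrightarrow> (\<exists>l\<in>hom C Y (Dom C m). d \<cdot> l = h)"
      using cmp_assoc[OF _ d(1) k(2)] d(2) monic_cancel[OF km cmp_in[OF _ d(1)] h] by (metis (no_types, lifting))
    finally show "(f \<cdot> k) \<cdot> h = tt C Y \<longleftrightarrow> (\<exists>l\<in>hom C Y (Dom C m). d \<cdot> l = h)" .
  qed
  moreover have "j \<cdot> (f \<cdot> k) = tt C (Dom C k)" using j_assoc[OF f k(2)] classified_tt[OF k(1) jf] by simp
  ultimately have dd: "dense C j d" unfolding dense_iff dD by blast
  have id: "Ide C (Dom C m) \<in> hom C (Dom C d) (Dom C m)" using ide_in[OF hom_dom_Ob[OF mh]] dD by simp
  obtain r where r: "r \<in> hom C (Dom C k) (Dom C m)" "r \<cdot> d = Ide C (Dom C m)"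
    using sheaf_extend[OF assms(1) dd id] dD by auto
  have "m \<cdot> r = k"
  proof (rule sheaf_eqI[OF F dd, unfolded dD, OF cmp_in[OF r(1) mh] k(2)])
    show "(m \<cdot> r) \<cdot> d = k \<cdot> d" using cmp_assoc'[OF d(1) r(1) mh] r(2) d(2) ide_right[OF mh] by simp
  qed
  then have "f \<cdot> k = tt C (Dom C k)" using factors_iff[OF m f k(2)] r(1) by blast
  then have "elem_le C (j \<cdot> f) f"
    unfolding elem_le_iff[OF jf f]
    using factors_iff[OF k(1) jf] cmp_assoc[OF _ k(2) f] tt_cmp by (metis (no_types, lifting))
  then have "j \<cdot> f = f" using N.antisym[OF jf f] N.j_infl[OF f] by blast
  then show ?thesis using f by (simp add: closed_preds_iff)
qed

text \<open>The equalizer of \<open>j\<close> and the identity represents closed predicates.  It is a sheaf because closed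
  predicates extend uniquely along dense monomorphisms.\<close>
lemma ex_closed_truth_values:
  shows "\<exists>e. monic C e \<and> Cod C e = Omega C \<and> sheaf C j (Dom C e) \<and>
    (\<forall>X f. f \<in> closed_preds X \<longleftrightarrow> (\<exists>g\<in>hom C X (Dom C e). e \<cdot> g = f))"
proof -
  let ?I = "Ide C (Omega C)"
  have I: "?I \<in> preds (Omega C)" using ide_in[OF Omega_Ob] .
  obtain e where e: "is_equalizer C j ?I e" using equalizers[OF j_in I] by blast
  have em: "monic C e" using equalizer_monic[OF e] .
  have Ce: "Cod C e = Omega C" using e homD[OF j_in] by (simp add: is_equalizer_def)
  have eh: "e \<in> preds (Dom C e)" using monic_hom[OF em] Ce by simp
  have fac: "f \<in> closed_preds X \<longleftrightarrow> (\<exists>g\<in>hom C X (Dom C e). e \<cdot> g = f)" for X f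
  proof (cases "f \<in> preds X")
    case True
    then show ?thesis using equalizer_factors_iff[OF e j_in True] ide_left[OF True] by (simp add: closed_preds_iff)
  next
    case False
    then show ?thesis using cmp_in[OF _ eh] by (auto simp: closed_preds_iff)
  qed
  have "sheaf C j (Dom C e)"
  proof (rule sheafI)
    show "Dom C e \<in> Ob C" using hom_dom_Ob[OF eh] .
    { fix m f assume m: "dense C j m" and f: "f \<in> hom C (Dom C m) (Dom C e)"
      note mh = dense_hom[OF m]
      have "e \<cdot> f \<in> closed_preds (Dom C m)" using fac f by blast
      then obtain b where b: "b \<in> closed_preds (Cod C m)" "b \<cdot> m = e \<cdot> f" using closed_extend[OF m] by blast
      then obtain g where gb: "g \<in> hom C (Cod C m) (Dom C e)" "e \<cdot> g = b" using fac by blast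
      then have g: "g \<in> hom C (Cod C m) (Dom C e)" "(e \<cdot> g) \<cdot> m = e \<cdot> f" using b(2) by simp_all
      have "g \<cdot> m = f"
        using cmp_assoc[OF mh g(1) eh] g(2) by (intro monic_cancel[OF em cmp_in[OF mh g(1)] f]) simp
      then show "\<exists>g\<in>hom C (Cod C m) (Dom C e). g \<cdot> m = f" using g(1) by blast }
    { fix m x y assume m: "dense C j m" and x: "x \<in> hom C (Cod C m) (Dom C e)"
        and y: "y \<in> hom C (Cod C m) (Dom C e)" and eq: "x \<cdot> m = y \<cdot> m"
      note mh = dense_hom[OF m]
      have "e \<cdot> x \<in> closed_preds (Cod C m)" "e \<cdot> y \<in> closed_preds (Cod C m)" using fac x y by blast+
      moreover have "(e \<cdot> x) \<cdot> m = (e \<cdot> y) \<cdot> m"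
        using cmp_assoc[OF mh x eh] cmp_assoc[OF mh y eh] eq by simp
      ultimately have "e \<cdot> x = e \<cdot> y" by (rule closed_eqI[OF m])
      then show "x = y" using monic_cancel[OF em x y] by blast }
  qed
  then show ?thesis using em Ce fac by blast
qed

end

section \<open>The topos of sheaves\<close>

context topos_operator
begin

lemma Sh_simps [simp]:
  "Ob (Sh C j) = {F. sheaf C j F}" "Dom (Sh C j) = Dom C" "Cod (Sh C j) = Cod C"
  "Ide (Sh C j) = Ide C" "Cmp (Sh C j) = Cmp C"
  by (simp_all add: Sh_def)

lemma hom_Sh_iff: "f \<in> hom (Sh C j) A B \<longleftrightarrow> f \<in> hom C A B \<and> sheaf C j A \<and> sheaf C j B"
  by (auto simp: hom_def Sh_def)

lemma hom_Sh_eq: "\<lbrakk>sheaf C j A; sheaf C j B\<rbrakk> \<Longrightarrow> hom (Sh C j) A B = hom C A B"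
  by (auto simp: hom_Sh_iff)

lemma Ar_Sh_iff: "f \<in> Ar (Sh C j) \<longleftrightarrow> f \<in> Ar C \<and> sheaf C j (Dom C f) \<and> sheaf C j (Cod C f)"
  by (simp add: Sh_def)

lemma category_Sh: "category (Sh C j)"
proof
  fix A assume "A \<in> Ob (Sh C j)"
  then show "Ide (Sh C j) A \<in> hom (Sh C j) A A" using ide_in sheaf_Ob by (auto simp: hom_Sh_iff)
qed (auto simp: hom_Sh_iff Ar_Sh_iff ide_left ide_right intro: cmp_in cmp_assoc)

text \<open>The order between closed predicates on a sheaf can be tested on arrows from sheaves, since the subobject
  classified by the smaller one is itself a sheaf.  This is what relates the Kripke-Joyal semantics of
  \<open>sh\<^sub>j(E)\<close> to that of \<open>E\<close>.\<close>
lemma closed_le_sheaf_iff: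
  assumes F: "sheaf C j F" and a: "a \<in> closed_preds F" and b: "b \<in> preds F"
  shows "elem_le C a b \<longleftrightarrow>
    (\<forall>Y h. sheaf C j Y \<longrightarrow> h \<in> hom C Y F \<longrightarrow> a \<cdot> h = tt C Y \<longrightarrow> b \<cdot> h = tt C Y)" (is "_ \<longleftrightarrow> ?R")
proof
  have aF: "a \<in> preds F" using a by (simp add: closed_preds_iff)
  show "elem_le C a b \<Longrightarrow> ?R" unfolding elem_le_iff[OF aF b] by blast
  assume R: ?R
  obtain m where m: "classifies C a m" "m \<in> hom C (Dom C m) F" using ex_classified[OF aF] by blast
  have bm: "b \<cdot> m = tt C (Dom C m)"
    using R closed_sub_sheaf[OF F a m(1)] m(2) classified_tt[OF m(1) aF] by blast
  show "elem_le C a b"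
    unfolding elem_le_iff[OF aF b]
  proof (intro allI impI)
    fix Y h assume h: "h \<in> hom C Y F" "a \<cdot> h = tt C Y"
    then obtain k where k: "k \<in> hom C Y (Dom C m)" "m \<cdot> k = h" using factors_iff[OF m(1) aF] by blast
    show "b \<cdot> h = tt C Y" using cmp_assoc[OF k(1) m(2) b] k(2) bm tt_cmp[OF k(1)] by simp
  qed
qed

lemma closed_eq_sheafI:
  assumes F: "sheaf C j F" and a: "a \<in> closed_preds F" and b: "b \<in> closed_preds F"
    and eq: "\<And>Y h. \<lbrakk>sheaf C j Y; h \<in> hom C Y F\<rbrakk> \<Longrightarrow> a \<cdot> h = tt C Y \<longleftrightarrow> b \<cdot> h = tt C Y"
  shows "a = b"
proof -
  have ab: "a \<in> preds F" "b \<in> preds F" using a b by (simp_all add: closed_preds_iff)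
  show ?thesis
    using poset_on.antisym[OF preds_poset ab] closed_le_sheaf_iff[OF F a ab(2)] closed_le_sheaf_iff[OF F b ab(1)] eq
    by blast
qed

text \<open>The kernel pair of an arrow between sheaves is a sheaf, so an arrow that is monic in the category of sheaves
  already has a trivial kernel pair in \<open>E\<close>.\<close>
lemma monic_Sh_iff: "monic (Sh C j) m \<longleftrightarrow> monic C m \<and> sheaf C j (Dom C m) \<and> sheaf C j (Cod C m)"
proof
  assume m: "monic C m \<and> sheaf C j (Dom C m) \<and> sheaf C j (Cod C m)"
  then have "m \<in> Ar C" by (simp add: monic_def)
  with m show "monic (Sh C j) m"
    using monic_cancel[of m] unfolding monic_def[of "Sh C j"] by (simp add: hom_Sh_iff Ar_Sh_iff)
next
  assume m: "monic (Sh C j) m"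
  let ?A = "Dom C m" and ?F = "Cod C m"
  have mA: "m \<in> Ar C" and A: "sheaf C j ?A" and F: "sheaf C j ?F"
    using m unfolding monic_def by (auto simp: Ar_Sh_iff)
  have mh: "m \<in> hom C ?A ?F" using mA by (rule Ar_hom)
  have Sh_cancel: "x = y"
    if "sheaf C j X" "x \<in> hom C X ?A" "y \<in> hom C X ?A" "m \<cdot> x = m \<cdot> y" for X x y
    using m that A unfolding monic_def by (simp add: hom_Sh_iff)
  obtain P p where P: "is_product C 2 (\<lambda>_. ?A) P p"
    using finite_products[of 2 "\<lambda>_. ?A"] sheaf_Ob[OF A] by blast
  have PS: "sheaf C j P" by (rule product_sheaf[OF P]) (rule A)
  have P2: "is_product2 C ?A ?A P (p 0) (p 1)" using product_is_product2[OF P] .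
  then have p: "p 0 \<in> hom C P ?A" "p 1 \<in> hom C P ?A" by (simp_all add: is_product2_def)
  note mp = cmp_in[OF p(1) mh] cmp_in[OF p(2) mh]
  obtain e where e: "is_equalizer C (m \<cdot> p 0) (m \<cdot> p 1) e" using equalizers[OF mp] by blast
  have ES: "sheaf C j (Dom C e)" using equalizer_sheaf[OF e mp(1) PS F] .
  have eh: "e \<in> hom C (Dom C e) P" using e homD[OF mp(1)] by (auto simp: is_equalizer_def hom_def)
  have "(m \<cdot> p 0) \<cdot> e = (m \<cdot> p 1) \<cdot> e" using e by (simp add: is_equalizer_def)
  then have pe: "p 0 \<cdot> e = p 1 \<cdot> e"
    using cmp_assoc[OF eh p(1) mh] cmp_assoc[OF eh p(2) mh]
    by (intro Sh_cancel[OF ES cmp_in[OF eh p(1)] cmp_in[OF eh p(2)]]) simp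
  have "x = y" if x: "x \<in> hom C X ?A" and y: "y \<in> hom C X ?A" and eq: "m \<cdot> x = m \<cdot> y" for X x y
  proof -
    obtain h where h: "h \<in> hom C X P" "p 0 \<cdot> h = x" "p 1 \<cdot> h = y" using product2_pairing[OF P2 x y] by blast
    have "(m \<cdot> p 0) \<cdot> h = (m \<cdot> p 1) \<cdot> h"
      using cmp_assoc'[OF h(1) p(1) mh] cmp_assoc'[OF h(1) p(2) mh] h eq by simp
    then obtain k where k: "k \<in> hom C X (Dom C e)" "e \<cdot> k = h"
      using equalizer_factors_iff[OF e mp(1) h(1)] by blast
    show "x = y" using cmp_assoc[OF k(1) eh p(1)] cmp_assoc[OF k(1) eh p(2)] k(2) h pe by simp
  qed
  then show "monic C m \<and> sheaf C j ?A \<and> sheaf C j ?F" using mA A F unfolding monic_def by blast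
qed

lemma one_terminal_Sh: "terminal (Sh C j) (one C)"
  using one_sheaf one_terminal sheaf_Ob unfolding terminal_def by (auto simp: hom_Sh_iff)

text \<open>Subobjects in the category of sheaves are the closed ones, and their classifiers are the closed predicates,
  which factor uniquely through the sheaf of closed truth values.\<close>
lemma ex_truth_Sh: "\<exists>t. is_truth (Sh C j) t"
proof -
  obtain e where em: "monic C e" and Ce: "Cod C e = Omega C" and eS: "sheaf C j (Dom C e)"
    and fac: "\<And>X f. f \<in> closed_preds X \<longleftrightarrow> (\<exists>g\<in>hom C X (Dom C e). e \<cdot> g = f)"
    using ex_closed_truth_values by blast
  have eh: "e \<in> preds (Dom C e)" using monic_hom[OF em] Ce by simp
  obtain t where t: "t \<in> hom C (one C) (Dom C e)" "e \<cdot> t = truth C"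
    using fac tt_closed[OF one_Ob] unfolding truth_eq_tt[symmetric] by blast
  have tD: "Dom C t = one C" "Cod C t = Dom C e" using homD[OF t(1)] by simp_all
  interpret S: category "Sh C j" by (rule category_Sh)
  have tS: "t \<in> Ar (Sh C j)" using homD[OF t(1)] one_sheaf eS by (simp add: Ar_Sh_iff)
  have termS: "terminal (Sh C j) (Dom (Sh C j) t)" using one_terminal_Sh tD by simp
  have val: "(\<exists>k\<in>hom C Y (one C). f \<cdot> h = t \<cdot> k) \<longleftrightarrow> (e \<cdot> f) \<cdot> h = tt C Y"
    if f: "f \<in> hom C F (Dom C e)" and h: "h \<in> hom C Y F" for Y F f h
  proof -
    have Y: "Y \<in> Ob C" using h by (rule hom_dom_Ob)
    have "(\<exists>k\<in>hom C Y (one C). f \<cdot> h = t \<cdot> k) \<longleftrightarrow> f \<cdot> h = t \<cdot> to_one C Y"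
      using to_one_in[OF Y] to_one_unique by blast
    also have "\<dots> \<longleftrightarrow> e \<cdot> (f \<cdot> h) = e \<cdot> (t \<cdot> to_one C Y)"
      using monic_cancel[OF em cmp_in[OF h f] cmp_in[OF to_one_in[OF Y] t(1)]] by auto
    also have "\<dots> \<longleftrightarrow> (e \<cdot> f) \<cdot> h = tt C Y"
      using cmp_assoc[OF h f eh] cmp_assoc[OF to_one_in[OF Y] t(1) eh] t(2) by (simp add: tt_def)
    finally show ?thesis .
  qed
  have "\<exists>!f. f \<in> hom (Sh C j) (Cod C m) (Dom C e) \<and>
      (\<exists>u\<in>hom (Sh C j) (Dom C m) (one C). is_pullback (Sh C j) f t m u)" if mS: "monic (Sh C j) m" for m
  proof -
    have m: "monic C m" and mD: "sheaf C j (Dom C m)" and mC: "sheaf C j (Cod C m)" using mS monic_Sh_iff by auto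
    have mh: "m \<in> hom C (Dom C m) (Cod C m)" using m by (rule monic_hom)
    have pb: "(\<exists>u\<in>hom (Sh C j) (Dom C m) (one C). is_pullback (Sh C j) f t m u) \<longleftrightarrow>
      (\<forall>Y h. sheaf C j Y \<longrightarrow> h \<in> hom C Y (Cod C m) \<longrightarrow>
         ((e \<cdot> f) \<cdot> h = tt C Y \<longleftrightarrow> (\<exists>k\<in>hom C Y (Dom C m). m \<cdot> k = h)))"
      if f: "f \<in> hom C (Cod C m) (Dom C e)" for f
      using S.point_pullback_iff[OF termS tS mS, of f] f val[OF f] mC mD eS one_sheaf
      by (simp add: hom_Sh_iff tD Bex_def Ball_def conj_commute imp_conjL cong: conj_cong)
    obtain c where c: "classifies C c m" using ex_classifier[OF m] by blast
    then have cF: "c \<in> preds (Cod C m)" by (simp add: classifies_def)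
    have "c \<in> closed_preds (Cod C m)" using sheaf_sub_closed[OF mD mC cF c] .
    then obtain f where f: "f \<in> hom C (Cod C m) (Dom C e)" "e \<cdot> f = c" using fac by blast
    show ?thesis
    proof (rule ex1I[of _ f])
      show "f \<in> hom (Sh C j) (Cod C m) (Dom C e) \<and>
          (\<exists>u\<in>hom (Sh C j) (Dom C m) (one C). is_pullback (Sh C j) f t m u)"
        using f mC eS factors_iff[OF c cF] unfolding pb[OF f(1)] by (simp add: hom_Sh_iff)
      fix g assume "g \<in> hom (Sh C j) (Cod C m) (Dom C e) \<and>
          (\<exists>u\<in>hom (Sh C j) (Dom C m) (one C). is_pullback (Sh C j) g t m u)"
      then have g: "g \<in> hom C (Cod C m) (Dom C e)"
        and gpb: "\<exists>u\<in>hom (Sh C j) (Dom C m) (one C). is_pullback (Sh C j) g t m u"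
        by (auto simp: hom_Sh_iff)
      have cl: "e \<cdot> g \<in> closed_preds (Cod C m)" "e \<cdot> f \<in> closed_preds (Cod C m)" using fac g f(1) by blast+
      have "e \<cdot> g = e \<cdot> f"
        using closed_eq_sheafI[OF mC cl] gpb factors_iff[OF c cF] f(2) unfolding pb[OF g] by blast
      then show "g = f" using monic_cancel[OF em g f(1)] by blast
    qed
  qed
  then have "is_truth (Sh C j) t" using tS termS unfolding is_truth_def by (simp add: tD)
  then show ?thesis by blast
qed

lemma equalizer_Sh:
  assumes e: "is_equalizer C f g e" and f: "f \<in> hom C F G" and F: "sheaf C j F" and G: "sheaf C j G"
  shows "is_equalizer (Sh C j) f g e"
proof -
  have "sheaf C j (Dom C e)" using equalizer_sheaf[OF assms] .
  then show ?thesis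
    using e F G homD[OF f] sheaf_Ob unfolding is_equalizer_def by (auto simp: hom_Sh_iff Ar_Sh_iff)
qed

lemma product_Sh:
  assumes P: "is_product C n A P p" and A: "\<And>i. i < n \<Longrightarrow> sheaf C j (A i)"
  shows "is_product (Sh C j) n A P p"
  unfolding is_product_def
proof (intro conjI allI impI ballI)
  have PS: "sheaf C j P" using product_sheaf[OF assms] .
  then show "P \<in> Ob (Sh C j)" by simp
  fix i assume "i < n" then show "p i \<in> hom (Sh C j) P (A i)"
    using P A PS by (simp add: hom_Sh_iff is_product_def)
next
  have PS: "sheaf C j P" using product_sheaf[OF assms] .
  fix X f assume X: "X \<in> Ob (Sh C j)" and f: "\<forall>i<n. f i \<in> hom (Sh C j) X (A i)"
  have XO: "X \<in> Ob C" using X sheaf_Ob by simp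
  have "\<exists>!h. h \<in> hom C X P \<and> (\<forall>i<n. p i \<cdot> h = f i)"
    using P[unfolded is_product_def, THEN conjunct2, THEN conjunct2, rule_format, OF XO, of f] f
    by (simp add: hom_Sh_iff)
  then show "\<exists>!h. h \<in> hom (Sh C j) X P \<and> (\<forall>i<n. p i \<cdot>\<^bsub>Sh C j\<^esub> h = f i)"
    using X PS by (simp add: hom_Sh_iff)
qed

lemma classifying_Sh: "classifying_category (Sh C j)"
proof (intro classifying_category.intro classifying_category_axioms.intro category_Sh ex_truth_Sh)
  fix f g X assume "f \<in> hom (Sh C j) X (Omega (Sh C j))" "g \<in> hom (Sh C j) X (Omega (Sh C j))"
  then have f: "f \<in> hom C X (Omega (Sh C j))" and g: "g \<in> hom C X (Omega (Sh C j))"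
    and "sheaf C j X" "sheaf C j (Omega (Sh C j))" by (simp_all add: hom_Sh_iff)
  then show "\<exists>e. is_equalizer (Sh C j) f g e" using equalizers[OF f g] equalizer_Sh[OF _ f] by blast
next
  fix n
  have "is_truth (Sh C j) (truth (Sh C j))" unfolding truth_def using ex_truth_Sh by (rule someI_ex)
  then have O: "sheaf C j (Omega (Sh C j))" by (simp add: is_truth_def Omega_def Ar_Sh_iff)
  obtain P p where "is_product C n (\<lambda>_. Omega (Sh C j)) P p"
    using finite_products[of n "\<lambda>_. Omega (Sh C j)"] sheaf_Ob[OF O] by blast
  then show "\<exists>P p. is_product (Sh C j) n (\<lambda>_. Omega (Sh C j)) P p" using product_Sh O by blast
qed

end

sublocale topos_operator \<subseteq> Sh: classifying_category "Sh C j"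
  by (rule classifying_Sh)

context topos_operator
begin

lemma Sh_truth: "truth (Sh C j) \<in> hom C (one (Sh C j)) (Omega (Sh C j))"
  and Sh_one: "sheaf C j (one (Sh C j))" and Sh_Omega: "sheaf C j (Omega (Sh C j))"
  using Sh.truth_in by (simp_all add: hom_Sh_iff)

text \<open>The terminal object chosen for \<open>sh\<^sub>j(E)\<close> has the universal property also with respect to objects of \<open>E\<close>,
  being isomorphic to that of \<open>E\<close>, which is a sheaf.\<close>
lemma Sh_one_unique:
  assumes u: "u \<in> hom C X (one (Sh C j))" and v: "v \<in> hom C X (one (Sh C j))"
  shows "u = v"
proof -
  let ?T = "one (Sh C j)"
  have T: "?T \<in> Ob C" using Sh_one sheaf_Ob by blast
  obtain i where i: "i \<in> hom C (one C) ?T"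
    using Sh.one_terminal one_sheaf unfolding terminal_def by (auto simp: hom_Sh_iff)
  note k = to_one_in[OF T]
  have iT: "i \<cdot> to_one C ?T = Ide C ?T"
    using Sh.one_terminal Sh_one cmp_in[OF k i] ide_in[OF T] unfolding terminal_def by (auto simp: hom_Sh_iff)
  have w: "w = i \<cdot> to_one C X" if "w \<in> hom C X ?T" for w
    using cmp_assoc[OF that k i] iT ide_left[OF that] to_one_unique[OF cmp_in[OF that k]] by simp
  show ?thesis unfolding w[OF u] by (rule w[OF v, symmetric])
qed

text \<open>The object of truth values of \<open>sh\<^sub>j(E)\<close> is an arbitrary choice.  Its generic point is a subobject in \<open>E\<close>,
  and the classifier of this subobject in \<open>E\<close> is the comparison with the closed truth values of \<open>E\<close>.\<close>
definition inclusion :: 'a where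
  "inclusion = (SOME k. classifies C k (truth (Sh C j)))"

lemma inclusion_classifies: "classifies C inclusion (truth (Sh C j))"
proof -
  have "monic C (truth (Sh C j))"
    using homD[OF Sh_truth] by (simp add: monic_def) (auto intro: Sh_one_unique)
  from someI_ex[OF ex_classifier[OF this]] show ?thesis unfolding inclusion_def .
qed

lemma inclusion_in: "inclusion \<in> preds (Omega (Sh C j))"
  using inclusion_classifies homD[OF Sh_truth] by (simp add: classifies_def)

lemma inclusion_closed: "inclusion \<in> closed_preds (Omega (Sh C j))"
  using sheaf_sub_closed[OF _ Sh_Omega inclusion_in inclusion_classifies] Sh_one homD[OF Sh_truth] by simp

lemma inclusion_cmp_closed: "f \<in> hom C F (Omega (Sh C j)) \<Longrightarrow> inclusion \<cdot> f \<in> closed_preds F"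
  using closed_cmp[OF inclusion_closed] .

lemma inclusion_tt_iff:
  assumes f: "f \<in> hom C F (Omega (Sh C j))" and h: "h \<in> hom C Y F" and Y: "sheaf C j Y"
  shows "(inclusion \<cdot> f) \<cdot> h = tt C Y \<longleftrightarrow> f \<cdot> h = tt (Sh C j) Y"
proof -
  let ?u = "to_one (Sh C j) Y"
  have u: "?u \<in> hom C Y (one (Sh C j))" using Sh.to_one_in[of Y] Y by (simp add: hom_Sh_iff)
  have "(inclusion \<cdot> f) \<cdot> h = tt C Y \<longleftrightarrow> (\<exists>k\<in>hom C Y (one (Sh C j)). truth (Sh C j) \<cdot> k = f \<cdot> h)"
    using factors_iff[OF inclusion_classifies inclusion_in cmp_in[OF h f]] cmp_assoc'[OF h f inclusion_in]
      homD[OF Sh_truth] by simp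
  also have "\<dots> \<longleftrightarrow> f \<cdot> h = tt (Sh C j) Y"
  proof
    assume "\<exists>k\<in>hom C Y (one (Sh C j)). truth (Sh C j) \<cdot> k = f \<cdot> h"
    then obtain k where k: "k \<in> hom C Y (one (Sh C j))" "truth (Sh C j) \<cdot> k = f \<cdot> h" by blast
    then show "f \<cdot> h = tt (Sh C j) Y" using Sh_one_unique[OF k(1) u] by (simp add: tt_def)
  next
    assume "f \<cdot> h = tt (Sh C j) Y"
    then show "\<exists>k\<in>hom C Y (one (Sh C j)). truth (Sh C j) \<cdot> k = f \<cdot> h"
      using u by (intro bexI[of _ ?u]) (simp_all add: tt_def)
  qed
  finally show ?thesis .
qed

lemma inclusion_tt: assumes X: "sheaf C j X" shows "inclusion \<cdot> tt (Sh C j) X = tt C X"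
proof -
  have t: "tt (Sh C j) X \<in> hom C X (Omega (Sh C j))" using Sh.tt_in X by (simp add: hom_Sh_iff)
  have id: "Ide C X \<in> hom C X X" using ide_in sheaf_Ob[OF X] by blast
  have "(inclusion \<cdot> tt (Sh C j) X) \<cdot> Ide C X = tt C X"
    using inclusion_tt_iff[OF t id X] ide_right[OF t] by simp
  then show ?thesis using ide_right[OF cmp_in[OF t inclusion_in]] by simp
qed

text \<open>Composition with \<open>inclusion\<close> sends a predicate of \<open>sh\<^sub>j(E)\<close> to the predicate of \<open>E\<close> that classifies the same
  subobject.\<close>
lemma inclusion_order:
  assumes F: "sheaf C j F"
  shows "order_equivalence (Sh.preds F) (elem_le (Sh C j))
    (closed_preds F) (elem_le C) (\<lambda>f. inclusion \<cdot> f)"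
proof
  show "(\<lambda>f. inclusion \<cdot> f) ` Sh.preds F = closed_preds F"
  proof (intro equalityI subsetI)
    fix g assume "g \<in> (\<lambda>f. inclusion \<cdot> f) ` Sh.preds F"
    then show "g \<in> closed_preds F" using inclusion_cmp_closed by (auto simp: hom_Sh_iff)
  next
    fix g assume g: "g \<in> closed_preds F"
    then have gF: "g \<in> preds F" by (simp add: closed_preds_iff)
    obtain m where m: "classifies C g m" "m \<in> hom C (Dom C m) F" using ex_classified[OF gF] by blast
    have mS: "sheaf C j (Dom C m)" using closed_sub_sheaf[OF F g m(1)] .
    have Cm: "Cod C m = F" using homD[OF m(2)] by simp
    have "monic (Sh C j) m" using m(1) mS F Cm by (simp add: monic_Sh_iff classifies_def)
    then obtain f where f: "classifies (Sh C j) f m" using Sh.ex_classifier by blast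
    then have fS: "f \<in> Sh.preds F" by (simp add: classifies_def Cm)
    then have fF: "f \<in> hom C F (Omega (Sh C j))" by (simp add: hom_Sh_iff)
    have "inclusion \<cdot> f = g"
    proof (rule closed_eq_sheafI[OF F inclusion_cmp_closed[OF fF] g])
      fix Y h assume Y: "sheaf C j Y" and h: "h \<in> hom C Y F"
      then show "(inclusion \<cdot> f) \<cdot> h = tt C Y \<longleftrightarrow> g \<cdot> h = tt C Y"
        using inclusion_tt_iff[OF fF h Y] Sh.factors_iff[OF f fS, of h Y] factors_iff[OF m(1) gF h] F mS
        by (simp add: hom_Sh_eq)
    qed
    then show "g \<in> (\<lambda>f. inclusion \<cdot> f) ` Sh.preds F" using fS by blast
  qed
  fix f g assume fS: "f \<in> Sh.preds F" and gS: "g \<in> Sh.preds F"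
  then have f: "f \<in> hom C F (Omega (Sh C j))" and g: "g \<in> hom C F (Omega (Sh C j))" by (simp_all add: hom_Sh_iff)
  have gF: "inclusion \<cdot> g \<in> preds F" using cmp_in[OF g inclusion_in] .
  show "elem_le C (inclusion \<cdot> f) (inclusion \<cdot> g) = elem_le (Sh C j) f g"
    unfolding closed_le_sheaf_iff[OF F inclusion_cmp_closed[OF f] gF] Sh.elem_le_iff[OF fS gS]
    using inclusion_tt_iff[OF f] inclusion_tt_iff[OF g] F by (auto simp: hom_Sh_iff)
qed

lemma closed_pred_factors:
  assumes "sheaf C j F" "g \<in> closed_preds F"
  shows "\<exists>f\<in>Sh.preds F. inclusion \<cdot> f = g"
proof -
  have "g \<in> (\<lambda>f. inclusion \<cdot> f) ` Sh.preds F"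
    using order_equivalence.image[OF inclusion_order[OF assms(1)]] assms(2) by simp
  then show ?thesis by blast
qed

text \<open>An operation on closed predicates that is stable under substitution along all arrows of \<open>E\<close> is carried over
  to the truth values of \<open>sh\<^sub>j(E)\<close> by the order equivalence above.\<close>
lemma stable_op_Sh:
  assumes R: "\<And>X a b. \<lbrakk>a \<in> closed_preds X; b \<in> closed_preds X\<rbrakk> \<Longrightarrow> R (closed_preds X) (elem_le C) a b (op X a b)"
    and R_in: "\<And>X a b c. R (closed_preds X) (elem_le C) a b c \<Longrightarrow> c \<in> closed_preds X"
    and op_cmp: "\<And>X Y h a b. \<lbrakk>h \<in> hom C Y X; a \<in> closed_preds X; b \<in> closed_preds X\<rbrakk> \<Longrightarrow>
      op X a b \<cdot> h = op Y (a \<cdot> h) (b \<cdot> h)"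
    and R_iff: "\<And>F a b c. \<lbrakk>sheaf C j F; a \<in> Sh.preds F;
        b \<in> Sh.preds F; c \<in> Sh.preds F\<rbrakk> \<Longrightarrow>
      R (closed_preds F) (elem_le C) (inclusion \<cdot> a) (inclusion \<cdot> b) (inclusion \<cdot> c) \<longleftrightarrow>
      R (Sh.preds F) (elem_le (Sh C j)) a b c"
  shows "stable_op (Sh C j) R"
  unfolding stable_op_def
proof (intro allI ballI)
  fix X f g assume fS: "f \<in> Sh.preds X" and gS: "g \<in> Sh.preds X"
  then have X: "sheaf C j X" and f: "f \<in> hom C X (Omega (Sh C j))" and g: "g \<in> hom C X (Omega (Sh C j))" by (simp_all add: hom_Sh_iff)
  note fc = inclusion_cmp_closed[OF f] and gc = inclusion_cmp_closed[OF g]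
  have "op X (inclusion \<cdot> f) (inclusion \<cdot> g) \<in> closed_preds X" using R_in[OF R[OF fc gc]] .
  then obtain c where cS: "c \<in> Sh.preds X" and c: "inclusion \<cdot> c = op X (inclusion \<cdot> f) (inclusion \<cdot> g)"
    using closed_pred_factors[OF X] by blast
  have cX: "c \<in> hom C X (Omega (Sh C j))" using cS by (simp add: hom_Sh_iff)
  have "R (Sh.preds Y) (elem_le (Sh C j)) (f \<cdot> h) (g \<cdot> h) (c \<cdot> h)"
    if hS: "h \<in> hom (Sh C j) Y X" for Y h
  proof -
    have h: "h \<in> hom C Y X" and Y: "sheaf C j Y" using hS by (simp_all add: hom_Sh_iff)
    have inS: "f \<cdot> h \<in> Sh.preds Y" "g \<cdot> h \<in> Sh.preds Y" "c \<cdot> h \<in> Sh.preds Y"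
      using cmp_in[OF h] f g cX Y Sh_Omega by (simp_all add: hom_Sh_iff)
    have ch: "inclusion \<cdot> (c \<cdot> h) = op Y (inclusion \<cdot> (f \<cdot> h)) (inclusion \<cdot> (g \<cdot> h))"
      using cmp_assoc[OF h cX inclusion_in] cmp_assoc[OF h f inclusion_in] cmp_assoc[OF h g inclusion_in]
        op_cmp[OF h fc gc] c by simp
    show ?thesis
      unfolding R_iff[OF Y inS, symmetric] ch
      by (rule R[OF inclusion_cmp_closed[OF cmp_in[OF h f]] inclusion_cmp_closed[OF cmp_in[OF h g]]])
  qed
  then show "\<exists>c\<in>Sh.preds X. \<forall>Y. \<forall>h\<in>hom (Sh C j) Y X.
      R (Sh.preds Y) (elem_le (Sh C j)) (f \<cdot>\<^bsub>Sh C j\<^esub> h) (g \<cdot>\<^bsub>Sh C j\<^esub> h) (c \<cdot>\<^bsub>Sh C j\<^esub> h)"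
    using cS by auto
qed

lemma closed_preds_Ob: "a \<in> closed_preds X \<Longrightarrow> X \<in> Ob C"
  unfolding closed_preds_iff using hom_dom_Ob by blast

lemma stable_meet_Sh: "stable_op (Sh C j) is_meet"
proof (rule stable_op_Sh)
  show "is_meet (closed_preds X) (elem_le C) a b (closed_meet_at X a b)"
    if "a \<in> closed_preds X" "b \<in> closed_preds X" for X a b
    using heyting_poset.is_meet_hmeet[OF heyting_closed_preds[OF closed_preds_Ob]] that by blast
  show "c \<in> closed_preds X" if "is_meet (closed_preds X) (elem_le C) a b c" for X a b c
    using that by (simp add: is_meet_def)
qed (simp_all add: hmeet_closed_cmp order_equivalence.is_meet_iff[OF inclusion_order])

lemma stable_join_Sh: "stable_op (Sh C j) is_join"
proof (rule stable_op_Sh)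
  show "is_join (closed_preds X) (elem_le C) a b (closed_join_at X a b)"
    if "a \<in> closed_preds X" "b \<in> closed_preds X" for X a b
    using heyting_poset.is_join_hjoin[OF heyting_closed_preds[OF closed_preds_Ob]] that by blast
  show "c \<in> closed_preds X" if "is_join (closed_preds X) (elem_le C) a b c" for X a b c
    using that by (simp add: is_join_def)
qed (simp_all add: hjoin_closed_cmp order_equivalence.is_join_iff[OF inclusion_order])

lemma stable_himp_Sh: "stable_op (Sh C j) is_himp"
proof (rule stable_op_Sh)
  show "is_himp (closed_preds X) (elem_le C) a b (closed_imp_at X a b)"
    if "a \<in> closed_preds X" "b \<in> closed_preds X" for X a b
    using heyting_poset.is_himp_himp[OF heyting_closed_preds[OF closed_preds_Ob]] that by blast
  show "c \<in> closed_preds X" if "is_himp (closed_preds X) (elem_le C) a b c" for X a b c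
    using that by (simp add: is_himp_def)
qed (simp_all add: himp_closed_cmp order_equivalence.is_himp_iff[OF inclusion_order])

lemma heyting_Sh: "heyting_category (Sh C j)"
proof (intro heyting_category.intro heyting_category_axioms.intro classifying_Sh
    stable_meet_Sh stable_join_Sh stable_himp_Sh)
  let ?T = "one (Sh C j)"
  have T: "?T \<in> Ob C" using Sh_one sheaf_Ob by blast
  have "closed_bot_at ?T \<in> closed_preds ?T"
    using heyting_poset.bot_in[OF heyting_closed_preds[OF T]] .
  then obtain z where zS: "z \<in> Sh.preds ?T" and z: "inclusion \<cdot> z = closed_bot_at ?T"
    using closed_pred_factors[OF Sh_one] by blast
  have zT: "z \<in> hom C ?T (Omega (Sh C j))" using zS by (simp add: hom_Sh_iff)
  have "is_bot (Sh.preds X) (elem_le (Sh C j)) (z \<cdot> to_one (Sh C j) X)" if X: "sheaf C j X" for X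
  proof -
    have u: "to_one (Sh C j) X \<in> hom C X ?T" using Sh.to_one_in[of X] X by (simp add: hom_Sh_iff)
    have "z \<cdot> to_one (Sh C j) X \<in> Sh.preds X"
      using cmp_in[OF u zT] X Sh_Omega by (simp add: hom_Sh_iff)
    moreover have "inclusion \<cdot> (z \<cdot> to_one (Sh C j) X) = closed_bot_at X"
      using cmp_assoc[OF u zT inclusion_in] z hbot_closed_cmp[OF u] by simp
    ultimately show ?thesis
      using order_equivalence.is_bot_iff[OF inclusion_order[OF X]]
        heyting_poset.is_bot_hbot[OF heyting_closed_preds[OF sheaf_Ob[OF X]]] by metis
  qed
  then show "\<exists>z\<in>Sh.preds ?T. \<forall>X\<in>Ob (Sh C j).
      is_bot (Sh.preds X) (elem_le (Sh C j)) (z \<cdot>\<^bsub>Sh C j\<^esub> to_one (Sh C j) X)"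
    using zS by auto
qed

text \<open>The predicates of \<open>sh\<^sub>j(E)\<close> on a sheaf are isomorphic to the closed predicates of \<open>E\<close> on it, and evaluation of
  terms is invariant under isomorphism.\<close>
theorem satisfies_Sh_iff:
  assumes t: "vars t \<subseteq> {..<n}"
  shows "satisfies (Sh C j) n t \<longleftrightarrow> (\<forall>F f. sheaf C j F \<longrightarrow> (\<forall>i<n. f i \<in> closed_preds F) \<longrightarrow>
    closed_eval_at F f t = tt C F)" (is "_ \<longleftrightarrow> ?R")
proof -
  interpret SH: heyting_category "Sh C j" by (rule heyting_Sh)
  have iso: "order_isomorphism (Sh.preds F) (elem_le (Sh C j)) (closed_preds F) (elem_le C) (\<lambda>f. inclusion \<cdot> f)"
    if "sheaf C j F" for F
    using that inclusion_order SH.heyting_preds heyting_closed_preds sheaf_Ob by (simp add: order_isomorphism_def)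
  have inj: "x = y" if F: "sheaf C j F" and xy: "x \<in> Sh.preds F" "y \<in> Sh.preds F"
    and eq: "inclusion \<cdot> x = inclusion \<cdot> y" for F x y
  proof -
    interpret E: order_isomorphism "Sh.preds F" "elem_le (Sh C j)" "closed_preds F" "elem_le C" "\<lambda>f. inclusion \<cdot> f"
      by (rule iso[OF F])
    show ?thesis using E.H.antisym[OF xy] E.le_iff[OF xy] E.le_iff[OF xy(2,1)] eq E.H'.refl E.image_in xy by metis
  qed
  have key: "Sh.eval_at F f t = tt (Sh C j) F \<longleftrightarrow>
      closed_eval_at F (\<lambda>i. inclusion \<cdot> f i) t = tt C F"
    if F: "sheaf C j F" and f: "\<forall>i<n. f i \<in> Sh.preds F" for F f
  proof -
    have v: "\<And>i. i \<in> vars t \<Longrightarrow> f i \<in> Sh.preds F" using f t by blast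
    have a: "Sh.eval_at F f t \<in> Sh.preds F"
      using heyting_poset.heval_in[OF SH.heyting_preds v] F by simp
    have b: "tt (Sh C j) F \<in> Sh.preds F" using Sh.tt_in F by simp
    have "closed_eval_at F (\<lambda>i. inclusion \<cdot> f i) t =
        inclusion \<cdot> Sh.eval_at F f t"
      using order_isomorphism.heval_image[OF iso[OF F], of t f] v by simp
    then show ?thesis
      unfolding inclusion_tt[OF F, symmetric] using inj[OF F a b] by auto
  qed
  show ?thesis
  proof
    assume sat: "satisfies (Sh C j) n t"
    show ?R
    proof (intro allI impI)
      fix F f assume F: "sheaf C j F" and f: "\<forall>i<n. f i \<in> closed_preds F"
      define g where "g i = (SOME g. g \<in> Sh.preds F \<and> inclusion \<cdot> g = f i)" for i
      have gi: "g i \<in> Sh.preds F \<and> inclusion \<cdot> g i = f i" if "i < n" for i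
        unfolding g_def by (rule someI_ex) (use closed_pred_factors[OF F, of "f i"] f that in blast)
      then have g: "\<And>i. i < n \<Longrightarrow> g i \<in> Sh.preds F" "\<And>i. i < n \<Longrightarrow> inclusion \<cdot> g i = f i" by blast+
      have "closed_eval_at F (\<lambda>i. inclusion \<cdot> g i) t = tt C F"
        using sat F g(1) key[OF F] unfolding SH.satisfies_iff[OF t] by simp
      moreover have "closed_eval_at F (\<lambda>i. inclusion \<cdot> g i) t = closed_eval_at F f t"
        using g(2) t by (intro heval_cong) auto
      ultimately show "closed_eval_at F f t = tt C F" by simp
    qed
  next
    assume R: ?R
    show "satisfies (Sh C j) n t"
      unfolding SH.satisfies_iff[OF t]
    proof (intro ballI allI impI)
      fix F f assume "F \<in> Ob (Sh C j)" and f: "\<forall>i<n. f i \<in> Sh.preds F"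
      then have F: "sheaf C j F" by simp
      have "\<forall>i<n. inclusion \<cdot> f i \<in> closed_preds F" using f inclusion_cmp_closed by (simp add: hom_Sh_iff)
      then show "Sh.eval_at F f t = tt (Sh C j) F"
        using R[rule_format, OF F, of "\<lambda>i. inclusion \<cdot> f i"] key[OF F f] by simp
    qed
  qed
qed

end

section \<open>Open local operators\<close>

definition classifier :: "('o, 'a, 'm) cat_scheme \<Rightarrow> 'a \<Rightarrow> 'a" where
  "classifier C m = (THE f. classifies C f m)"

context classifying_category
begin

lemma classifies_classifier: "monic C m \<Longrightarrow> classifies C (classifier C m) m"
  unfolding classifier_def using ex_classifier classifier_unique by (metis theI)

lemma classifier_eq: "classifies C f m \<Longrightarrow> classifier C m = f"
  using classifies_classifier classifier_unique unfolding classifies_def by blast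

lemma sub_le_iff:
  assumes m: "monic C m" "Cod C m = X" and k: "monic C k" "Cod C k = X"
  shows "elem_le C (classifier C m) (classifier C k) \<longleftrightarrow> sub_le C m k"
proof
  note cm = classifies_classifier[OF m(1)] and ck = classifies_classifier[OF k(1)]
  have fm: "classifier C m \<in> preds X" and fk: "classifier C k \<in> preds X"
    using cm ck m k by (simp_all add: classifies_def)
  show "sub_le C m k \<Longrightarrow> elem_le C (classifier C m) (classifier C k)"
    using cm ck unfolding elem_le_def by blast
  assume le: "elem_le C (classifier C m) (classifier C k)"
  have mh: "m \<in> hom C (Dom C m) X" using monic_hom[OF m(1)] m(2) by simp
  have "classifier C k \<cdot> m = tt C (Dom C m)"
    using le mh classified_tt[OF cm fm] unfolding elem_le_iff[OF fm fk] by blast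
  then show "sub_le C m k" using factors_iff[OF ck fk mh] by (simp add: sub_le_def)
qed

lemma subobject_order:
  "order_equivalence (Sub C X) (sub_le C) (preds X) (elem_le C) (classifier C)"
proof
  show "classifier C ` Sub C X = preds X"
  proof (intro equalityI subsetI)
    fix f assume "f \<in> classifier C ` Sub C X"
    then obtain m where m: "monic C m" "Cod C m = X" "f = classifier C m" by (auto simp: Sub_def)
    then show "f \<in> preds X" using classifies_classifier[OF m(1)] by (simp add: classifies_def)
  next
    fix f assume "f \<in> preds X"
    then obtain m where m: "classifies C f m" "m \<in> hom C (Dom C m) X" using ex_classified by blast
    then have "m \<in> Sub C X" using homD[OF m(2)] by (simp add: Sub_def classifies_def)
    then show "f \<in> classifier C ` Sub C X" using classifier_eq[OF m(1)] by blast
  qed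
qed (simp add: Sub_def sub_le_iff)

end

context topos_operator
begin

lemma sheaf_subobject_order:
  assumes F: "sheaf C j F"
  shows "order_equivalence (Sub (Sh C j) F) (sub_le (Sh C j)) (closed_preds F) (elem_le C) (classifier C)"
proof
  have Sub_iff: "m \<in> Sub (Sh C j) F \<longleftrightarrow> m \<in> Sub C F \<and> sheaf C j (Dom C m)" for m
    using F by (auto simp: Sub_def monic_Sh_iff)
  interpret E: order_equivalence "Sub C F" "sub_le C" "preds F" "elem_le C" "classifier C" by (rule subobject_order)
  show "classifier C ` Sub (Sh C j) F = closed_preds F"
  proof (intro equalityI subsetI)
    fix f assume "f \<in> classifier C ` Sub (Sh C j) F"
    then obtain m where m: "m \<in> Sub C F" "sheaf C j (Dom C m)" "f = classifier C m" using Sub_iff by auto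
    then have "classifies C f m" using classifies_classifier by (simp add: Sub_def)
    then show "f \<in> closed_preds F" using sheaf_sub_closed[OF m(2) F] E.image_in[OF m(1)] m(3) by simp
  next
    fix f assume f: "f \<in> closed_preds F"
    then have "f \<in> preds F" by (simp add: closed_preds_iff)
    then obtain m where m: "classifies C f m" "m \<in> hom C (Dom C m) F" using ex_classified by blast
    then have "m \<in> Sub (Sh C j) F"
      using homD[OF m(2)] closed_sub_sheaf[OF F f m(1)] by (simp add: Sub_iff) (simp add: Sub_def classifies_def)
    then show "f \<in> classifier C ` Sub (Sh C j) F" using classifier_eq[OF m(1)] by blast
  qed
  fix m k assume "m \<in> Sub (Sh C j) F" "k \<in> Sub (Sh C j) F"
  then have m: "m \<in> Sub C F" "sheaf C j (Dom C m)" and k: "k \<in> Sub C F" "sheaf C j (Dom C k)"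
    using Sub_iff by auto
  show "elem_le C (classifier C m) (classifier C k) = sub_le (Sh C j) m k"
    unfolding E.le_iff[OF m(1) k(1)] sub_le_def by (simp add: hom_Sh_eq[OF m(2) k(2)])
qed

end

text \<open>An associated sheaf functor with its unit made explicit.\<close>
locale sheaf_reflection = topos_operator C j for C :: "('o, 'a, 'm) cat_scheme" (structure) and j +
  fixes Fo :: "'o \<Rightarrow> 'o" and Fa :: "'a \<Rightarrow> 'a" and \<eta> :: "'o \<Rightarrow> 'a"
  assumes reflector: "category_functor C (Sh C j) Fo Fa"
    and unit: "X \<in> Ob C \<Longrightarrow> \<eta> X \<in> hom C X (Fo X)"
    and unit_natural: "f \<in> hom C X Y \<Longrightarrow> \<eta> Y \<cdot> f = Fa f \<cdot> \<eta> X"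
    and unit_universal: "\<lbrakk>X \<in> Ob C; sheaf C j F; f \<in> hom C X F\<rbrakk> \<Longrightarrow> \<exists>!g. g \<in> hom C (Fo X) F \<and> g \<cdot> \<eta> X = f"
begin

lemma Fo_sheaf: "X \<in> Ob C \<Longrightarrow> sheaf C j (Fo X)"
  using category_functor.obj[OF reflector] by simp

lemma Fa_hom: "f \<in> hom C X Y \<Longrightarrow> Fa f \<in> hom C (Fo X) (Fo Y)"
  using category_functor.arr[OF reflector] by (simp add: hom_Sh_iff)

lemma unit_eqI:
  assumes "X \<in> Ob C" "sheaf C j F" and f: "f \<in> hom C (Fo X) F" and g: "g \<in> hom C (Fo X) F"
    and eq: "f \<cdot> \<eta> X = g \<cdot> \<eta> X"
  shows "f = g"
  by (rule ex1_unique[OF unit_universal[OF assms(1,2) cmp_in[OF unit[OF assms(1)] g]]])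
    (simp_all add: f g eq)

text \<open>Closed predicates are arrows into a sheaf, so by the universal property composition with the unit is a
  bijection on them.  As it preserves meets, it also reflects the order.\<close>
lemma unit_order:
  assumes X: "X \<in> Ob C"
  shows "order_equivalence (closed_preds (Fo X)) (elem_le C) (closed_preds X) (elem_le C) (\<lambda>f. f \<cdot> \<eta> X)"
proof -
  note uX = unit[OF X]
  have FX: "Fo X \<in> Ob C" using hom_cod_Ob[OF uX] .
  obtain e where em: "monic C e" and Ce: "Cod C e = Omega C" and eS: "sheaf C j (Dom C e)"
    and fac: "\<And>X f. f \<in> closed_preds X \<longleftrightarrow> (\<exists>g\<in>hom C X (Dom C e). e \<cdot> g = f)"
    using ex_closed_truth_values by blast
  have eh: "e \<in> preds (Dom C e)" using monic_hom[OF em] Ce by simp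
  interpret N: nucleus "preds (Fo X)" "elem_le C" "\<lambda>f. j \<cdot> f" by (rule nucleus_preds[OF FX])
  interpret NX: nucleus "preds X" "elem_le C" "\<lambda>f. j \<cdot> f" by (rule nucleus_preds[OF X])
  have inj: "f = g" if fg: "f \<in> closed_preds (Fo X)" "g \<in> closed_preds (Fo X)" and eq: "f \<cdot> \<eta> X = g \<cdot> \<eta> X" for f g
  proof -
    obtain f' where f': "f' \<in> hom C (Fo X) (Dom C e)" "e \<cdot> f' = f" using fg(1) fac by blast
    obtain g' where g': "g' \<in> hom C (Fo X) (Dom C e)" "e \<cdot> g' = g" using fg(2) fac by blast
    have "e \<cdot> (f' \<cdot> \<eta> X) = e \<cdot> (g' \<cdot> \<eta> X)"
      using cmp_assoc[OF uX f'(1) eh] cmp_assoc[OF uX g'(1) eh] f'(2) g'(2) eq by simp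
    then have "f' \<cdot> \<eta> X = g' \<cdot> \<eta> X"
      by (rule monic_cancel[OF em cmp_in[OF uX f'(1)] cmp_in[OF uX g'(1)]])
    then have "f' = g'" by (rule unit_eqI[OF X eS f'(1) g'(1)])
    then show "f = g" using f'(2) g'(2) by simp
  qed
  show ?thesis
  proof
    show "(\<lambda>f. f \<cdot> \<eta> X) ` closed_preds (Fo X) = closed_preds X"
    proof (intro equalityI subsetI)
      fix f assume "f \<in> (\<lambda>f. f \<cdot> \<eta> X) ` closed_preds (Fo X)"
      then show "f \<in> closed_preds X" using closed_cmp[OF _ uX] by blast
    next
      fix f assume "f \<in> closed_preds X"
      then obtain g where g: "g \<in> hom C X (Dom C e)" "e \<cdot> g = f" using fac by blast
      obtain g' where g': "g' \<in> hom C (Fo X) (Dom C e)" "g' \<cdot> \<eta> X = g"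
        using unit_universal[OF X eS g(1)] by blast
      have "(e \<cdot> g') \<cdot> \<eta> X = f" using cmp_assoc'[OF uX g'(1) eh] g'(2) g(2) by simp
      moreover have "e \<cdot> g' \<in> closed_preds (Fo X)" using fac g'(1) by blast
      ultimately show "f \<in> (\<lambda>f. f \<cdot> \<eta> X) ` closed_preds (Fo X)" by blast
    qed
    fix f g assume f: "f \<in> closed_preds (Fo X)" and g: "g \<in> closed_preds (Fo X)"
    note fP = N.closed_in[OF f] and gP = N.closed_in[OF g]
    have "elem_le C (f \<cdot> \<eta> X) (g \<cdot> \<eta> X) \<longleftrightarrow> meet_at X (f \<cdot> \<eta> X) (g \<cdot> \<eta> X) = f \<cdot> \<eta> X"
      using NX.meet_absorb[OF cmp_in[OF uX fP] cmp_in[OF uX gP]] by simp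
    also have "\<dots> \<longleftrightarrow> meet_at (Fo X) f g \<cdot> \<eta> X = f \<cdot> \<eta> X"
      by (simp only: hmeet_cmp[OF fP gP uX])
    also have "\<dots> \<longleftrightarrow> meet_at (Fo X) f g = f"
      using inj[OF N.meet_closed[OF f g] f] by auto
    also have "\<dots> \<longleftrightarrow> elem_le C f g" using N.meet_absorb[OF fP gP] .
    finally show "elem_le C (f \<cdot> \<eta> X) (g \<cdot> \<eta> X) = elem_le C f g" .
  qed
qed

text \<open>By naturality of the unit, \<open>a\<close> is contained in the pullback of \<open>a\<^sub>j(a)\<close>, which is closed.  Conversely, let
  \<open>u\<close> be the closed subobject of \<open>a\<^sub>j X\<close> whose pullback is the closure of \<open>a\<close>.  It is a sheaf through which
  \<open>\<eta> a\<close> factors, so it contains \<open>a\<^sub>j(a)\<close> by the universal property.\<close>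
lemma sheafified_subobject:
  assumes a: "a \<in> Sub C X" and aS: "Fa a \<in> Sub (Sh C j) (Fo X)"
  shows "classifier C (Fa a) \<cdot> \<eta> X = j \<cdot> classifier C a"
proof -
  have am: "monic C a" and Ca: "Cod C a = X" using a by (auto simp: Sub_def)
  let ?A = "Dom C a" and ?f = "classifier C a" and ?g = "classifier C (Fa a)"
  have ah: "a \<in> hom C ?A X" using monic_hom[OF am] Ca by simp
  have A: "?A \<in> Ob C" and X: "X \<in> Ob C" using homD[OF ah] by auto
  note uA = unit[OF A] and uX = unit[OF X] and Fah = Fa_hom[OF ah]
  have FX: "sheaf C j (Fo X)" using Fo_sheaf[OF X] .
  have fc: "classifies C ?f a" using classifies_classifier[OF am] .
  then have f: "?f \<in> preds X" using Ca by (simp add: classifies_def)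
  have Fam: "monic C (Fa a)" using aS by (auto simp: Sub_def monic_Sh_iff)
  have gc: "classifies C ?g (Fa a)" using classifies_classifier[OF Fam] .
  have gcl: "?g \<in> closed_preds (Fo X)" using order_equivalence.image_in[OF sheaf_subobject_order[OF FX] aS] .
  then have g: "?g \<in> preds (Fo X)" by (simp add: closed_preds_iff)
  have DFa: "Dom C (Fa a) = Fo ?A" using homD[OF Fah] by simp
  note gu = cmp_in[OF uX g]
  interpret NX: nucleus "preds X" "elem_le C" "\<lambda>f. j \<cdot> f" by (rule nucleus_preds[OF X])
  interpret U: order_equivalence "closed_preds (Fo X)" "elem_le C" "closed_preds X" "elem_le C" "\<lambda>f. f \<cdot> \<eta> X"
    by (rule unit_order[OF X])
  show ?thesis
  proof (rule NX.antisym[OF gu j_cmp_in[OF f]])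
    have "(?g \<cdot> \<eta> X) \<cdot> a = (?g \<cdot> Fa a) \<cdot> \<eta> ?A"
      using cmp_assoc'[OF ah uX g] cmp_assoc'[OF uA Fah g] unit_natural[OF ah] by simp
    also have "\<dots> = tt C ?A" using classified_tt[OF gc g] DFa tt_cmp[OF uA] by simp
    finally have gua: "(?g \<cdot> \<eta> X) \<cdot> a = tt C ?A" .
    have "elem_le C ?f (?g \<cdot> \<eta> X)"
      unfolding elem_le_iff[OF f gu]
    proof (intro allI impI)
      fix Y h assume h: "h \<in> hom C Y X" "?f \<cdot> h = tt C Y"
      then obtain k where k: "k \<in> hom C Y ?A" "a \<cdot> k = h" using factors_iff[OF fc f] by blast
      show "(?g \<cdot> \<eta> X) \<cdot> h = tt C Y" using cmp_assoc[OF k(1) ah gu] gua k(2) tt_cmp[OF k(1)] by simp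
    qed
    then show "elem_le C (j \<cdot> ?f) (?g \<cdot> \<eta> X)" using NX.j_le_iff[OF f closed_cmp[OF gcl uX]] by blast
  next
    have "j \<cdot> ?f \<in> (\<lambda>f. f \<cdot> \<eta> X) ` closed_preds (Fo X)" using U.image j_closed_preds[OF f] by simp
    then obtain q where q: "q \<in> closed_preds (Fo X)" "q \<cdot> \<eta> X = j \<cdot> ?f" by auto
    then have qP: "q \<in> preds (Fo X)" by (simp add: closed_preds_iff)
    obtain u where u: "classifies C q u" "u \<in> hom C (Dom C u) (Fo X)" using ex_classified[OF qP] by blast
    have uS: "sheaf C j (Dom C u)" using closed_sub_sheaf[OF FX q(1) u(1)] .
    note ua = cmp_in[OF ah uX]
    have "q \<cdot> (\<eta> X \<cdot> a) = tt C ?A"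
      using cmp_assoc[OF ah uX qP] q(2) j_assoc[OF f ah] classified_tt[OF fc f] j_tt[OF A] by simp
    then obtain r where r: "r \<in> hom C ?A (Dom C u)" "u \<cdot> r = \<eta> X \<cdot> a" using factors_iff[OF u(1) qP ua] by blast
    obtain s where s: "s \<in> hom C (Fo ?A) (Dom C u)" "s \<cdot> \<eta> ?A = r" using unit_universal[OF A uS r(1)] by blast
    have "u \<cdot> s = Fa a"
    proof (rule unit_eqI[OF A FX cmp_in[OF s(1) u(2)] Fah])
      show "(u \<cdot> s) \<cdot> \<eta> ?A = Fa a \<cdot> \<eta> ?A"
        using cmp_assoc'[OF uA s(1) u(2)] s(2) r(2) unit_natural[OF ah] by simp
    qed
    then have "sub_le C (Fa a) u" using s(1) DFa by (auto simp: sub_le_def)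
    then have "elem_le C ?g q" using gc u(1) unfolding elem_le_def by blast
    then have "elem_le C (?g \<cdot> \<eta> X) (q \<cdot> \<eta> X)" using elem_le_cmp[OF g qP uX] by blast
    then show "elem_le C (?g \<cdot> \<eta> X) (j \<cdot> ?f)" using q(2) by simp
  qed
qed

lemma sheafified_order:
  assumes X: "X \<in> Ob C"
  shows "order_equivalence (Sub (Sh C j) (Fo X)) (sub_le (Sh C j)) (closed_preds X) (elem_le C)
    (\<lambda>m. classifier C m \<cdot> \<eta> X)"
  by (rule order_equivalence_comp[OF sheaf_subobject_order[OF Fo_sheaf[OF X]] unit_order[OF X]])

lemma ex_subobject:
  assumes "f \<in> preds X" shows "\<exists>a\<in>Sub C X. classifier C a = f"
proof -
  have "f \<in> classifier C ` Sub C X" using assms order_equivalence.image[OF subobject_order[of X]] by simp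
  then show ?thesis by blast
qed

text \<open>The subobjects of \<open>a\<^sub>j X\<close> in \<open>sh\<^sub>j(E)\<close> correspond to the closed predicates on \<open>X\<close>, and \<open>a\<^sub>j(m)\<close> to the closure of
  \<open>m\<close>; so preservation of implication by \<open>a\<^sub>j\<close> becomes an equation between predicates.\<close>
lemma preserves_himp:
  assumes pres: "\<And>a b c. is_himp (Sub C X) (sub_le C) a b c \<Longrightarrow>
      is_himp (Sub (Sh C j) (Fo X)) (sub_le (Sh C j)) (Fa a) (Fa b) (Fa c)"
    and f: "f \<in> preds X" and g: "g \<in> preds X"
  shows "j \<cdot> imp_at X f g = imp_at X (j \<cdot> f) (j \<cdot> g)"
proof -
  have X: "X \<in> Ob C" using f by (rule hom_dom_Ob)
  interpret NX: nucleus "preds X" "elem_le C" "\<lambda>f. j \<cdot> f" by (rule nucleus_preds[OF X])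
  interpret K: heyting_poset "closed_preds X" "elem_le C" by (rule heyting_closed_preds[OF X])
  obtain a where a: "a \<in> Sub C X" "classifier C a = f" using ex_subobject[OF f] by blast
  obtain b where b: "b \<in> Sub C X" "classifier C b = g" using ex_subobject[OF g] by blast
  obtain c where c: "c \<in> Sub C X" "classifier C c = imp_at X f g"
    using ex_subobject[OF NX.imp_in[OF f g]] by blast
  have "is_himp (Sub C X) (sub_le C) a b c"
    using order_equivalence.is_himp_iff[OF subobject_order a(1) b(1) c(1)] NX.is_himp_himp[OF f g] a b c by simp
  then have H: "is_himp (Sub (Sh C j) (Fo X)) (sub_le (Sh C j)) (Fa a) (Fa b) (Fa c)" by (rule pres)
  then have S: "Fa a \<in> Sub (Sh C j) (Fo X)" "Fa b \<in> Sub (Sh C j) (Fo X)" "Fa c \<in> Sub (Sh C j) (Fo X)"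
    by (simp_all add: is_himp_def)
  have "is_himp (closed_preds X) (elem_le C) (j \<cdot> f) (j \<cdot> g) (j \<cdot> imp_at X f g)"
    using H order_equivalence.is_himp_iff[OF sheafified_order[OF X] S]
      sheafified_subobject[OF a(1) S(1)] sheafified_subobject[OF b(1) S(2)] sheafified_subobject[OF c(1) S(3)] a b c
    by simp
  then show ?thesis
    using K.himp_eq NX.himp_closed[OF j_closed_preds[OF f] j_closed_preds[OF g]] by simp
qed

text \<open>As for implication, except that the pseudocomplement of sheaves refers to the least closed predicate \<open>j 0\<close>.\<close>
lemma preserves_pseudocompl:
  assumes pres: "\<And>a c. is_pseudocompl (Sub C X) (sub_le C) a c \<Longrightarrow>
      is_pseudocompl (Sub (Sh C j) (Fo X)) (sub_le (Sh C j)) (Fa a) (Fa c)"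
    and f: "f \<in> preds X"
  shows "j \<cdot> neg_at X f = imp_at X (j \<cdot> f) (j \<cdot> bot_at X)"
proof -
  have X: "X \<in> Ob C" using f by (rule hom_dom_Ob)
  interpret NX: nucleus "preds X" "elem_le C" "\<lambda>f. j \<cdot> f" by (rule nucleus_preds[OF X])
  interpret K: heyting_poset "closed_preds X" "elem_le C" by (rule heyting_closed_preds[OF X])
  obtain a where a: "a \<in> Sub C X" "classifier C a = f" using ex_subobject[OF f] by blast
  obtain c where c: "c \<in> Sub C X" "classifier C c = neg_at X f"
    using ex_subobject[OF NX.imp_in[OF f NX.bot_in]] by blast
  have "is_pseudocompl (Sub C X) (sub_le C) a c"
    using order_equivalence.is_pseudocompl_iff[OF subobject_order a(1) c(1)] NX.is_pseudocompl_iff[OF f] a c by simp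
  then have H: "is_pseudocompl (Sub (Sh C j) (Fo X)) (sub_le (Sh C j)) (Fa a) (Fa c)" by (rule pres)
  then have S: "Fa a \<in> Sub (Sh C j) (Fo X)" "Fa c \<in> Sub (Sh C j) (Fo X)"
    by (auto simp: is_himp_def is_pseudocompl_def)
  have "is_pseudocompl (closed_preds X) (elem_le C) (j \<cdot> f) (j \<cdot> neg_at X f)"
    using H order_equivalence.is_pseudocompl_iff[OF sheafified_order[OF X] S]
      sheafified_subobject[OF a(1) S(1)] sheafified_subobject[OF c(1) S(2)] a c
    by simp
  then show ?thesis
    using K.is_pseudocompl_iff[OF j_closed_preds[OF f]]
      NX.himp_closed[OF j_closed_preds[OF f] NX.j_closed[OF NX.bot_in]] by (simp add: NX.hbot_closed)
qed

end

context topos_operator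
begin

lemma reflectionE:
  assumes "associated_sheaf_functor C j Fo Fa" obtains \<eta> where "sheaf_reflection C j Fo Fa \<eta>"
proof -
  obtain \<eta> where "category_functor C (Sh C j) Fo Fa" "\<forall>X\<in>Ob C. \<eta> X \<in> hom C X (Fo X)"
    "\<forall>X Y. \<forall>f\<in>hom C X Y. \<eta> Y \<cdot> f = Fa f \<cdot> \<eta> X"
    "\<forall>X\<in>Ob C. \<forall>F. sheaf C j F \<longrightarrow> (\<forall>f\<in>hom C X F. \<exists>!g. g \<in> hom C (Fo X) F \<and> g \<cdot> \<eta> X = f)"
    using assms unfolding associated_sheaf_functor_def by blast
  then have "sheaf_reflection C j Fo Fa \<eta>"
    by (intro sheaf_reflection.intro sheaf_reflection_axioms.intro topos_operator_axioms) blast+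
  then show ?thesis using that by blast
qed

lemma implicationally_open_himp:
  assumes "implicationally_open C j" "f \<in> preds X" "g \<in> preds X"
  shows "j \<cdot> imp_at X f g = imp_at X (j \<cdot> f) (j \<cdot> g)"
proof -
  obtain Fo Fa where "associated_sheaf_functor C j Fo Fa"
    and pres: "\<And>X a b c. \<lbrakk>X \<in> Ob C; is_himp (Sub C X) (sub_le C) a b c\<rbrakk> \<Longrightarrow>
           is_himp (Sub (Sh C j) (Fo X)) (sub_le (Sh C j)) (Fa a) (Fa b) (Fa c)"
    using assms(1) unfolding implicationally_open_def by blast
  then obtain \<eta> where "sheaf_reflection C j Fo Fa \<eta>" by (elim reflectionE)
  then interpret R: sheaf_reflection C j Fo Fa \<eta> .
  show ?thesis using R.preserves_himp[OF pres] hom_dom_Ob assms(2,3) by blast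
qed

lemma weakly_open_hneg:
  assumes "weakly_open C j" "f \<in> preds X"
  shows "j \<cdot> neg_at X f = imp_at X (j \<cdot> f) (j \<cdot> bot_at X)"
proof -
  obtain Fo Fa where "associated_sheaf_functor C j Fo Fa"
    and pres: "\<And>X a c. \<lbrakk>X \<in> Ob C; is_pseudocompl (Sub C X) (sub_le C) a c\<rbrakk> \<Longrightarrow>
           is_pseudocompl (Sub (Sh C j) (Fo X)) (sub_le (Sh C j)) (Fa a) (Fa c)"
    using assms(1) unfolding weakly_open_def by blast
  then obtain \<eta> where "sheaf_reflection C j Fo Fa \<eta>" by (elim reflectionE)
  then interpret R: sheaf_reflection C j Fo Fa \<eta> .
  show ?thesis using R.preserves_pseudocompl[OF pres] hom_dom_Ob assms(2) by blast
qed

section \<open>Density of the axiom\<close>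

lemma dense_axiom_iff:
  assumes t: "vars t \<subseteq> {..<n}"
  shows "dense C j (axiom_equalizer C n t) \<longleftrightarrow>
    (\<forall>X f. X \<in> Ob C \<longrightarrow> (\<forall>i<n. f i \<in> preds X) \<longrightarrow> j \<cdot> eval_at X f t = tt C X)" (is "_ \<longleftrightarrow> ?R")
proof -
  let ?P = "Omega_pow C n"
  have tP: "interp C n t \<in> preds ?P" using interp_in[OF t] .
  have cl: "classifies C (interp C n t) (axiom_equalizer C n t)" using axiom_equalizer_classifies[OF t] .
  have Ce: "Cod C (axiom_equalizer C n t) = ?P" using homD[OF classified_hom[OF cl tP]] by simp
  have id: "Ide C ?P \<in> hom C ?P ?P" using ide_in[OF power_Ob] .
  have "dense C j (axiom_equalizer C n t) \<longleftrightarrow> j \<cdot> interp C n t = tt C ?P"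
    unfolding dense_iff Ce using cl classifier_unique by metis
  also have "\<dots> \<longleftrightarrow> ?R"
  proof
    assume eq: "j \<cdot> interp C n t = tt C ?P"
    show ?R
    proof (intro allI impI)
      fix X f assume X: "X \<in> Ob C" and f: "\<forall>i<n. f i \<in> preds X"
      then obtain h where h: "h \<in> hom C X ?P" "\<forall>i<n. proj C n i \<cdot> h = f i"
        using tuple_ex[of X n f] by blast
      have "eval_at X f t = eval_at X (\<lambda>i. proj C n i \<cdot> h) t"
        using h t by (intro heval_cong) auto
      then show "j \<cdot> eval_at X f t = tt C X"
        using interp_cmp[OF h(1) t] tt_cmp[OF h(1)] eq j_assoc[OF tP h(1)] by simp
    qed
  next
    assume R: ?R
    have p: "\<forall>i<n. proj C n i \<cdot> Ide C ?P \<in> preds ?P" using cmp_in[OF id] proj_in by blast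
    have "j \<cdot> (interp C n t \<cdot> Ide C ?P) = tt C ?P"
      unfolding interp_cmp[OF id t] using R[rule_format, OF power_Ob, of "\<lambda>i. proj C n i \<cdot> Ide C ?P"] p by blast
    then show "j \<cdot> interp C n t = tt C ?P" using ide_right[OF tP] by simp
  qed
  finally show ?thesis .
qed

lemma open_heval:
  assumes "implicationally_open C j \<or> (weakly_open C j \<and> imp_free t)"
    and X: "X \<in> Ob C" and v: "\<And>i. i \<in> vars t \<Longrightarrow> v i \<in> preds X"
  shows "closed_eval_at X (\<lambda>i. j \<cdot> v i) t = j \<cdot> eval_at X v t"
proof -
  interpret NX: nucleus "preds X" "elem_le C" "\<lambda>f. j \<cdot> f" by (rule nucleus_preds[OF X])
  show ?thesis
  proof (rule NX.heval_closed_open)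
    show "j \<cdot> neg_at X a = imp_at X (j \<cdot> a) (j \<cdot> bot_at X)" if "a \<in> preds X" for a
      using assms(1) implicationally_open_himp[OF _ that NX.bot_in] weakly_open_hneg[OF _ that] by blast
    show "imp_free t \<or> (\<forall>a\<in>preds X. \<forall>b\<in>preds X.
        j \<cdot> imp_at X a b = imp_at X (j \<cdot> a) (j \<cdot> b))"
      using assms(1) implicationally_open_himp by blast
  qed (rule v)
qed

text \<open>For open \<open>j\<close> the closure of the term at \<open>f\<close> is the term, with closed operations, at \<open>j f\<close>.  Validity in
  \<open>sh\<^sub>j(E)\<close> only concerns closed predicates on sheaves, whereas density concerns all objects.  The gap is
  closed by the generic case: closed predicates on any object are the substitution instances of those on a
  power of the sheaf of closed truth values.\<close>
theorem open_dense_iff_satisfies: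
  assumes op: "implicationally_open C j \<or> (weakly_open C j \<and> imp_free t)" and t: "vars t \<subseteq> {..<n}"
  shows "dense C j (axiom_equalizer C n t) \<longleftrightarrow> satisfies (Sh C j) n t"
  unfolding dense_axiom_iff[OF t] satisfies_Sh_iff[OF t]
proof (intro iffI allI impI)
  fix F f assume R: "\<forall>X f. X \<in> Ob C \<longrightarrow> (\<forall>i<n. f i \<in> preds X) \<longrightarrow> j \<cdot> eval_at X f t = tt C X"
    and F: "sheaf C j F" and f: "\<forall>i<n. f i \<in> closed_preds F"
  have fi: "f i \<in> preds F" "j \<cdot> f i = f i" if "i < n" for i using f that by (simp_all add: closed_preds_iff)
  have "closed_eval_at F f t = closed_eval_at F (\<lambda>i. j \<cdot> f i) t"
    using fi(2) t by (intro heval_cong) auto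
  also have "\<dots> = j \<cdot> eval_at F f t"
    using fi(1) t by (intro open_heval[OF op sheaf_Ob[OF F]]) auto
  also have "\<dots> = tt C F" using R sheaf_Ob[OF F] fi(1) by blast
  finally show "closed_eval_at F f t = tt C F" .
next
  fix X f assume R: "\<forall>F f. sheaf C j F \<longrightarrow> (\<forall>i<n. f i \<in> closed_preds F) \<longrightarrow>
      closed_eval_at F f t = tt C F"
    and X: "X \<in> Ob C" and f: "\<forall>i<n. f i \<in> preds X"
  obtain e where em: "monic C e" and Ce: "Cod C e = Omega C" and eS: "sheaf C j (Dom C e)"
    and fac: "\<And>X f. f \<in> closed_preds X \<longleftrightarrow> (\<exists>g\<in>hom C X (Dom C e). e \<cdot> g = f)"
    using ex_closed_truth_values by blast
  have eh: "e \<in> preds (Dom C e)" using monic_hom[OF em] Ce by simp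
  obtain Q q where Q: "is_product C n (\<lambda>_. Dom C e) Q q"
    using finite_products[of n "\<lambda>_. Dom C e"] sheaf_Ob[OF eS] by blast
  have QS: "sheaf C j Q" by (rule product_sheaf[OF Q]) (rule eS)
  have q: "q i \<in> hom C Q (Dom C e)" if "i < n" for i using Q that by (simp add: is_product_def)
  have eq: "e \<cdot> q i \<in> closed_preds Q" if "i < n" for i using fac q[OF that] by blast
  have Qtt: "closed_eval_at Q (\<lambda>i. e \<cdot> q i) t = tt C Q"
    using R[rule_format, OF QS, of "\<lambda>i. e \<cdot> q i"] eq by simp
  define g where "g i = (SOME g. g \<in> hom C X (Dom C e) \<and> e \<cdot> g = j \<cdot> f i)" for i
  have g: "g i \<in> hom C X (Dom C e) \<and> e \<cdot> g i = j \<cdot> f i" if "i < n" for i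
    unfolding g_def by (rule someI_ex) (use fac j_closed_preds f that in blast)
  have "\<exists>!h. h \<in> hom C X Q \<and> (\<forall>i<n. q i \<cdot> h = g i)"
    using Q[unfolded is_product_def, THEN conjunct2, THEN conjunct2, rule_format, OF X, of g] g by simp
  then obtain h where h: "h \<in> hom C X Q" "\<forall>i<n. q i \<cdot> h = g i" by (elim ex1E conjE)
  have eqh: "(e \<cdot> q i) \<cdot> h = j \<cdot> f i" if "i < n" for i
    using cmp_assoc'[OF h(1) q[OF that] eh] h(2) g that by simp
  have "j \<cdot> eval_at X f t = closed_eval_at X (\<lambda>i. j \<cdot> f i) t"
    using f t by (intro open_heval[OF op X, symmetric]) auto
  also have "\<dots> = closed_eval_at X (\<lambda>i. (e \<cdot> q i) \<cdot> h) t"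
    using eqh t by (intro heval_cong) auto
  also have "\<dots> = closed_eval_at Q (\<lambda>i. e \<cdot> q i) t \<cdot> h"
    using eq t by (intro heval_closed_cmp[OF h(1), symmetric]) auto
  also have "\<dots> = tt C X" using Qtt tt_cmp[OF h(1)] by simp
  finally show "j \<cdot> eval_at X f t = tt C X" .
qed

text \<open>For dense subtoposes (\<open>j 0 = 0\<close>) the form of the term replaces openness.\<close>
theorem dense_satisfies:
  assumes bot: "\<And>X. X \<in> Ob C \<Longrightarrow> j \<cdot> bot_at X = bot_at X"
    and t: "vars t \<subseteq> {..<n}" "disjunctive t" and dense: "dense C j (axiom_equalizer C n t)"
  shows "satisfies (Sh C j) n t"
  unfolding satisfies_Sh_iff[OF t(1)]
proof (intro allI impI)
  fix F f assume F: "sheaf C j F" and f: "\<forall>i<n. f i \<in> closed_preds F"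
  have FO: "F \<in> Ob C" using sheaf_Ob[OF F] .
  interpret N: nucleus "preds F" "elem_le C" "\<lambda>f. j \<cdot> f" by (rule nucleus_preds[OF FO])
  have "closed_eval_at F f t = j \<cdot> eval_at F f t"
    using f t by (intro N.heval_closed_disjunctive bot FO) auto
  also have "\<dots> = tt C F" using dense FO f N.closed_in unfolding dense_axiom_iff[OF t(1)] by blast
  finally show "closed_eval_at F f t = tt C F" .
qed

end

section \<open>Double negation\<close>

context elementary_topos
begin

lemma double_neg_cmp: "f \<in> preds X \<Longrightarrow> double_neg C \<cdot> f = neg_at X (neg_at X f)"
  using cmp_assoc'[OF _ neg_op_in neg_op_in] hneg_preds cmp_in[OF _ neg_op_in] unfolding double_neg_def by metis

lemma double_neg_local_operator: "local_operator C (double_neg C)"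
proof -
  let ?d = "double_neg C" and ?P = "Omega_pow C 2"
  have d: "?d \<in> preds (Omega C)" unfolding double_neg_def using cmp_in neg_op_in by blast
  have id: "Ide C (Omega C) \<in> preds (Omega C)" using ide_in[OF Omega_Ob] .
  interpret H1: heyting_poset "preds (one C)" "elem_le C" by (rule heyting_preds[OF one_Ob])
  interpret HO: heyting_poset "preds (Omega C)" "elem_le C" by (rule heyting_preds[OF Omega_Ob])
  interpret HP: heyting_poset "preds ?P" "elem_le C" by (rule heyting_preds[OF power_Ob])
  have p: "proj C 2 0 \<in> preds ?P" "proj C 2 1 \<in> preds ?P" by (simp_all add: proj_in)
  have truth: "?d \<cdot> truth C = truth C"
    using double_neg_cmp[OF truth_in] H1.not_not_top by (simp add: truth_eq_tt htop_preds[OF one_Ob])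
  have "?d \<cdot> ?d = ?d"
  proof -
    have "?d = neg_at (Omega C) (neg_at (Omega C) (Ide C (Omega C)))"
      using double_neg_cmp[OF id] ide_right[OF d] by simp
    then show ?thesis using double_neg_cmp[OF d] HO.not_not_idem[OF id] by metis
  qed
  moreover have "?d \<cdot> and_op C = and_op C \<cdot> pair C (?d \<cdot> proj C 2 0) (?d \<cdot> proj C 2 1)"
  proof -
    have idP: "Ide C ?P \<in> hom C ?P ?P" using ide_in[OF power_Ob] .
    have "pair C (proj C 2 0) (proj C 2 1) = Ide C ?P"
      using pair_eqI[OF idP ide_right[OF p(1)] ide_right[OF p(2)]] by simp
    then have a: "and_op C = meet_at ?P (proj C 2 0) (proj C 2 1)"
      using hmeet_preds[OF p] ide_right[OF op_in(1)] by simp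
    have "?d \<cdot> and_op C = neg_at ?P (neg_at ?P (meet_at ?P (proj C 2 0) (proj C 2 1)))"
      using double_neg_cmp[OF op_in(1)] a by simp
    also have "\<dots> = meet_at ?P (?d \<cdot> proj C 2 0) (?d \<cdot> proj C 2 1)"
      using HP.not_not_meet[OF p] double_neg_cmp[OF p(1)] double_neg_cmp[OF p(2)] by (simp del: One_nat_def)
    also have "\<dots> = and_op C \<cdot> pair C (?d \<cdot> proj C 2 0) (?d \<cdot> proj C 2 1)"
      using hmeet_preds[OF cmp_in[OF p(1) d] cmp_in[OF p(2) d]] .
    finally show ?thesis .
  qed
  ultimately show ?thesis using d truth unfolding local_operator_def by blast
qed

text \<open>Density passes to larger local operators, because \<open>k a\<close> is true as soon as the smaller \<open>j a\<close> is.\<close>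
lemma L_topology_le_iff:
  assumes L: "is_L_topology C n t jL" and t: "vars t \<subseteq> {..<n}" and k: "local_operator C k"
  shows "local_le C jL k \<longleftrightarrow> dense C k (axiom_equalizer C n t)"
proof
  assume le: "local_le C jL k"
  have jL: "local_operator C jL" and dense: "dense C jL (axiom_equalizer C n t)"
    using L by (simp_all add: is_L_topology_def)
  interpret J: topos_operator C jL by unfold_locales (rule jL)
  interpret K: topos_operator C k by unfold_locales (rule k)
  show "dense C k (axiom_equalizer C n t)"
    unfolding K.dense_axiom_iff[OF t]
  proof (intro allI impI)
    fix X f assume X: "X \<in> Ob C" and f: "\<forall>i<n. f i \<in> preds X"
    let ?a = "eval_at X f t"
    have a: "?a \<in> preds X" using f t by (intro heyting_poset.heval_in[OF heyting_preds[OF X]]) auto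
    have "jL \<cdot> ?a = tt C X" using dense X f unfolding J.dense_axiom_iff[OF t] by blast
    then have "elem_le C (tt C X) (k \<cdot> ?a)" using le X a unfolding local_le_def by metis
    then show "k \<cdot> ?a = tt C X" using elem_le_tt K.j_cmp_in[OF a] by blast
  qed
qed (use L k in \<open>auto simp: is_L_topology_def\<close>)

lemma dense_double_neg:
  assumes t: "vars t \<subseteq> {..<n}" and pr: "provable {Or (Var 0) (Neg (Var 0))} t"
  shows "dense C (double_neg C) (axiom_equalizer C n t)"
proof -
  interpret K: topos_operator C "double_neg C" by unfold_locales (rule double_neg_local_operator)
  show ?thesis
    unfolding K.dense_axiom_iff[OF t]
  proof (intro allI impI)
    fix X f assume X: "X \<in> Ob C" and f: "\<forall>i<n. f i \<in> preds X"
    interpret H: heyting_poset "preds X" "elem_le C" by (rule heyting_preds[OF X])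
    \<comment> \<open>Valuations of formulas in further variables need some value beyond \<open>n\<close>.\<close>
    let ?g = "\<lambda>i. if i < n then f i else tt C X"
    have g: "?g i \<in> preds X" for i using f tt_in[OF X] by simp
    have eq: "eval_at X f t = eval_at X ?g t"
      using t by (intro heval_cong) auto
    have "eval_at X ?g t \<in> preds X" using g by (intro H.heval_in)
    then show "double_neg C \<cdot> eval_at X f t = tt C X"
      unfolding eq using H.glivenko[OF pr g] double_neg_cmp htop_preds[OF X] by simp
  qed
qed

end

lemma subst_Var: "subst Var t = t"
  by (induction t) auto

theorem proposition4p4:
  fixes C :: "('o, 'a) cat" and n :: nat and \<phi> :: hterm and jL :: 'a
  assumes "elementary_topos C"
    and "vars \<phi> \<subseteq> {..<n}"
    and "intermediate_logic (logic {\<phi>})"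
    and "disjunctive \<phi>"
    and "is_L_topology C n \<phi> jL"
  shows "local_le C jL (double_neg C) \<and>
    satisfies (Sh C jL) n \<phi> \<and>
    (\<forall>j. implicationally_open C j \<or> (weakly_open C j \<and> imp_free \<phi>) \<longrightarrow>
       (local_le C jL j \<longleftrightarrow> satisfies (Sh C j) n \<phi>))"
proof -
  interpret T: elementary_topos C by (rule assms(1))
  have jL: "local_operator C jL" and dense: "dense C jL (axiom_equalizer C n \<phi>)"
    using assms(5) by (simp_all add: is_L_topology_def)
  interpret J: topos_operator C jL by unfold_locales (rule jL)
  \<comment> \<open>The axiom itself belongs to the logic that it presents.\<close>
  have "provable {\<phi>} (subst Var \<phi>)" by (rule provable.scheme) simp
  then have "provable {Or (Var 0) (Neg (Var 0))} \<phi>"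
    using assms(3) unfolding intermediate_logic_def logic_def subst_Var by blast
  then have le: "local_le C jL (double_neg C)"
    using T.dense_double_neg[OF assms(2)] T.L_topology_le_iff[OF assms(5,2) T.double_neg_local_operator] by blast
  \<comment> \<open>\<open>j 0 \<le> \<not>\<not> 0 = 0\<close>.\<close>
  have bot: "jL \<cdot>\<^bsub>C\<^esub> hbot (hom C X (Omega C)) (elem_le C) = hbot (hom C X (Omega C)) (elem_le C)" if X: "X \<in> Ob C" for X
  proof -
    interpret N: nucleus "hom C X (Omega C)" "elem_le C" "\<lambda>f. jL \<cdot>\<^bsub>C\<^esub> f" by (rule J.nucleus_preds[OF X])
    have "elem_le C (jL \<cdot>\<^bsub>C\<^esub> N.Bot) (N.Not (N.Not N.Bot))"
      using le X N.bot_in T.double_neg_cmp[OF N.bot_in] unfolding local_le_def by metis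
    moreover have "N.Not N.Bot = N.Top" by (simp add: N.imp_eq_top_iff N.refl)
    moreover have "N.Not N.Top = N.Bot"
      using N.imp_elim[of N.Top N.Bot "N.Not N.Top"] by (intro N.antisym) (simp_all add: N.refl)
    ultimately show ?thesis by (intro N.antisym) simp_all
  qed
  have "satisfies (Sh C jL) n \<phi>" by (rule J.dense_satisfies[OF bot assms(2,4) dense])
  moreover have "local_le C jL j \<longleftrightarrow> satisfies (Sh C j) n \<phi>"
    if op: "implicationally_open C j \<or> (weakly_open C j \<and> imp_free \<phi>)" for j
  proof -
    have j: "local_operator C j" using op by (auto simp: implicationally_open_def weakly_open_def)
    interpret K: topos_operator C j by unfold_locales (rule j)
    show ?thesis using T.L_topology_le_iff[OF assms(5,2) j] K.open_dense_iff_satisfies[OF op assms(2)] by blast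
  qed
  ultimately show ?thesis using le by blast
qed

end
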